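(* Let $K$ be a number field, $q$ the rank of $\mathcal{O}_K^\times$, and let $\widetilde{S}$, $D$, $\mathscr{C}^{\max}(D)$ and the constants $\alpha_{\boldsymbol{B}}(\widetilde{S})$ be as defined in the context. Let $$\alpha = \frac{1}{q!^2} \int_{\substack{t_1,t_2 \ge 0\\ t_1+t_2 \le 1}} (1-t_1-t_2)^q \,\mathrm{d} t_1 \,\mathrm{d} t_2 = \frac{1}{q!\,(q+2)!}.$$ Then $$\alpha = \sum_{\boldsymbol{B}\in \mathscr{C}^{\max}(D)}\alpha_{\boldsymbol{B}}(\widetilde{S}).$$
   Context: $K$ is a number field with set of archimedean places $\Omega_\infty$ of cardinality $q+1$. The surface: $S\subset\mathbb{P}^4_K$ is the singular quartic del Pezzo surface $x_0x_3-x_2x_4 = x_0x_1 + x_1x_3 + x_2^2 = 0$, and $\widetilde{S}\to S$ is its minimal desingularization. Concretely, $\widetilde{S}$ is the following blow-up of $\mathbb{P}^2_K$ with coordinates $(u:v:w)$: blow up $p_1=(0:1:-1)$ with exceptional curve $E_1$; blow up the intersection of $E_1$ with the strict transform of $\{v+w=0\}$, with exceptional curve $E_2$; blow up the intersection of $E_2$ with the strict transform of $\{v+w=0\}$, with exceptional curve $E_3$; blow up $(0:1:0)$ with exceptional curve $E_4$; blow up $(0:0:1)$ with exceptional curve $E_5$. Denote by $A_1=E_5$, $A_2=E_4$, $A_3$ = strict transform of $E_1$, $A_4$ = strict transform of $E_2$, $A_5=E_3$, and $A_6,A_7,A_8,A_9$ the strict transforms of $\{u=0\}$, $\{v+w=0\}$,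 $\{w=0\}$, $\{v=0\}$, respectively. With $l_0$ the pullback of the class of a line and $l_1,\dots,l_5$ the classes of the total transforms of the five exceptional curves (a basis of $\operatorname{Pic}\widetilde S\cong\mathbb{Z}^6$), the classes $[A_1],\dots,[A_9]$ are $$l_5,\ l_4,\ l_1-l_2,\ l_2-l_3,\ l_3,\ l_0-l_1-l_4-l_5,\ l_0-l_1-l_2-l_3,\ l_0-l_4,\ l_0-l_5 .$$ The boundary is $D=A_3+A_4+A_5+A_6+A_7$, and $U=\widetilde{S}\setminus D$. Clemens complex: for each archimedean place $v$, the $K_v$-analytic Clemens complex $\mathscr{C}_v(D)$ is the path with vertices $A_7, A_5,A_4,A_3,A_6$ (in this order), its four maximal faces being the edges $(57),(45),(34),(36)$, where $(ij)$ joins $A_i$ and $A_j$. Let $\mathscr{C}(D)=\prod_{v\mid\infty}\mathscr{C}_v(D)$; $\mathscr{C}^{\max}(D)$ is the set of its $4^{q+1}$ maximal faces, i.e. tuples $\boldsymbol{B}=(B_v)_{v\mid\infty}$ with each $B_v\in\{(57),(45),(34),(36)\}$. Write $A_i\prec (jk)$ if $i\in\{j,k\}$. Constants: for an edge $B$, let $U_B=\widetilde{S}\setminus\bigcup_{i\in\{3,\dots,7\},\,A_i\nprec B}A_i$. For $\boldsymbol{B}\in\mathscr{C}^{\max}(D)$, let $\operatorname{Pic}(U;\boldsymbol{B})$ be the fiber product over $\operatorname{Pic}U$ (via restriction) of the groups $\operatorname{Pic}U_{B_v}$, $v\mid\infty$; it is free of rank $2(q+1)+1=2q+3$. Let $\operatorname{Eff}(U;\boldsymbol{B})\subset\operatorname{Pic}(U;\boldsymbol{B})_{\mathbb{R}}$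 be the effective cone, generated by the classes of tuples $(E_v)_{v\mid\infty}$ of effective divisors $E_v$ on $U_{B_v}$ all having the same restriction to $U$; equivalently, generated by $([A_1]_{U_{B_v}})_v$, $([A_2]_{U_{B_v}})_v$, and the classes with entry $[A_i]_{U_{B_{v}}}$ at one place $v$ with $A_i\prec B_v$ and entry $0$ at all other places. Let $\operatorname{Eff}(U;\boldsymbol{B})^\vee\subset \operatorname{Pic}(U;\boldsymbol{B})_{\mathbb{R}}^\vee$ be the dual cone, $-\boldsymbol{K}_D=([-K_{\widetilde{S}}-D]_{U_{B_v}})_{v\mid\infty}$ the log anticanonical class, and $$P_{\boldsymbol{B}}=\{E\in\operatorname{Eff}(U;\boldsymbol{B})^\vee : \langle-\boldsymbol{K}_D,E\rangle\le 1\}.$$ Then $$\alpha_{\boldsymbol{B}}(\widetilde{S})=(2q+3)\operatorname{vol}(P_{\boldsymbol{B}}),$$ where the volume is with respect to the Lebesgue measure on $\operatorname{Pic}(U;\boldsymbol{B})_{\mathbb{R}}^\vee$ normalized so that the dual lattice of $\operatorname{Pic}(U;\boldsymbol{B})$ has covolume $1$. *)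

theory Defs
  imports
    "HOL-Analysis.Analysis"
    "HOL-Algebra.Free_Abelian_Groups"
    "HOL-Computational_Algebra.Polynomial"
begin

section \<open>Number fields\<close>

definition is_number_field :: "'k::field_char_0 itself \<Rightarrow> bool" where
  "is_number_field _ \<longleftrightarrow>
     (\<exists>B. finite B \<and> (\<forall>x::'k. \<exists>c::'k \<Rightarrow> rat. x = (\<Sum>b\<in>B. of_rat (c b) * b)))"

definition is_absolute_value :: "('k::field \<Rightarrow> real) \<Rightarrow> bool" where
  "is_absolute_value f \<longleftrightarrow>
     (\<forall>x. 0 \<le> f x) \<and> (\<forall>x. f x = 0 \<longleftrightarrow> x = 0) \<and>
     (\<forall>x y. f (x * y) = f x * f y) \<and> (\<forall>x y. f (x + y) \<le> f x + f y)"

definition archimedean_absolute_values :: "('k::field \<Rightarrow> real) set" where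
  "archimedean_absolute_values =
     {f. is_absolute_value f \<and> \<not> (\<forall>x y. f (x + y) \<le> max (f x) (f y))}"

definition absolute_value_equiv :: "(('k::field \<Rightarrow> real) \<times> ('k \<Rightarrow> real)) set" where
  "absolute_value_equiv =
     {(f, g). f \<in> archimedean_absolute_values \<and> g \<in> archimedean_absolute_values \<and>
              (\<exists>s>0. \<forall>x. g x = f x powr s)}"

definition archimedean_places :: "('k::field \<Rightarrow> real) set set" where
  "archimedean_places = archimedean_absolute_values // absolute_value_equiv"

definition ring_of_integers_units :: "'k::field_char_0 set" where
  "ring_of_integers_units = {x. x \<noteq> 0 \<and> algebraic_int x \<and> algebraic_int (inverse x)}"

definition unit_rank :: "'k::field_char_0 itself \<Rightarrow> nat" where
  "unit_rank _ = Sup (card ` {F. finite F \<and> F \<subseteq> (ring_of_integers_units :: 'k set) \<and>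
     (\<forall>e::'k \<Rightarrow> int. (\<Prod>x\<in>F. x powi e x) = 1 \<longrightarrow> (\<forall>x\<in>F. e x = 0))})"


section \<open>The blown-up projective plane\<close>

text \<open>
  \<open>K[u,v,w]\<close> is the iterated polynomial ring \<open>K[w][v][u]\<close>, so \<open>coeff (coeff (coeff g i) j) k\<close>
  is the coefficient of \<open>u^i v^j w^k\<close>.
\<close>

type_synonym 'k poly3 = "'k poly poly poly"

definition form_u :: "'k::field poly3" where "form_u = [:0, 1:]"
definition form_v :: "'k::field poly3" where "form_v = [:[:0, 1:]:]"
definition form_w :: "'k::field poly3" where "form_w = [:[:[:0, 1:]:]:]"

definition is_form :: "nat \<Rightarrow> 'k::field poly3 \<Rightarrow> bool" where
  "is_form d g \<longleftrightarrow> (\<forall>i j k. coeff (coeff (coeff g i) j) k \<noteq> 0 \<longrightarrow> i + j + k = d)"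

text \<open>
  Each exceptional curve is the locus \<open>s = 0\<close> in an affine chart with coordinate ring
  \<open>K[s,t] = K[t][s]\<close> (the outer variable is \<open>s\<close>).
\<close>

definition chart_s :: "'k::field poly poly" where "chart_s = [:0, 1:]"
definition chart_t :: "'k::field poly poly" where "chart_t = [:[:0, 1:]:]"

definition subst_form ::
  "'k::field poly3 \<Rightarrow> 'k poly poly \<Rightarrow> 'k poly poly \<Rightarrow> 'k poly poly \<Rightarrow> 'k poly poly" where
  "subst_form g a b c =
     poly (map_poly (\<lambda>p. poly (map_poly (\<lambda>r. poly (map_poly (\<lambda>z. [:[:z:]:]) r) c) p) b) g) a"

text \<open>
  The blow-up maps in these charts. Near \<open>(0:1:-1)\<close> take \<open>v = 1\<close>, with local coordinates \<open>u\<close> and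
  \<open>v + w\<close>; the \<open>k\<close>-th of the first three blow-ups has a chart \<open>u = s\<close>, \<open>v + w = s^k t\<close>,
  in which \<open>E\<^sub>k\<close> is \<open>s = 0\<close>, the strict transform of \<open>{v + w = 0}\<close> is \<open>t = 0\<close>, and the
  centre of the next blow-up (if any) is \<open>s = t = 0\<close>. Near \<open>(0:1:0)\<close> and \<open>(0:0:1)\<close> the local
  coordinates are \<open>u, w\<close> and \<open>u, v\<close>.
\<close>

definition blowup_chart :: "nat \<Rightarrow> 'k::field poly3 \<Rightarrow> 'k poly poly" where
  "blowup_chart k g =
     (if k \<in> {1, 2, 3} then subst_form g chart_s 1 (chart_s ^ k * chart_t - 1)
      else if k = 4 then subst_form g chart_s 1 (chart_s * chart_t)
      else subst_form g chart_s (chart_s * chart_t) 1)"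

text \<open>
  The prime divisors of the surface over \<open>K\<close> are the five exceptional curves and the strict
  transforms of the integral plane curves. An integral plane curve is represented by its unique
  equation whose leading coefficient is 1 for the lexicographic order with \<open>u > v > w\<close>.
\<close>

type_synonym 'k prime_divisor = "nat + 'k poly3"

abbreviation Exceptional :: "nat \<Rightarrow> 'k::field prime_divisor" where "Exceptional \<equiv> Inl"
abbreviation Strict :: "'k::field poly3 \<Rightarrow> 'k prime_divisor" where "Strict \<equiv> Inr"

definition prime_divisors :: "'k::field prime_divisor set" where
  "prime_divisors = Exceptional ` {1..5} \<union>
     Strict ` {f. irreducible f \<and> (\<exists>d. is_form d f) \<and>
                  lead_coeff (lead_coeff (lead_coeff f)) = 1}"

text \<open>
  The multiplicity of \<open>f\<close> in \<open>g \<noteq> 0\<close>. (The library's \<open>multiplicity\<close> is restricted to the class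
  \<open>factorial_semiring\<close>, to which polynomials over a type of class \<open>field\<close> need not belong.)
\<close>

definition mult_in :: "'a::comm_semiring_1 \<Rightarrow> 'a \<Rightarrow> nat" where
  "mult_in f g = Max {n. f ^ n dvd g}"

text \<open>The vanishing order of (the pullback of) a nonzero form along a prime divisor.\<close>

fun ord_along :: "'k::field prime_divisor \<Rightarrow> 'k poly3 \<Rightarrow> int" where
  "ord_along (Exceptional k) g = int (mult_in chart_s (blowup_chart k g))"
| "ord_along (Strict f) g = int (mult_in f g)"

text \<open>
  An open subset whose complement is a union of curves is represented by the set \<open>X\<close> of prime
  divisors meeting it. The surface being smooth, the Picard group of the open
  subset is its divisor class group: divisors modulo divisors of rational functions, the latter
  being quotients \<open>g / h\<close> of nonzero forms of equal degree. In \<open>free_Abelian_group\<close> and its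
  quotients the group law is written multiplicatively.
\<close>

definition principal_divisors ::
  "'k::field prime_divisor set \<Rightarrow> ('k prime_divisor \<Rightarrow>\<^sub>0 int) set" where
  "principal_divisors X =
     {d. Poly_Mapping.keys d \<subseteq> X \<and>
         (\<exists>n g h. g \<noteq> 0 \<and> h \<noteq> 0 \<and> is_form n g \<and> is_form n h \<and>
            (\<forall>P\<in>X. Poly_Mapping.lookup d P = ord_along P g - ord_along P h))}"

definition effective_divisors ::
  "'k::field prime_divisor set \<Rightarrow> ('k prime_divisor \<Rightarrow>\<^sub>0 int) set" where
  "effective_divisors X =
     {d. Poly_Mapping.keys d \<subseteq> X \<and> (\<forall>P. 0 \<le> Poly_Mapping.lookup d P)}"

definition Pic :: "'k::field prime_divisor set \<Rightarrow> ('k prime_divisor \<Rightarrow>\<^sub>0 int) set monoid" where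
  "Pic X = free_Abelian_group X Mod principal_divisors X"

definition divisor_class ::
  "'k::field prime_divisor set \<Rightarrow> ('k prime_divisor \<Rightarrow>\<^sub>0 int) \<Rightarrow> ('k prime_divisor \<Rightarrow>\<^sub>0 int) set" where
  "divisor_class X d = principal_divisors X #>\<^bsub>free_Abelian_group X\<^esub> d"

definition restrict_divisor ::
  "'k::field prime_divisor set \<Rightarrow> ('k prime_divisor \<Rightarrow>\<^sub>0 int) \<Rightarrow> ('k prime_divisor \<Rightarrow>\<^sub>0 int)" where
  "restrict_divisor X = frag_extend (\<lambda>P. if P \<in> X then frag_of P else 0)"

text \<open>The union below is over a set of equal classes.\<close>

definition restrict_class ::
  "'k::field prime_divisor set \<Rightarrow> ('k prime_divisor \<Rightarrow>\<^sub>0 int) set \<Rightarrow> ('k prime_divisor \<Rightarrow>\<^sub>0 int) set" where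
  "restrict_class X C = (\<Union>d\<in>C. divisor_class X (restrict_divisor X d))"


section \<open>Boundary and log anticanonical class\<close>

text \<open>The curves $A_1, \ldots, A_9$.\<close>

definition curve_A :: "nat \<Rightarrow> 'k::field prime_divisor" where
  "curve_A i = [Exceptional 5, Exceptional 4, Exceptional 1, Exceptional 2, Exceptional 3,
                Strict form_u, Strict (form_v + form_w), Strict form_w, Strict form_v] ! (i - 1)"

definition boundary :: "'k::field prime_divisor \<Rightarrow>\<^sub>0 int" where
  "boundary = (\<Sum>i\<in>{3..7}. frag_of (curve_A i))"

definition open_U :: "'k::field prime_divisor set" where
  "open_U = prime_divisors - curve_A ` {3..7}"

text \<open>
  \<open>total_l 0\<close> is the pullback of the line \<open>{u = 0}\<close>, and \<open>total_l 1, \<dots>, total_l 5\<close> are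
  the total transforms of the five exceptional curves. The second blow-up is centred on \<open>E\<^sub>1\<close>, the third on \<open>E\<^sub>2\<close> but off
  the strict transform of \<open>E\<^sub>1\<close>.
\<close>

definition total_l :: "nat \<Rightarrow> 'k::field prime_divisor \<Rightarrow>\<^sub>0 int" where
  "total_l i =
    [frag_of (Strict form_u) +
       (\<Sum>k\<in>{1..5}. frag_cmul (ord_along (Exceptional k) (form_u :: 'k poly3))
                              (frag_of (Exceptional k))),
     frag_of (Exceptional 1) + frag_of (Exceptional 2) + frag_of (Exceptional 3),
     frag_of (Exceptional 2) + frag_of (Exceptional 3),
     frag_of (Exceptional 3),
     frag_of (Exceptional 4),
     frag_of (Exceptional 5)] ! i"

text \<open>The canonical divisor of an iterated blow-up of the plane in five points.\<close>

definition canonical_divisor :: "'k::field prime_divisor \<Rightarrow>\<^sub>0 int" where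
  "canonical_divisor = frag_cmul (- 3) (total_l 0) + (\<Sum>i\<in>{1..5}. total_l i)"

definition log_anticanonical_divisor :: "'k::field prime_divisor \<Rightarrow>\<^sub>0 int" where
  "log_anticanonical_divisor = - canonical_divisor - boundary"


section \<open>Clemens complex\<close>

text \<open>
  At every archimedean place the analytic Clemens complex of the boundary is the path through
  $A_7, A_5, A_4, A_3, A_6$; a maximal face is recorded as the set of indices of its two vertices.
\<close>

definition clemens_edges :: "nat set set" where
  "clemens_edges = {{5, 7}, {4, 5}, {3, 4}, {3, 6}}"

definition clemens_max_faces :: "(('k::field \<Rightarrow> real) set \<Rightarrow> nat set) set" where
  "clemens_max_faces = archimedean_places \<rightarrow>\<^sub>E clemens_edges"

definition open_U_edge :: "nat set \<Rightarrow> 'k::field prime_divisor set" where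
  "open_U_edge e = prime_divisors - curve_A ` ({3..7} - e)"


section \<open>The constants\<close>

definition Pic_UB ::
  "(('k::field \<Rightarrow> real) set \<Rightarrow> nat set)
     \<Rightarrow> (('k \<Rightarrow> real) set \<Rightarrow> ('k prime_divisor \<Rightarrow>\<^sub>0 int) set) monoid" where
  "Pic_UB B =
    (let G = product_group archimedean_places (\<lambda>v. Pic (open_U_edge (B v)))
     in G \<lparr>carrier := {c \<in> carrier G. \<forall>v\<in>archimedean_places. \<forall>v'\<in>archimedean_places.
                         restrict_class open_U (c v) = restrict_class open_U (c v')}\<rparr>)"

definition effective_classes ::
  "(('k::field \<Rightarrow> real) set \<Rightarrow> nat set)
     \<Rightarrow> (('k \<Rightarrow> real) set \<Rightarrow> ('k prime_divisor \<Rightarrow>\<^sub>0 int) set) set" where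
  "effective_classes B =
     {(\<lambda>v\<in>archimedean_places. divisor_class (open_U_edge (B v)) (E v)) | E.
        (\<forall>v\<in>archimedean_places. E v \<in> effective_divisors (open_U_edge (B v))) \<and>
        (\<forall>v\<in>archimedean_places. \<forall>v'\<in>archimedean_places.
           restrict_divisor open_U (E v) = restrict_divisor open_U (E v'))}"

definition log_anticanonical_class ::
  "(('k::field \<Rightarrow> real) set \<Rightarrow> nat set) \<Rightarrow> ('k \<Rightarrow> real) set \<Rightarrow> ('k prime_divisor \<Rightarrow>\<^sub>0 int) set" where
  "log_anticanonical_class B =
     (\<lambda>v\<in>archimedean_places. divisor_class (open_U_edge (B v))
        (restrict_divisor (open_U_edge (B v)) log_anticanonical_divisor))"

text \<open>
  For an abelian group \<open>G\<close>, the dual of the real vector space \<open>G \<otimes> \<real>\<close> is \<open>Hom(G, \<real>)\<close>. Only the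
  values of a functional on the carrier matter.
\<close>

definition real_dual :: "('a, 'b) monoid_scheme \<Rightarrow> ('a \<Rightarrow> real) set" where
  "real_dual G = {\<phi>. \<forall>x\<in>carrier G. \<forall>y\<in>carrier G. \<phi> (x \<otimes>\<^bsub>G\<^esub> y) = \<phi> x + \<phi> y}"

text \<open>A functional lies in the dual of the effective cone iff it is nonnegative on the generators.\<close>

definition dual_effective_cone ::
  "(('k::field \<Rightarrow> real) set \<Rightarrow> nat set)
     \<Rightarrow> ((('k \<Rightarrow> real) set \<Rightarrow> ('k prime_divisor \<Rightarrow>\<^sub>0 int) set) \<Rightarrow> real) set" where
  "dual_effective_cone B = {\<phi> \<in> real_dual (Pic_UB B). \<forall>c\<in>effective_classes B. 0 \<le> \<phi> c}"

definition polytope_B ::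
  "(('k::field \<Rightarrow> real) set \<Rightarrow> nat set)
     \<Rightarrow> ((('k \<Rightarrow> real) set \<Rightarrow> ('k prime_divisor \<Rightarrow>\<^sub>0 int) set) \<Rightarrow> real) set" where
  "polytope_B B = {\<phi> \<in> dual_effective_cone B. \<phi> (log_anticanonical_class B) \<le> 1}"

definition is_Z_basis :: "('a, 'b) monoid_scheme \<Rightarrow> nat \<Rightarrow> (nat \<Rightarrow> 'a) \<Rightarrow> bool" where
  "is_Z_basis G n b \<longleftrightarrow>
     b \<in> {..<n} \<rightarrow> carrier G \<and>
     bij_betw (\<lambda>c. finprod G (\<lambda>i. b i [^]\<^bsub>G\<^esub> (c i :: int)) {..<n})
       ({..<n} \<rightarrow>\<^sub>E (UNIV :: int set)) (carrier G)"

text \<open>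
  Evaluation at a \<open>\<int>\<close>-basis of \<open>G\<close> identifies \<open>Hom(G, \<real>)\<close> with \<open>\<real>^n\<close> and the dual lattice
  \<open>Hom(G, \<int>)\<close> with \<open>\<int>^n\<close>, so Lebesgue measure on \<open>\<real>^n\<close> gives the dual lattice covolume 1. Base
  changes lie in \<open>GL(n, \<int>)\<close> and preserve it, so the choice of basis is irrelevant.
\<close>

definition dual_volume :: "('a, 'b) monoid_scheme \<Rightarrow> ('a \<Rightarrow> real) set \<Rightarrow> real" where
  "dual_volume G P =
    (let (n, b) = (SOME (n, b). is_Z_basis G n b)
     in measure (PiM {..<n} (\<lambda>_. lborel)) ((\<lambda>\<phi>. \<lambda>i\<in>{..<n}. \<phi> (b i)) ` P))"

text \<open>
  With \<open>q + 1\<close> archimedean places, the factor is the rank \<open>2 (q + 1) + 1 = 2 q + 3\<close> of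
  \<open>Pic_UB B\<close>.
\<close>

definition alpha_B :: "(('k::field \<Rightarrow> real) set \<Rightarrow> nat set) \<Rightarrow> real" where
  "alpha_B B = real (2 * card (archimedean_places :: ('k \<Rightarrow> real) set set) + 1)
                 * dual_volume (Pic_UB B) (polytope_B B)"

end

theory Submission
  imports Defs "Berlekamp_Zassenhaus.Unique_Factorization_Poly"
begin

text \<open>
  Write \<open>m = q + 1\<close> for the number of archimedean places. The Picard group of the surface is free on
  \<open>A\<^sub>1, A\<^sub>3, A\<^sub>4, A\<^sub>5, A\<^sub>6, A\<^sub>7\<close>, and \<open>A\<^sub>1 + A\<^sub>2 = A\<^sub>4 + 2 A\<^sub>5 - A\<^sub>6 + A\<^sub>7\<close>. In these coordinates, removing
  boundary curves from the surface merely forgets the corresponding coordinates; this is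
  \<open>principal_divisors_eq\<close>, which rests on unique factorisation of forms in three variables. Therefore
  the glued group for a face \<open>B\<close> is free on \<open>A\<^sub>1\<close> and on the two curves of the edge at each place, and a
  functional on it is given by its value \<open>x\<close> on \<open>A\<^sub>1\<close> and its values \<open>z\<^sub>v\<^sub>,\<^sub>i\<close> on the boundary curve \<open>A\<^sub>i\<close> at
  the place \<open>v\<close>.

  Every curve that meets the open set \<open>U\<close> has a class that is a nonnegative combination of
  \<open>A\<^sub>1, \<dots>, A\<^sub>6\<close> (\<open>class_coeff_nonneg\<close>), because a curve of degree \<open>d\<close> other than \<open>A\<^sub>7\<close> vanishes to order at
  most \<open>d\<close> along each exceptional curve. So the dual of the effective cone is cut out by \<open>x \<ge> 0\<close>,
  \<open>z\<^sub>v\<^sub>,\<^sub>i \<ge> 0\<close> and nonnegativity on \<open>A\<^sub>2\<close>.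

  The log anticanonical class is \<open>A\<^sub>3 + 2 A\<^sub>4 + 3 A\<^sub>5 + A\<^sub>7\<close> and exceeds \<open>A\<^sub>1 + A\<^sub>2\<close> by
  \<open>A\<^sub>3 + A\<^sub>4 + A\<^sub>5 + A\<^sub>6\<close>. Let \<open>\<lambda>\<^sub>v\<close> and \<open>\<mu>\<^sub>v\<close> be the values of the functional on the parts of these two
  divisors that are supported on the edge at \<open>v\<close>. For each of the four edges the change from the two
  values \<open>z\<^sub>v\<^sub>,\<^sub>i\<close> to \<open>\<lambda>\<^sub>v, \<mu>\<^sub>v\<close> is unimodular, and the cones \<open>z\<^sub>v\<^sub>,\<^sub>i \<ge> 0\<close> become the four parts into which the
  lines \<open>\<lambda> = 3\<mu>\<close>, \<open>\<lambda> = 2\<mu>\<close>, \<open>\<lambda> = \<mu>\<close> cut the quadrant \<open>\<lambda>, \<mu> \<ge> 0\<close> (\<open>edge_cones_subdivide\<close>). The other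
  conditions read \<open>x \<ge> 0\<close>, \<open>x + \<Sum>\<mu>\<^sub>v \<le> \<Sum>\<lambda>\<^sub>v\<close> and \<open>\<Sum>\<lambda>\<^sub>v \<le> 1\<close> for every face alike
  (\<open>polytope_image\<close>). Hence the polytopes of all faces together subdivide one region, whose volume
  \<open>\<integral>\<^sub>0\<^sup>1 L\<^sup>m\<^sup>-\<^sup>1/(m-1)! \<cdot> L\<^sup>m\<^sup>+\<^sup>1/(m+1)! dL = 1/((2m+1) (m-1)! (m+1)!)\<close> is found by integrating over
  \<open>L = \<Sum>\<lambda>\<^sub>v\<close> (\<open>emeasure_total_region\<close>).

  The volume of a polytope is measured in an unspecified integral basis. That any basis may be used
  is \<open>dual_volume_eq\<close>; it needs the invariance of Lebesgue measure under \<open>GL(n, \<int>)\<close> for a dimension \<open>n\<close>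
  that depends on the number of places, hence on product measures over \<open>{..<n}\<close>
  (\<open>emeasure_mat_apply\<close>).
\<close>

section \<open>Substitution into forms\<close>

text \<open>
  The substitution of \<open>a, b, c\<close> for \<open>u, v, w\<close>, with coefficients mapped by \<open>h\<close>. Blow-up charts,
  evaluation at points and the homogenisation below are all instances, so that the facts on ring
  homomorphisms, scaling and degrees are needed once only.
\<close>
definition subst3 ::
  "('a::comm_ring_1 \<Rightarrow> 'b::comm_ring_1) \<Rightarrow> 'b \<Rightarrow> 'b \<Rightarrow> 'b \<Rightarrow> 'a poly poly poly \<Rightarrow> 'b" where
  "subst3 h a b c g =
     poly (map_poly (\<lambda>p. poly (map_poly (\<lambda>r. poly (map_poly h r) c) p) b) g) a"

abbreviation coeff3 :: "'a::zero poly poly poly \<Rightarrow> nat \<Rightarrow> nat \<Rightarrow> nat \<Rightarrow> 'a" where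
  "coeff3 g i j k \<equiv> coeff (coeff (coeff g i) j) k"

lemma comm_ring_hom_eval:
  assumes "comm_ring_hom h"
  shows "comm_ring_hom (\<lambda>p. poly (map_poly h p) a)"
proof -
  interpret comm_ring_hom h by fact
  interpret m: map_poly_comm_ring_hom h ..
  show ?thesis
    by unfold_locales (auto simp: m.hom_add m.hom_mult)
qed

lemma comm_ring_hom_subst3:
  assumes "comm_ring_hom h"
  shows "comm_ring_hom (subst3 h a b c)"
  unfolding subst3_def[abs_def] using assms by (intro comm_ring_hom_eval)

lemma poly_map_poly_sum:
  fixes h :: "'a::zero \<Rightarrow> 'b::comm_semiring_1"
  assumes "degree p \<le> N" "h 0 = 0"
  shows "poly (map_poly h p) x = (\<Sum>i\<le>N. h (coeff p i) * x ^ i)"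
proof -
  have le: "degree (map_poly h p) \<le> N"
    using assms(1) degree_map_poly_le order_trans by blast
  have "poly (map_poly h p) x = (\<Sum>i\<le>N. coeff (map_poly h p) i * x ^ i)"
    unfolding poly_altdef using le by (intro sum.mono_neutral_left) (auto simp: coeff_eq_0)
  then show ?thesis
    using assms(2) by (simp add: coeff_map_poly)
qed

lemma subst3_sum:
  assumes h: "comm_ring_hom h"
    and N: "\<forall>i j k. coeff3 g i j k \<noteq> 0 \<longrightarrow> i \<le> N \<and> j \<le> N \<and> k \<le> N"
  shows "subst3 h a b c g = (\<Sum>i\<le>N. \<Sum>j\<le>N. \<Sum>k\<le>N. h (coeff3 g i j k) * a ^ i * b ^ j * c ^ k)"
proof -
  interpret comm_ring_hom h by fact
  have d1: "degree (coeff (coeff g i) j) \<le> N" for i j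
    using N by (intro degree_le) (meson linorder_not_le)
  have d2: "degree (coeff g i) \<le> N" for i
    using N by (intro degree_le allI impI poly_eqI) (metis coeff_0 linorder_not_le)
  have d3: "degree g \<le> N"
    using N by (intro degree_le allI impI poly_eqI) (metis coeff_0 linorder_not_le)
  show ?thesis
    unfolding subst3_def
    by (simp add: poly_map_poly_sum[OF d1] poly_map_poly_sum[OF d2] poly_map_poly_sum[OF d3]
        sum_distrib_left sum_distrib_right mult_ac)
qed

lemma ex_coeff3_bound:
  "\<exists>N. \<forall>i j k. coeff3 g i j k \<noteq> 0 \<longrightarrow> i \<le> N \<and> j \<le> N \<and> k \<le> N"
proof -
  define N2 where "N2 = (\<Sum>i\<le>degree g. degree (coeff g i))"
  define N1 where "N1 = (\<Sum>i\<le>degree g. \<Sum>j\<le>degree (coeff g i). degree (coeff (coeff g i) j))"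
  have "i \<le> degree g + N2 + N1 \<and> j \<le> degree g + N2 + N1 \<and> k \<le> degree g + N2 + N1"
    if nz: "coeff3 g i j k \<noteq> 0" for i j k
  proof -
    have i: "i \<le> degree g" using nz by (metis coeff_0 le_degree)
    have j: "j \<le> degree (coeff g i)" using nz by (metis coeff_0 le_degree)
    have k: "k \<le> degree (coeff (coeff g i) j)" using nz by (metis le_degree)
    have "degree (coeff g i) \<le> N2"
      unfolding N2_def using i by (intro member_le_sum) auto
    moreover have "degree (coeff (coeff g i) j) \<le> (\<Sum>j\<le>degree (coeff g i). degree (coeff (coeff g i) j))"
      using j by (intro member_le_sum) auto
    moreover have "(\<Sum>j\<le>degree (coeff g i). degree (coeff (coeff g i) j)) \<le> N1"
      unfolding N1_def using i
      by (rule_tac member_le_sum[where f="\<lambda>i. \<Sum>j\<le>degree (coeff g i). degree (coeff (coeff g i) j)"]) auto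
    ultimately show ?thesis using i j k by linarith
  qed
  then show ?thesis by blast
qed

lemma subst3_hom:
  assumes h: "comm_ring_hom h" and E: "comm_ring_hom E"
  shows "E (subst3 h a b c g) = subst3 (\<lambda>x. E (h x)) (E a) (E b) (E c) g"
proof -
  interpret h: comm_ring_hom h by fact
  interpret E: comm_ring_hom E by fact
  have Eh: "comm_ring_hom (\<lambda>x. E (h x))"
    by unfold_locales (auto simp: h.hom_add h.hom_mult E.hom_add E.hom_mult)
  obtain N where N: "\<forall>i j k. coeff3 g i j k \<noteq> 0 \<longrightarrow> i \<le> N \<and> j \<le> N \<and> k \<le> N"
    using ex_coeff3_bound[of g] by blast
  show ?thesis
    unfolding subst3_sum[OF h N] subst3_sum[OF Eh N]
    by (simp add: E.hom_sum E.hom_mult E.hom_power)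
qed

lemma subst3_scale:
  assumes h: "comm_ring_hom h" and "is_form d g"
  shows "subst3 h (l * a) (l * b) (l * c) g = l ^ d * subst3 h a b c g"
proof -
  interpret h: comm_ring_hom h by fact
  obtain N where N: "\<forall>i j k. coeff3 g i j k \<noteq> 0 \<longrightarrow> i \<le> N \<and> j \<le> N \<and> k \<le> N"
    using ex_coeff3_bound[of g] by blast
  have "h (coeff3 g i j k) * (l * a) ^ i * (l * b) ^ j * (l * c) ^ k =
        l ^ d * (h (coeff3 g i j k) * a ^ i * b ^ j * c ^ k)" for i j k
  proof (cases "coeff3 g i j k = 0")
    case False
    then have "d = i + j + k" using assms(2) by (auto simp: is_form_def)
    then show ?thesis by (simp add: power_mult_distrib power_add mult_ac)
  qed simp
  then show ?thesis
    unfolding subst3_sum[OF h N]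
    by (simp add: sum_distrib_left)
qed

lemma degree_subst3_le:
  fixes h :: "'k::field \<Rightarrow> 'b::comm_ring_1 poly"
  assumes h: "comm_ring_hom h" and f: "is_form d g" and "\<And>x. degree (h x) = 0"
    and "degree a \<le> 1" "degree b \<le> 1" "degree c \<le> 1"
  shows "degree (subst3 h a b c g) \<le> d"
proof -
  obtain N where N: "\<forall>i j k. coeff3 g i j k \<noteq> 0 \<longrightarrow> i \<le> N \<and> j \<le> N \<and> k \<le> N"
    using ex_coeff3_bound[of g] by blast
  interpret h: comm_ring_hom h by fact
  have p: "degree (x ^ n) \<le> n" if "degree x \<le> 1" for x :: "'b poly" and n
    using degree_power_le[of x n] that by (metis le_trans mult.commute mult_le_mono2 nat_mult_1_right)
  have "degree (h (coeff3 g i j k) * a ^ i * b ^ j * c ^ k) \<le> d" for i j k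
  proof (cases "coeff3 g i j k = 0")
    case False
    then have "d = i + j + k" using f by (auto simp: is_form_def)
    moreover have "degree (h (coeff3 g i j k) * a ^ i * b ^ j * c ^ k) \<le> 0 + i + j + k"
      using p assms by (intro order_trans[OF degree_mult_le] add_mono) auto
    ultimately show ?thesis by simp
  qed simp
  then show ?thesis
    unfolding subst3_sum[OF h N]
    by (intro degree_sum_le) auto
qed

lemma map_poly_nonzero: "h (coeff p i) \<noteq> 0 \<Longrightarrow> h 0 = 0 \<Longrightarrow> map_poly h p \<noteq> 0"
  by (metis coeff_0 coeff_map_poly)

lemma ex_nonroot:
  fixes p :: "'k::field_char_0 poly"
  assumes "p \<noteq> 0"
  shows "\<exists>x. x \<noteq> 0 \<and> poly p x \<noteq> 0"
proof -
  have "finite (insert 0 {x. poly p x = 0})" using poly_roots_finite[OF assms] by simp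
  then show ?thesis using infinite_UNIV_char_0 ex_new_if_finite by blast
qed

lemma comm_ring_hom_id: "comm_ring_hom (\<lambda>x::'a::comm_ring_1. x)"
  by unfold_locales auto

text \<open>
  The ground field is infinite, so one may choose \<open>z\<close>, \<open>y\<close>, \<open>x\<close> in turn outside the finitely many roots
  of a nonzero coefficient.
\<close>
lemma ex_subst3_nonzero:
  fixes g :: "'k::field_char_0 poly3"
  assumes "g \<noteq> 0"
  shows "\<exists>x y z. x \<noteq> 0 \<and> y \<noteq> 0 \<and> z \<noteq> 0 \<and> subst3 (\<lambda>x. x) x y z g \<noteq> 0"
proof -
  obtain i where "coeff g i \<noteq> 0" using assms by (metis coeff_0 poly_eqI)
  moreover obtain j where j: "coeff (coeff g i) j \<noteq> 0" using calculation by (metis coeff_0 poly_eqI)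
  moreover obtain z where z: "z \<noteq> 0" "poly (coeff (coeff g i) j) z \<noteq> 0" using ex_nonroot[OF j] by blast
  let ?h1 = "\<lambda>r. poly (map_poly (\<lambda>x. x) r) z"
  have id: "map_poly (\<lambda>x. x) r = r" for r :: "'k poly" by (simp add: poly_eqI coeff_map_poly)
  have "map_poly ?h1 (coeff g i) \<noteq> 0"
    using z by (intro map_poly_nonzero[of _ _ j]) (auto simp: id)
  then obtain y where y: "y \<noteq> 0" "poly (map_poly ?h1 (coeff g i)) y \<noteq> 0"
    using ex_nonroot by blast
  have "map_poly (\<lambda>p. poly (map_poly ?h1 p) y) g \<noteq> 0"
    using y by (intro map_poly_nonzero[of _ _ i]) auto
  then obtain x where "x \<noteq> 0" "poly (map_poly (\<lambda>p. poly (map_poly ?h1 p) y) g) x \<noteq> 0"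
    using ex_nonroot by blast
  then show ?thesis using y z unfolding subst3_def by blast
qed

lemma subst3_forms [simp]:
  assumes "comm_ring_hom h"
  shows "subst3 h a b c form_u = a" "subst3 h a b c form_v = b" "subst3 h a b c form_w = c"
proof -
  interpret comm_ring_hom h by fact
  show "subst3 h a b c form_u = a" "subst3 h a b c form_v = b" "subst3 h a b c form_w = c"
    by (simp_all add: subst3_def form_u_def form_v_def form_w_def map_poly_pCons)
qed

section \<open>Homogeneity and total degree\<close>

definition const3 :: "'k::field \<Rightarrow> 'k poly3" where "const3 z = [:[:[:z:]:]:]"

lemma comm_ring_hom_const3: "comm_ring_hom const3"
  by unfold_locales (auto simp: const3_def)

lemma const3_monom: "const3 z * form_u ^ i * form_v ^ j * form_w ^ k = monom (monom (monom z k) j) i"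
proof -
  have c: "const3 z = monom (monom (monom z 0) 0) 0" and u: "form_u = monom (monom (monom 1 0) 0) 1"
    and v: "form_v = monom (monom (monom 1 0) 1) 0" and w: "form_w = monom (monom (monom 1 1) 0) 0"
    by (simp_all add: const3_def form_u_def form_v_def form_w_def monom_0 monom_Suc)
  show ?thesis unfolding c u v w
    by (simp add: monom_power mult_monom)
qed

lemma coeff3_monom: "coeff3 (monom (monom (monom z k') j') i') i j k =
    (if k' = k then if j' = j then if i' = i then z else 0 else 0 else 0)"
  by simp

lemma sum3_delta:
  fixes N a b c :: nat
  shows "(\<Sum>i\<le>N. \<Sum>j\<le>N. \<Sum>k\<le>N. if k = c then if j = b then if i = a then F i j k else 0 else 0 else 0)
    = (if a \<le> N \<and> b \<le> N \<and> c \<le> N then F a b c else (0 :: 'a::comm_monoid_add))"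
  by (cases "c \<le> N"; cases "b \<le> N") (simp_all add: sum.delta)

text \<open>
  The image of \<open>g\<close> under \<open>(u, v, w) \<mapsto> (uT, vT, wT)\<close>: the coefficient of \<open>T^n\<close> is the homogeneous part
  of degree \<open>n\<close>. This turns homogeneity into a statement about polynomials in one variable over a
  domain.
\<close>
definition spread :: "'k::field poly3 \<Rightarrow> 'k poly3 poly" where
  "spread g = subst3 (\<lambda>z. [:const3 z:]) (monom form_u 1) (monom form_v 1) (monom form_w 1) g"

lemma comm_ring_hom_pconst: "comm_ring_hom h \<Longrightarrow> comm_ring_hom (\<lambda>z. [:h z:])"
proof -
  assume "comm_ring_hom h"
  then interpret comm_ring_hom h .
  show ?thesis by unfold_locales (auto simp: hom_add hom_mult)
qed

lemma comm_ring_hom_spread: "comm_ring_hom spread"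
  unfolding spread_def[abs_def]
  by (intro comm_ring_hom_subst3 comm_ring_hom_pconst comm_ring_hom_const3)

lemma coeff_spread: "coeff3 (coeff (spread g) n) i j k = (if i + j + k = n then coeff3 g i j k else 0)"
proof -
  obtain N where N: "\<forall>i j k. coeff3 g i j k \<noteq> 0 \<longrightarrow> i \<le> N \<and> j \<le> N \<and> k \<le> N"
    using ex_coeff3_bound[of g] by blast
  have "[:const3 z:] * monom form_u 1 ^ i * monom form_v 1 ^ j * monom form_w 1 ^ k
    = monom (monom (monom (monom z k) j) i) (i + j + k)" for z :: 'a and i j k
    by (simp add: monom_power mult_monom monom_0[symmetric] const3_monom del: monom_0)
  then have "spread g = (\<Sum>i\<le>N. \<Sum>j\<le>N. \<Sum>k\<le>N. monom (monom (monom (monom (coeff3 g i j k) k) j) i) (i + j + k))"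
    unfolding spread_def subst3_sum[OF comm_ring_hom_pconst[OF comm_ring_hom_const3] N] by simp
  then have "coeff3 (coeff (spread g) n) i j k =
     (\<Sum>i'\<le>N. \<Sum>j'\<le>N. \<Sum>k'\<le>N. coeff3 (if i' + j' + k' = n then monom (monom (monom (coeff3 g i' j' k') k') j') i' else 0) i j k)"
    by (simp add: coeff_sum)
  also have "\<dots> = (\<Sum>i'\<le>N. \<Sum>j'\<le>N. \<Sum>k'\<le>N.
     if k' = k then if j' = j then if i' = i then if i' + j' + k' = n then coeff3 g i' j' k' else 0 else 0 else 0 else 0)"
    by (intro sum.cong refl) (simp add: coeff3_monom del: coeff_monom)
  also have "\<dots> = (if i + j + k = n then coeff3 g i j k else 0)"
    using N by (subst sum3_delta) auto
  finally show ?thesis .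
qed

lemma is_form_iff_spread: "is_form d g \<longleftrightarrow> spread g = monom g d"
proof
  assume "is_form d g"
  then show "spread g = monom g d"
    by (intro poly_eqI) (auto simp: coeff_spread is_form_def)
next
  assume "spread g = monom g d"
  then have c: "coeff3 (coeff (monom g d) (i + j + k)) i j k = coeff3 g i j k" for i j k
    using coeff_spread[of g "i + j + k" i j k] by simp
  have "i + j + k = d" if "coeff3 g i j k \<noteq> 0" for i j k
    using that c[of i j k] by (auto split: if_splits)
  then show "is_form d g" by (auto simp: is_form_def)
qed

lemma spread_eq_0_iff [simp]: "spread g = 0 \<longleftrightarrow> g = 0"
proof
  interpret comm_ring_hom spread by (rule comm_ring_hom_spread)
  show "g = 0 \<Longrightarrow> spread g = 0" by simp
  assume "spread g = 0"
  then have "coeff3 g i j k = 0" for i j k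
    using coeff_spread[of g "i + j + k" i j k] by simp
  then show "g = 0" by (intro poly_eqI) simp
qed

definition tdeg :: "'k::field poly3 \<Rightarrow> nat" where "tdeg g = degree (spread g)"

lemma tdeg_form: "is_form d g \<Longrightarrow> g \<noteq> 0 \<Longrightarrow> tdeg g = d"
  by (simp add: tdeg_def is_form_iff_spread degree_monom_eq)

lemma tdeg_mult: "g \<noteq> 0 \<Longrightarrow> h \<noteq> 0 \<Longrightarrow> tdeg (g * h) = tdeg g + tdeg h"
proof -
  interpret comm_ring_hom spread by (rule comm_ring_hom_spread)
  show "g \<noteq> 0 \<Longrightarrow> h \<noteq> 0 \<Longrightarrow> tdeg (g * h) = tdeg g + tdeg h"
    by (simp add: tdeg_def hom_mult degree_mult_eq)
qed

lemma is_form_mult: "is_form d g \<Longrightarrow> is_form e h \<Longrightarrow> is_form (d + e) (g * h)"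
proof -
  interpret comm_ring_hom spread by (rule comm_ring_hom_spread)
  show "is_form d g \<Longrightarrow> is_form e h \<Longrightarrow> is_form (d + e) (g * h)"
    by (simp add: is_form_iff_spread hom_mult mult_monom)
qed

lemma monom_if_order_eq_degree:
  fixes p :: "'a::idom poly"
  assumes "p \<noteq> 0" "Polynomial.order 0 p = degree p"
  shows "p = monom (lead_coeff p) (degree p)"
proof -
  have "monom 1 (degree p) dvd p"
    using order_1[of 0 p] assms by (simp add: monom_altdef)
  then obtain q where q: "p = monom 1 (degree p) * q" by blast
  with assms have "q \<noteq> 0" by auto
  then have "degree q = 0"
    using arg_cong[OF q, of degree] by (simp add: degree_mult_eq monom_eq_0_iff degree_monom_eq)
  then obtain c where c: "q = [:c:]" by (metis degree_eq_zeroE)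
  with q have "p = monom c (degree p)" by (simp add: mult_monom monom_0[symmetric] del: monom_0)
  then show ?thesis by (metis lead_coeff_monom)
qed

text \<open>
  Both the lowest and the highest exponent of \<open>T\<close> in \<open>spread\<close> are additive on products. They agree
  for the product, and the lowest never exceeds the highest, so they agree for each factor.
\<close>
lemma is_form_factor:
  assumes "is_form n (g * h)" "g * h \<noteq> 0"
  shows "is_form (tdeg g) g"
proof -
  interpret comm_ring_hom spread by (rule comm_ring_hom_spread)
  have nz: "g \<noteq> 0" "h \<noteq> 0" using assms by auto
  have le: "Polynomial.order 0 (spread f) \<le> degree (spread f)" if "f \<noteq> 0" for f :: "'a poly3"
    using that by (intro order_degree) simp
  have "Polynomial.order 0 (spread (g * h)) = degree (spread (g * h))"
    using assms by (simp add: is_form_iff_spread degree_monom_eq)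
  then have "Polynomial.order 0 (spread g) = degree (spread g)"
    using le[of g] le[of h] nz by (simp add: hom_mult order_mult degree_mult_eq)
  then have m: "spread g = monom (lead_coeff (spread g)) (tdeg g)"
    using nz unfolding tdeg_def by (intro monom_if_order_eq_degree) auto
  define L where "L = lead_coeff (spread g)"
  have "coeff3 L i j k = coeff3 g i j k" for i j k
    using coeff_spread[of g "i + j + k" i j k] coeff_spread[of g "tdeg g" i j k]
    by (subst (asm) (1 2) m[folded L_def]) (auto split: if_splits)
  then have "L = g" by (intro poly_eqI)
  then show ?thesis using m by (simp add: is_form_iff_spread L_def)
qed

section \<open>Factorisation of forms into plane curves\<close>

definition plane_curves :: "'k::field poly3 set" where
  "plane_curves = {f. irreducible f \<and> (\<exists>d. is_form d f) \<and>
                  lead_coeff (lead_coeff (lead_coeff f)) = 1}"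

lemma is_form_const3: "is_form 0 (const3 c)"
  by (auto simp: is_form_def const3_def coeff_pCons split: nat.splits)

lemma is_form_0_const: "is_form 0 g \<Longrightarrow> g = const3 (coeff3 g 0 0 0)"
  unfolding is_form_def const3_def
  by (intro poly_eqI) (auto simp: coeff_pCons split: nat.splits)

lemma tdeg_0_unit:
  assumes "is_form n g" "g \<noteq> 0" "tdeg g = 0"
  obtains c where "c \<noteq> 0" "g = const3 c" "g dvd 1"
proof -
  have g: "g = const3 (coeff3 g 0 0 0)"
    using assms tdeg_form is_form_0_const by metis
  moreover from this have nz: "coeff3 g 0 0 0 \<noteq> 0" using assms(2) by (auto simp: const3_def)
  moreover from nz have "const3 (coeff3 g 0 0 0) * const3 (1 / coeff3 g 0 0 0) = 1" by (simp add: const3_def)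
  ultimately show ?thesis using that by (metis dvd_triv_left)
qed

lemma plane_curvesD:
  assumes "f \<in> plane_curves"
  shows "irreducible f" "prime_elem f" "is_form (tdeg f) f" "f \<noteq> 0" "tdeg f > 0"
    "lead_coeff (lead_coeff (lead_coeff f)) = 1" "\<not> f dvd 1"
proof -
  show irr: "irreducible f" and f: "lead_coeff (lead_coeff (lead_coeff f)) = 1" using assms by (auto simp: plane_curves_def)
  show "prime_elem f" using irr by simp
  show nz: "f \<noteq> 0" using irr by auto
  show form: "is_form (tdeg f) f" using assms nz by (auto simp: plane_curves_def tdeg_form)
  show "\<not> f dvd 1" using irr by (simp add: irreducible_not_unit)
  then show "tdeg f > 0" using tdeg_0_unit[OF form nz] by blast
qed

lemma tdeg_dvd: "f dvd g \<Longrightarrow> g \<noteq> 0 \<Longrightarrow> tdeg f \<le> tdeg g"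
  by (auto simp: dvd_def tdeg_mult)

lemma tdeg_const: "c \<noteq> 0 \<Longrightarrow> tdeg (const3 c) = 0"
  by (rule tdeg_form[OF is_form_const3]) (simp add: const3_def)

lemma tdeg_unit:
  fixes f :: "'k::field poly3"
  assumes "f dvd 1"
  shows "tdeg f = 0"
proof -
  have "tdeg (1 :: 'k poly3) = 0" using tdeg_const[of "1::'k"] by (simp add: const3_def)
  then show ?thesis using tdeg_dvd[OF assms] by simp
qed

text \<open>
  In a factorisation of a linear form one factor has degree 0, so it is a nonzero constant.
\<close>
lemma irreducible_linear_form:
  assumes "is_form 1 f" "f \<noteq> 0"
  shows "irreducible f"
proof (rule irreducibleI)
  show "f \<noteq> 0" by fact
  have "tdeg f = 1" using assms by (rule tdeg_form)
  then show "\<not> f dvd 1"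
    using tdeg_unit[of f] by auto
  fix a b assume ab: "f = a * b"
  then have "a \<noteq> 0" "b \<noteq> 0" using assms by auto
  with ab \<open>tdeg f = 1\<close> have "tdeg a = 0 \<or> tdeg b = 0" by (auto simp: tdeg_mult)
  moreover have "is_form (tdeg a) a" "is_form (tdeg b) b"
    using assms ab is_form_factor[of 1 a b] is_form_factor[of 1 b a] by (auto simp: mult.commute)
  ultimately show "a dvd 1 \<or> b dvd 1"
    using \<open>a \<noteq> 0\<close> \<open>b \<noteq> 0\<close> by (metis tdeg_0_unit)
qed

text \<open>The normalisation of the leading coefficient makes the equation of a curve unique.\<close>
lemma curve_dvd_curve:
  assumes "f \<in> plane_curves" "f' \<in> plane_curves" "f dvd f'"
  shows "f = f'"
proof -
  obtain a where a: "f' = f * a" using assms(3) by (elim dvdE)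
  note f = plane_curvesD[OF assms(1)] and f' = plane_curvesD[OF assms(2)]
  have "a dvd 1" using irreducibleD[OF f'(1) a] f(7) by blast
  have anz: "a \<noteq> 0" using a f' by auto
  have "is_form (tdeg a) a" using a f' is_form_factor[of _ a f] by (metis mult.commute)
  moreover have "tdeg a = 0"
    using tdeg_unit[OF \<open>a dvd 1\<close>] .
  ultimately obtain c where c: "a = const3 c" using anz tdeg_0_unit by metis
  have "lead_coeff (lead_coeff (lead_coeff f')) = lead_coeff (lead_coeff (lead_coeff f)) * c"
    unfolding a lead_coeff_mult by (simp add: c const3_def)
  then have "c = 1" using f f' by simp
  then show ?thesis using a c by (simp add: const3_def)
qed

text \<open>
  An irreducible factor of a form exists by unique factorisation, is a form by \<open>is_form_factor\<close>,
  and can be normalised by a constant.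
\<close>
lemma ex_curve_dvd:
  fixes g :: "'k::field poly3"
  assumes "is_form n g" "g \<noteq> 0" "n > 0"
  shows "\<exists>f\<in>plane_curves. f dvd g"
proof -
  have "\<not> g dvd 1"
    using tdeg_unit[of g] tdeg_form[OF assms(1,2)] assms(3) by auto
  with assms(2) obtain F where "mset_factors F g" using mset_factors_exist by blast
  then obtain f where f: "irreducible f" "f dvd g"
    by (metis mset_factorsD(2) mset_factors_imp_dvd mset_factorsD(1) multiset_nonemptyE)
  then obtain h where h: "g = f * h" by (elim dvdE)
  have form: "is_form (tdeg f) f" using is_form_factor h assms by metis
  define c where "c = lead_coeff (lead_coeff (lead_coeff f))"
  have c: "c \<noteq> 0" using f by (auto simp: c_def)
  define f1 where "f1 = const3 (1 / c) * f"
  have u: "const3 (1 / c) * const3 c = 1" using c by (simp add: const3_def)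
  then have unit: "const3 (1 / c) dvd 1" by (metis dvd_triv_left)
  have "irreducible f1" unfolding f1_def using f unit by (simp add: irreducible_mult_unit_left)
  moreover have "is_form (0 + tdeg f) f1"
    unfolding f1_def by (intro is_form_mult is_form_const3 form)
  moreover have "lead_coeff (lead_coeff (lead_coeff f1)) = 1"
    unfolding f1_def lead_coeff_mult using c by (simp add: const3_def c_def)
  ultimately have "f1 \<in> plane_curves" by (auto simp: plane_curves_def)
  moreover have "f1 dvd g" unfolding f1_def using f unit by (simp add: mult_unit_dvd_iff')
  ultimately show ?thesis by blast
qed

lemma mult_in_eqI:
  fixes f :: "'a::idom"
  assumes "f \<noteq> 0" "\<not> f dvd g"
  shows "mult_in f (f ^ m * g) = m"
proof -
  have "f ^ n dvd f ^ m * g \<longleftrightarrow> n \<le> m" for n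
  proof
    assume d: "f ^ n dvd f ^ m * g"
    show "n \<le> m"
    proof (rule ccontr)
      assume "\<not> n \<le> m"
      then have "f ^ n = f ^ m * (f * f ^ (n - m - 1))" by (simp flip: power_add power_Suc)
      then have "f * f ^ (n - m - 1) dvd g" using d assms(1) by simp
      then show False using assms(2) dvd_mult_left by blast
    qed
  qed (simp add: le_imp_power_dvd)
  then have "{n. f ^ n dvd f ^ m * g} = {..m}" by auto
  moreover have "Max {..m} = m" by (intro Max_eqI) auto
  ultimately show ?thesis by (simp add: mult_in_def)
qed

lemma curve_decomp:
  assumes "f \<in> plane_curves" "g \<noteq> 0"
  obtains m h where "g = f ^ m * h" "\<not> f dvd h"
proof -
  have "\<exists>m h. g = f ^ m * h \<and> \<not> f dvd h"
    using assms(2)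
  proof (induction "tdeg g" arbitrary: g rule: less_induct)
    case less
    show ?case
    proof (cases "f dvd g")
      case True
      then obtain g1 where g1: "g = f * g1" by (elim dvdE)
      have "tdeg g1 < tdeg g" using g1 less.prems plane_curvesD[OF assms(1)] by (simp add: tdeg_mult)
      then obtain m h where "g1 = f ^ m * h" "\<not> f dvd h" using less.hyps[of g1] less.prems g1 by auto
      then have "g = f ^ Suc m * h" using g1 by (simp add: mult_ac)
      then show ?thesis using \<open>\<not> f dvd h\<close> by blast
    next
      case False
      then show ?thesis by (intro exI[of _ 0] exI[of _ g]) simp
    qed
  qed
  then show ?thesis using that by blast
qed

text \<open>
  The equation of a curve is prime, since polynomials over a field form a unique factorisation
  domain; so the multiplicities of the two factors add up.
\<close>
lemma mult_in_mult:
  assumes f: "f \<in> plane_curves" and "g \<noteq> 0" "h \<noteq> 0"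
  shows "mult_in f (g * h) = mult_in f g + mult_in f h"
proof -
  note f' = plane_curvesD[OF f]
  obtain m g' where g: "g = f ^ m * g'" "\<not> f dvd g'" using curve_decomp[OF f assms(2)] .
  obtain n h' where h: "h = f ^ n * h'" "\<not> f dvd h'" using curve_decomp[OF f assms(3)] .
  have "\<not> f dvd g' * h'" using g h f'(2) by (simp add: prime_elem_dvd_mult_iff)
  moreover have "g * h = f ^ (m + n) * (g' * h')" using g h by (simp add: power_add mult_ac)
  ultimately show ?thesis using g h f'(4) by (metis mult_in_eqI)
qed

lemma mult_in_not_dvd: "f \<noteq> 0 \<Longrightarrow> \<not> f dvd (g::'a::idom) \<Longrightarrow> mult_in f g = 0"
  using mult_in_eqI[of f g 0] by simp

lemma mult_in_curve:
  assumes "f \<in> plane_curves" "f' \<in> plane_curves"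
  shows "mult_in f f' = (if f = f' then 1 else 0)"
  using mult_in_eqI[of f 1 1] mult_in_not_dvd[of f f'] curve_dvd_curve[OF assms] plane_curvesD[OF assms(1)]
  by auto

lemma mult_in_const: "f \<in> plane_curves \<Longrightarrow> c \<noteq> 0 \<Longrightarrow> mult_in f (const3 c) = 0"
  using tdeg_dvd[of f "const3 c"] tdeg_const[of c] plane_curvesD[of f]
  by (intro mult_in_not_dvd) (auto simp: const3_def)

text \<open>
  Degree, multiplicity along a curve and vanishing order along an exceptional curve are all
  additive on nonzero forms and trivial on constants. This is all that is used about them in
  relating a form to its divisor.
\<close>
definition is_valuation :: "('k::field poly3 \<Rightarrow> int) \<Rightarrow> bool" where
  "is_valuation \<nu> \<longleftrightarrow>
     (\<forall>m n g h. is_form m g \<longrightarrow> is_form n h \<longrightarrow> g \<noteq> 0 \<longrightarrow> h \<noteq> 0 \<longrightarrow> \<nu> (g * h) = \<nu> g + \<nu> h) \<and>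
     (\<forall>c. c \<noteq> 0 \<longrightarrow> \<nu> (const3 c) = 0)"

text \<open>
  Unique factorisation in additive form: a form is a constant times the product of its prime
  factors with their multiplicities, and \<open>\<nu>\<close> sees only the prime factors. The induction splits off
  one curve at a time.
\<close>
lemma valuation_of_form:
  assumes \<nu>: "is_valuation \<nu>" and "is_form n g" "g \<noteq> 0"
  shows "finite {f \<in> plane_curves. mult_in f g \<noteq> 0}" (is "finite (?S g)")
    and "(\<Sum>f | f \<in> plane_curves \<and> mult_in f g \<noteq> 0. int (mult_in f g) * \<nu> f) = \<nu> g"
proof -
  have "finite (?S g) \<and> (\<Sum>f\<in>?S g. int (mult_in f g) * \<nu> f) = \<nu> g"
    using assms(2,3)
  proof (induction n arbitrary: g rule: less_induct)
    case (less n)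
    show ?case
    proof (cases "n = 0")
      case True
      then obtain c where c: "g = const3 c" "c \<noteq> 0"
        using less.prems tdeg_form tdeg_0_unit by metis
      then have S: "?S g = {}" by (auto simp: mult_in_const)
      show ?thesis unfolding S using \<nu> c by (simp add: is_valuation_def)
    next
      case False
      then obtain f h where f: "f \<in> plane_curves" and g: "g = f * h"
        using ex_curve_dvd[OF less.prems] by (auto simp: dvd_def)
      note f' = plane_curvesD[OF f]
      have h: "h \<noteq> 0" using g less.prems by auto
      have hf: "is_form (tdeg h) h" using is_form_factor[of n h f] g less.prems by (simp add: mult.commute)
      have "tdeg h < n" using g f' h less.prems tdeg_form[of n g] by (auto simp: tdeg_mult)
      from less.IH[OF this hf h] have fin: "finite (?S h)"
        and IH: "(\<Sum>f\<in>?S h. int (mult_in f h) * \<nu> f) = \<nu> h" by auto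
      have m: "mult_in f' g = (if f' = f then 1 else 0) + mult_in f' h" if "f' \<in> plane_curves" for f'
        using that f h f' by (simp add: g mult_in_mult mult_in_curve)
      have S: "?S g = insert f (?S h)" using m f by auto
      have "(\<Sum>f'\<in>?S g. int (mult_in f' g) * \<nu> f')
        = (\<Sum>f'\<in>insert f (?S h). (if f' = f then \<nu> f else 0) + int (mult_in f' h) * \<nu> f')"
        unfolding S by (intro sum.cong refl) (use m f in \<open>auto simp: algebra_simps\<close>)
      also have "\<dots> = \<nu> f + (\<Sum>f'\<in>insert f (?S h). int (mult_in f' h) * \<nu> f')"
        using fin by (simp add: sum.distrib)
      also have "(\<Sum>f'\<in>insert f (?S h). int (mult_in f' h) * \<nu> f') = \<nu> h"
        unfolding IH[symmetric] using fin f by (intro sum.mono_neutral_right) auto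
      also have "\<nu> f + \<nu> h = \<nu> g"
        using \<nu> f' h hf unfolding is_valuation_def g by metis
      finally show ?thesis using S fin by simp
    qed
  qed
  then show "finite (?S g)" "(\<Sum>f\<in>?S g. int (mult_in f g) * \<nu> f) = \<nu> g" by auto
qed

section \<open>Vanishing orders along the exceptional curves\<close>

definition chart_v :: "nat \<Rightarrow> 'k::field poly poly" where
  "chart_v k = (if k \<in> {1,2,3,4} then 1 else chart_s * chart_t)"
definition chart_w :: "nat \<Rightarrow> 'k::field poly poly" where
  "chart_w k = (if k \<in> {1,2,3} then chart_s ^ k * chart_t - 1 else if k = 4 then chart_s * chart_t else 1)"

lemma blowup_chart_subst3: "blowup_chart k g = subst3 (\<lambda>z. [:[:z:]:]) chart_s (chart_v k) (chart_w k) g"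
  by (auto simp: blowup_chart_def subst_form_def subst3_def chart_v_def chart_w_def)

lemma comm_ring_hom_const2: "comm_ring_hom (\<lambda>z::'k::field. [:[:z:]:])"
  by (intro comm_ring_hom_pconst comm_ring_hom_id)

lemma comm_ring_hom_blowup_chart: "comm_ring_hom (blowup_chart k)"
  unfolding blowup_chart_subst3[abs_def] by (intro comm_ring_hom_subst3 comm_ring_hom_const2)

lemma comm_ring_hom_poly: "comm_ring_hom (\<lambda>p::'a::comm_ring_1 poly. poly p x)"
  by unfold_locales auto

text \<open>The value at the point \<open>(s, t)\<close> of a chart.\<close>
definition chart_eval :: "'k::field \<Rightarrow> 'k \<Rightarrow> 'k poly poly \<Rightarrow> 'k" where
  "chart_eval s t F = poly (map_poly (\<lambda>p. poly p t) F) s"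

lemma comm_ring_hom_chart_eval: "comm_ring_hom (chart_eval s t)"
  unfolding chart_eval_def[abs_def] by (intro comm_ring_hom_eval comm_ring_hom_poly)

lemma chart_eval_simps [simp]:
  "chart_eval s t [:[:z:]:] = z" "chart_eval s t chart_s = s" "chart_eval s t chart_t = t"
  "chart_eval s t (F + G) = chart_eval s t F + chart_eval s t G"
  "chart_eval s t (F - G) = chart_eval s t F - chart_eval s t G"
  "chart_eval s t (F * G) = chart_eval s t F * chart_eval s t G"
  "chart_eval s t (F ^ n) = chart_eval s t F ^ n"
  "chart_eval s t 1 = 1" "chart_eval s t 0 = 0"
proof -
  interpret E: comm_ring_hom "chart_eval s t" by (rule comm_ring_hom_chart_eval)
  show "chart_eval s t (F + G) = chart_eval s t F + chart_eval s t G"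
  "chart_eval s t (F - G) = chart_eval s t F - chart_eval s t G"
  "chart_eval s t (F * G) = chart_eval s t F * chart_eval s t G"
  "chart_eval s t (F ^ n) = chart_eval s t F ^ n"
  "chart_eval s t 1 = 1" "chart_eval s t 0 = 0"
    by (rule E.hom_add E.hom_mult E.hom_minus E.hom_power E.hom_one E.hom_zero)+
  show "chart_eval s t [:[:z:]:] = z" "chart_eval s t chart_s = s" "chart_eval s t chart_t = t"
    by (simp_all add: chart_eval_def chart_s_def chart_t_def Polynomial.map_poly_pCons)
qed

text \<open>
  Each chart is birational: where the coordinates do not vanish, every point of the plane is the
  image of a point of the chart. So a point at which \<open>g\<close> does not vanish lifts to the chart, with \<open>g\<close>
  rescaled by homogeneity.
\<close>
lemma blowup_chart_nonzero:
  fixes g :: "'k::field_char_0 poly3"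
  assumes g: "is_form d g" "g \<noteq> 0"
  shows "blowup_chart k g \<noteq> 0"
proof
  assume 0: "blowup_chart k g = 0"
  obtain x y z where nz: "x \<noteq> 0" "y \<noteq> 0" "z \<noteq> 0" "subst3 (\<lambda>x. x) x y z g \<noteq> 0"
    using ex_subst3_nonzero[OF g(2)] by blast
  have ev: "subst3 (\<lambda>x. x) s (chart_eval s t (chart_v k)) (chart_eval s t (chart_w k)) g = 0" for s t
    using arg_cong[OF 0, of "chart_eval s t"]
      subst3_hom[OF comm_ring_hom_const2 comm_ring_hom_chart_eval, of s t chart_s "chart_v k" "chart_w k" g]
    by (simp add: blowup_chart_subst3)
  have hom: "subst3 (\<lambda>x. x) (l * x) (l * y) (l * z) g \<noteq> 0" if "l \<noteq> 0" for l
    using that nz by (simp add: subst3_scale[OF comm_ring_hom_id g(1)])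
  consider "k \<in> {1,2,3}" | "k = 4" | "k \<notin> {1,2,3,4}" by blast
  then show False
  proof cases
    case 1
    \<comment> \<open>the point \<open>(x/y, t)\<close> of the chart lies over \<open>(x : y : z)\<close>\<close>
    define t where "t = (z / y + 1) * (y / x) ^ k"
    have "(x / y) ^ k * t - 1 = z / y"
      using nz by (simp add: t_def power_divide)
    moreover have "chart_v k = (1 :: 'k poly poly)" "chart_w k = (chart_s ^ k * chart_t - 1 :: 'k poly poly)"
      using 1 by (auto simp: chart_v_def chart_w_def)
    ultimately show False
      using ev[of "x / y" t] hom[of "1 / y"] nz by simp
  next
    case 2
    then show False
      using ev[of "x / y" "z / x"] hom[of "1 / y"] nz
      by (auto simp: chart_v_def chart_w_def)
  next
    case 3
    then show False
      using ev[of "x / z" "y / x"] hom[of "1 / z"] nz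
      by (auto simp: chart_v_def chart_w_def)
  qed
qed

text \<open>
  The exceptional curve is \<open>s = 0\<close>, so the multiplicity is the order of vanishing at 0 in the outer
  variable.
\<close>
lemma mult_in_chart_s: "F \<noteq> 0 \<Longrightarrow> mult_in chart_s F = Polynomial.order 0 F"
proof -
  assume "F \<noteq> 0"
  then have "{n. chart_s ^ n dvd F} = {..Polynomial.order 0 F}"
    using order_divides[of 0 _ F] by (auto simp: chart_s_def)
  moreover have "Max {..Polynomial.order 0 F} = Polynomial.order 0 F" by (intro Max_eqI) auto
  ultimately show ?thesis by (simp add: mult_in_def)
qed

abbreviation ordE :: "nat \<Rightarrow> 'k::field poly3 \<Rightarrow> int" where "ordE k g \<equiv> ord_along (Exceptional k) g"

lemma ordE_eq_order:
  fixes g :: "'k::field_char_0 poly3"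
  shows "is_form d g \<Longrightarrow> g \<noteq> 0 \<Longrightarrow> ordE k g = int (Polynomial.order 0 (blowup_chart k g))"
  by (simp add: mult_in_chart_s blowup_chart_nonzero)

lemma is_valuation_ordE: "is_valuation (ordE k :: 'k::field_char_0 poly3 \<Rightarrow> int)"
proof -
  interpret C: comm_ring_hom "blowup_chart k :: 'k poly3 \<Rightarrow> _" by (rule comm_ring_hom_blowup_chart)
  have m: "ordE k (g * h) = ordE k g + ordE k h" if "is_form m g" "is_form n h" "g \<noteq> 0" "h \<noteq> 0"
    for m n and g h :: "'k poly3"
    using that ordE_eq_order[OF is_form_mult[OF that(1,2)], of k] blowup_chart_nonzero[OF that(1), of k]
      blowup_chart_nonzero[OF that(2), of k]
    by (simp add: ordE_eq_order order_mult C.hom_mult del: ord_along.simps)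
  have "ordE k (const3 c) = 0" if "c \<noteq> 0" for c :: 'k
  proof -
    have "const3 c * const3 (1 / c) = 1" "const3 (1::'k) = 1" using that by (simp_all add: const3_def)
    moreover have "const3 c \<noteq> 0" "const3 (1 / c) \<noteq> 0" using that by (auto simp: const3_def)
    ultimately have "ordE k (const3 c) + ordE k (const3 (1 / c)) = ordE k (1 :: 'k poly3)"
      and "ordE k (1 :: 'k poly3) + ordE k (1 :: 'k poly3) = ordE k (1 :: 'k poly3)"
      using m[OF is_form_const3 is_form_const3, of c "1 / c"] m[OF is_form_const3[of 1] is_form_const3[of 1]]
      by (simp_all del: ord_along.simps)
    then show ?thesis by simp
  qed
  with m show ?thesis unfolding is_valuation_def by blast
qed

lemma is_valuation_tdeg: "is_valuation (\<lambda>g. int (tdeg g))"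
  by (auto simp: is_valuation_def tdeg_mult tdeg_const)

lemma is_valuation_mult_in: "f \<in> plane_curves \<Longrightarrow> is_valuation (\<lambda>g. int (mult_in f g))"
  by (auto simp: is_valuation_def mult_in_mult mult_in_const)

lemma is_form_linear [simp]: "is_form 1 form_u" "is_form 1 form_v" "is_form 1 form_w" "is_form 1 (form_v + form_w)"
  by (auto simp: is_form_def form_u_def form_v_def form_w_def coeff_pCons split: nat.splits)

lemma form_nonzero [simp]: "form_u \<noteq> 0" "form_v + form_w \<noteq> 0"
  by (auto simp: form_u_def form_v_def form_w_def)

lemma linear_plane_curves: "form_u \<in> plane_curves" "form_v + form_w \<in> plane_curves"
  using irreducible_linear_form[of form_u] irreducible_linear_form[of "form_v + form_w"] is_form_linear(1,4)
  unfolding plane_curves_def mem_Collect_eq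
  by (auto simp del: is_form_linear) (auto simp: form_u_def form_v_def form_w_def)

lemma ordE_form_u: "ordE k (form_u :: 'k::field_char_0 poly3) = 1"
proof -
  have "Polynomial.order 0 (chart_s :: 'k poly poly) = 1"
    using order_power_n_n[of "0 :: 'k poly" 1] by (simp add: chart_s_def)
  then show ?thesis
    by (subst ordE_eq_order[OF is_form_linear(1)]) (simp_all add: blowup_chart_subst3 comm_ring_hom_const2)
qed

lemma ordE_form_v_w:
  "ordE k (form_v + form_w :: 'k::field_char_0 poly3) = (if k \<in> {1,2,3} then int k else 0)"
proof -
  interpret C: comm_ring_hom "blowup_chart k :: 'k poly3 \<Rightarrow> _" by (rule comm_ring_hom_blowup_chart)
  have c: "blowup_chart k (form_v + form_w :: 'k poly3) = chart_v k + chart_w k"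
    by (simp add: C.hom_add) (simp add: blowup_chart_subst3 comm_ring_hom_const2)
  have "Polynomial.order 0 (chart_v k + chart_w k :: 'k poly poly) = (if k \<in> {1,2,3} then k else 0)"
  proof (cases "k \<in> {1,2,3}")
    case True
    then have "chart_v k + chart_w k = (chart_s ^ k * chart_t :: 'k poly poly)" by (auto simp: chart_v_def chart_w_def)
    moreover have "Polynomial.order 0 (chart_t :: 'k poly poly) = 0" by (intro order_0I) (simp add: chart_t_def)
    moreover have "Polynomial.order 0 (chart_s ^ k :: 'k poly poly) = k"
      using order_power_n_n[of "0 :: 'k poly" k] by (simp add: chart_s_def)
    moreover have "chart_s ^ k * chart_t \<noteq> (0 :: 'k poly poly)" by (simp add: chart_s_def chart_t_def)
    ultimately show ?thesis using True by (simp add: order_mult)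
  next
    case False
    then have "poly (chart_v k + chart_w k :: 'k poly poly) 0 \<noteq> 0"
      by (auto simp: chart_v_def chart_w_def chart_s_def)
    then show ?thesis using False by (simp add: order_0I)
  qed
  then show ?thesis by (subst ordE_eq_order[OF is_form_linear(4)]) (simp_all add: c)
qed

text \<open>
  Both sides are the restriction of \<open>f\<close> to the line \<open>v + w = 0\<close>, evaluated at \<open>u = x\<close>, \<open>w = z\<close>.
\<close>
lemma subst3_on_line:
  "subst3 (\<lambda>x. x) x (- z) z f = poly (map_poly (\<lambda>p. poly (poly p [:0, - 1:]) z) f) (x :: 'k::field)"
proof -
  have id: "map_poly (\<lambda>x. x) r = r" for r :: "'k poly" by (simp add: poly_eqI coeff_map_poly)
  have "poly (map_poly (\<lambda>r. poly r z) p) (- z) = poly (poly p [:0, - 1:]) z" for p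
    using poly_hom.poly_map_poly[of z p "[:0, -1:]"] by simp
  then show ?thesis by (simp add: subst3_def id)
qed

text \<open>
  Over \<open>(0:1:0)\<close> and \<open>(0:0:1)\<close> the chart has degree at most \<open>d\<close> in \<open>s\<close>. In the three charts over \<open>(0:1:-1)\<close>
  the strict transform of \<open>v + w = 0\<close> is \<open>t = 0\<close>; there the form becomes \<open>f(s, 1, -1)\<close>, again of degree
  at most \<open>d\<close>, and it is nonzero because \<open>v + w\<close> does not divide \<open>f\<close>. This is where \<open>A\<^sub>7\<close>, which has order
  2 and 3 along \<open>E\<^sub>2\<close> and \<open>E\<^sub>3\<close>, has to be excluded.
\<close>
lemma ordE_le_tdeg:
  fixes f :: "'k::field_char_0 poly3"
  assumes f: "f \<in> plane_curves" "f \<noteq> form_v + form_w"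
  shows "ordE k f \<le> int (tdeg f)"
proof -
  note f' = plane_curvesD[OF f(1)]
  have nz: "blowup_chart k f \<noteq> 0" by (rule blowup_chart_nonzero[OF f'(3,4)])
  have "Polynomial.order 0 (blowup_chart k f) \<le> tdeg f"
  proof (cases "k \<in> {1,2,3}")
    case False
    have "degree (blowup_chart k f) \<le> tdeg f"
      unfolding blowup_chart_subst3
      by (rule degree_subst3_le[OF comm_ring_hom_const2 f'(3)])
        (use False in \<open>auto simp: chart_s_def chart_t_def chart_v_def chart_w_def\<close>)
    then show ?thesis using order_degree[OF nz, of 0] by simp
  next
    case True
    let ?\<rho> = "map_poly (\<lambda>p. poly p 0) :: 'k poly poly \<Rightarrow> 'k poly"
    have \<rho>: "comm_ring_hom ?\<rho>"
    proof -
      interpret P: comm_ring_hom "\<lambda>p::'k poly. poly p 0" by (rule comm_ring_hom_poly)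
      interpret map_poly_comm_ring_hom "\<lambda>p::'k poly. poly p 0" ..
      show ?thesis by unfold_locales
    qed
    interpret \<rho>: comm_ring_hom ?\<rho> by fact
    have "?\<rho> chart_s = [:0, 1:]" "?\<rho> chart_t = 0" by (simp_all add: chart_s_def chart_t_def Polynomial.map_poly_pCons)
    then have eq: "?\<rho> (blowup_chart k f) = subst3 (\<lambda>z. [:z:]) [:0, 1:] 1 (- 1) f"
      unfolding blowup_chart_subst3 subst3_hom[OF comm_ring_hom_const2 \<rho>] using True
      by (auto simp: chart_v_def chart_w_def \<rho>.hom_minus \<rho>.hom_mult Polynomial.map_poly_pCons)
    have "subst3 (\<lambda>z. [:z:]) [:0, 1:] 1 (- 1) f \<noteq> 0"
    proof
      assume 0: "subst3 (\<lambda>z. [:z:]) [:0, 1:] 1 (- 1) f = 0"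
      have z1: "subst3 (\<lambda>z. z) x 1 (- 1) f = 0" for x
        using subst3_hom[OF comm_ring_hom_pconst[OF comm_ring_hom_id] comm_ring_hom_poly[of x], of "[:0,1:]" 1 "- 1" f]
          0 by simp
      have z2: "subst3 (\<lambda>z. z) x (- z) z f = 0" if "z \<noteq> 0" for x z
        using subst3_scale[OF comm_ring_hom_id f'(3), of "- z" "- x / z" 1 "- 1"] z1[of "- x / z"] that by simp
      have "map_poly (\<lambda>p. poly p [:0, - 1:]) f = 0"
      proof (rule ccontr)
        let ?G = "map_poly (\<lambda>p. poly p [:0, - 1:]) f"
        assume "?G \<noteq> 0"
        then obtain i where "coeff ?G i \<noteq> 0" by (metis coeff_0 poly_eqI)
        then obtain z where z: "z \<noteq> 0" "poly (coeff ?G i) z \<noteq> 0" using ex_nonroot by blast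
        then have "map_poly (\<lambda>p. poly (poly p [:0, - 1:]) z) f \<noteq> 0"
          by (intro map_poly_nonzero[of _ _ i]) (auto simp: coeff_map_poly)
        then obtain x where "poly (map_poly (\<lambda>p. poly (poly p [:0, - 1:]) z) f) x \<noteq> 0"
          using ex_nonroot by blast
        then show False using z2[OF z(1), of x] by (simp add: subst3_on_line)
      qed
      then have "poly (coeff f i) [:0, - 1:] = 0" for i
        using coeff_map_poly[of "\<lambda>p. poly p [:0, - 1:]" f i] by simp
      then have "[:[:0, 1:], 1:] dvd coeff f i" for i
        using poly_eq_0_iff_dvd[of "coeff f i" "[:0, - 1:]"] by (simp add: minus_pCons)
      then have "[:[:[:0, 1:], 1:]:] dvd f" by (simp add: const_poly_dvd_iff)
      moreover have "[:[:[:0, 1:], 1:]:] = (form_v + form_w :: 'k poly3)" by (simp add: form_v_def form_w_def)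
      ultimately show False using curve_dvd_curve[OF linear_plane_curves(2) f(1)] f(2) by simp
    qed
    moreover have "degree (subst3 (\<lambda>z. [:z:]) [:0, 1:] 1 (- 1) f) \<le> tdeg f"
      by (rule degree_subst3_le[OF comm_ring_hom_pconst[OF comm_ring_hom_id] f'(3)]) auto
    moreover have "[:0, 1:] ^ Polynomial.order 0 (blowup_chart k f) dvd ?\<rho> (blowup_chart k f)"
    proof -
      have "[:0, 1:] ^ Polynomial.order 0 (blowup_chart k f) dvd blowup_chart k f"
        using order_1[of 0 "blowup_chart k f"] by simp
      then have "?\<rho> ([:0, 1:] ^ Polynomial.order 0 (blowup_chart k f)) dvd ?\<rho> (blowup_chart k f)"
        by (rule \<rho>.hom_dvd)
      then show ?thesis by (simp add: \<rho>.hom_power Polynomial.map_poly_pCons)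
    qed
    ultimately show ?thesis
      using order_divides[of 0 "Polynomial.order 0 (blowup_chart k f)" "?\<rho> (blowup_chart k f)"]
        order_degree[of "?\<rho> (blowup_chart k f)" 0]
      by (simp add: eq)
  qed
  then show ?thesis using ordE_eq_order[OF f'(3,4), of k] by simp
qed

section \<open>Divisor classes in coordinates\<close>

type_synonym 'k divisor = "'k prime_divisor \<Rightarrow>\<^sub>0 int"
type_synonym 'k place = "('k \<Rightarrow> real) set"

abbreviation supp :: "('a \<Rightarrow>\<^sub>0 int) \<Rightarrow> 'a set" where "supp \<equiv> Poly_Mapping.keys"
abbreviation dcoeff :: "('a \<Rightarrow>\<^sub>0 int) \<Rightarrow> 'a \<Rightarrow> int" where "dcoeff \<equiv> Poly_Mapping.lookup"

lemma prime_divisors_alt: "prime_divisors = Exceptional ` {1..5} \<union> Strict ` plane_curves"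
  by (simp add: prime_divisors_def plane_curves_def)

text \<open>
  The coefficients of the class of a prime divisor in the basis \<open>A\<^sub>6, E\<^sub>1, \<dots>, E\<^sub>5\<close> (with index 0 for
  \<open>A\<^sub>6\<close>). A curve of degree \<open>d\<close> is equivalent to \<open>d\<close> times the pullback of the line \<open>u = 0\<close>, which is \<open>A\<^sub>6 +
  E\<^sub>1 + \<dots> + E\<^sub>5\<close>, minus the exceptional part of its own pullback.
\<close>
fun class_coeff :: "nat \<Rightarrow> 'k::field prime_divisor \<Rightarrow> int" where
  "class_coeff k (Exceptional j) = (if j = k then 1 else 0)"
| "class_coeff k (Strict f) = int (tdeg f) - (if k = 0 then 0 else ordE k f)"

text \<open>
  The coefficients in the basis \<open>A\<^sub>1, A\<^sub>3, \<dots>, A\<^sub>7\<close>, obtained from \<open>class_coeff\<close> by eliminating \<open>A\<^sub>2 = E\<^sub>4\<close>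
  through \<open>A\<^sub>2 = - A\<^sub>1 + A\<^sub>4 + 2 A\<^sub>5 - A\<^sub>6 + A\<^sub>7\<close>. The advantage of this basis is that it contains all
  boundary curves. Only the indices 1, 3, 4, 5, 6, 7 are meaningful.
\<close>
definition coord :: "nat \<Rightarrow> 'k::field prime_divisor \<Rightarrow> int" where
  "coord i P =
    (if i = 1 then class_coeff 5 P - class_coeff 4 P
     else if i = 3 then class_coeff 1 P
     else if i = 4 then class_coeff 2 P + class_coeff 4 P
     else if i = 5 then class_coeff 3 P + 2 * class_coeff 4 P
     else if i = 6 then class_coeff 0 P - class_coeff 4 P
     else class_coeff 4 P)"

lemma tdeg_linear: "tdeg (form_u :: 'k::field poly3) = 1" "tdeg (form_v + form_w :: 'k::field poly3) = 1"
  using tdeg_form[OF is_form_linear(1)] tdeg_form[OF is_form_linear(4)] by auto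

lemma atLeastAtMost_3_7: "{3..7} = {3, 4, 5, 6, 7 :: nat}"
  by auto

lemma atLeastAtMost_1_5: "{1..5} = {1, 2, 3, 4, 5 :: nat}"
  by auto

lemma coord_curve_A:
  assumes "j \<in> {1, 3, 4, 5, 6, 7}" "i \<in> {1, 3, 4, 5, 6, 7}"
  shows "coord i (curve_A j :: 'k::field_char_0 prime_divisor) = (if i = j then 1 else 0)"
  using assms
  by (auto simp: coord_def curve_A_def tdeg_linear ordE_form_u ordE_form_v_w simp del: ord_along.simps)

lemma coord_curve_A2:
  "coord 1 (curve_A 2 :: 'k::field prime_divisor) = - 1" "coord 3 (curve_A 2 :: 'k prime_divisor) = 0"
  "coord 4 (curve_A 2 :: 'k prime_divisor) = 1" "coord 5 (curve_A 2 :: 'k prime_divisor) = 2"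
  "coord 6 (curve_A 2 :: 'k prime_divisor) = - 1" "coord 7 (curve_A 2 :: 'k prime_divisor) = 1"
  by (simp_all add: coord_def curve_A_def)

lemma curve_A_prime: "j \<in> {1..7} \<Longrightarrow> curve_A j \<in> prime_divisors"
proof -
  assume "j \<in> {1..7}"
  then have "j \<in> {1,2,3,4,5,6,7}" by auto
  then show ?thesis
    by (auto simp: curve_A_def prime_divisors_alt linear_plane_curves)
qed

lemma curve_A_inj:
  assumes "curve_A i = (curve_A j :: 'k::field_char_0 prime_divisor)" "i \<in> {1..7}" "j \<in> {3..7}"
  shows "i = j"
proof -
  have "i \<in> {1,2,3,4,5,6,7}" "j \<in> {3,4,5,6,7}" using assms by auto
  moreover have "form_v + form_w \<noteq> (form_u :: 'k poly3)" by (simp add: form_u_def form_v_def form_w_def)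
  ultimately show ?thesis using assms(1) by (auto simp: curve_A_def)
qed

definition lin_ext :: "('a \<Rightarrow> int) \<Rightarrow> ('a \<Rightarrow>\<^sub>0 int) \<Rightarrow> int" where
  "lin_ext \<phi> d = (\<Sum>P\<in>supp d. dcoeff d P * \<phi> P)"

lemma lin_superset:
  assumes "finite S" "supp d \<subseteq> S"
  shows "lin_ext \<phi> d = (\<Sum>P\<in>S. dcoeff d P * \<phi> P)"
  unfolding lin_ext_def using assms by (intro sum.mono_neutral_left) (auto simp: in_keys_iff)

lemma lin_add: "lin_ext \<phi> (d + d') = lin_ext \<phi> d + lin_ext \<phi> d'"
proof -
  let ?S = "supp d \<union> supp d'"
  have "supp (d + d') \<subseteq> ?S" by (rule Poly_Mapping.keys_add)
  then show ?thesis
    using lin_superset[of ?S "d + d'" \<phi>] lin_superset[of ?S d \<phi>] lin_superset[of ?S d' \<phi>]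
    by (simp add: lookup_add algebra_simps sum.distrib)
qed

lemma lin_0 [simp]: "lin_ext \<phi> 0 = 0" by (simp add: lin_ext_def)

lemma lin_uminus: "lin_ext \<phi> (- d) = - lin_ext \<phi> d"
  using lin_add[of \<phi> d "- d"] by simp

lemma lin_diff: "lin_ext \<phi> (d - d') = lin_ext \<phi> d - lin_ext \<phi> d'"
  using lin_add[of \<phi> d "- d'"] by (simp add: lin_uminus)

lemma lin_frag_of [simp]: "lin_ext \<phi> (frag_of P) = \<phi> P" by (simp add: lin_ext_def)

lemma lin_cmul: "lin_ext \<phi> (frag_cmul c d) = c * lin_ext \<phi> d"
proof -
  have "supp (frag_cmul c d) \<subseteq> supp d" by (rule keys_cmul)
  then show ?thesis
    using lin_superset[of "supp d" "frag_cmul c d" \<phi>]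
    by (simp add: lin_ext_def sum_distrib_left mult.assoc)
qed

lemma lin_sum: "lin_ext \<phi> (\<Sum>i\<in>A. d i) = (\<Sum>i\<in>A. lin_ext \<phi> (d i))"
  by (induction A rule: infinite_finite_induct) (auto simp: lin_add)

lemma lin_coord:
  "lin_ext (coord i) d =
    (if i = 1 then lin_ext (class_coeff 5) d - lin_ext (class_coeff 4) d
     else if i = 3 then lin_ext (class_coeff 1) d
     else if i = 4 then lin_ext (class_coeff 2) d + lin_ext (class_coeff 4) d
     else if i = 5 then lin_ext (class_coeff 3) d + 2 * lin_ext (class_coeff 4) d
     else if i = 6 then lin_ext (class_coeff 0) d - lin_ext (class_coeff 4) d
     else lin_ext (class_coeff 4) d)"
  by (auto simp: lin_ext_def coord_def sum.distrib sum_subtractf sum_distrib_left algebra_simps)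

lemma sum_exceptional_class_coeff:
  assumes "k \<le> 5"
  shows "(\<Sum>P\<in>Exceptional ` {1..5}. c P * class_coeff k P) = (if k = 0 then 0 else c (Exceptional k))"
proof -
  have "(\<Sum>P\<in>Exceptional ` {1..5}. c P * class_coeff k P) = (\<Sum>j\<in>{1..5}. if j = k then c (Exceptional k) else 0)"
    by (subst sum.reindex) (auto intro!: sum.cong simp del: sum.delta sum.delta')
  also have "\<dots> = (if k = 0 then 0 else c (Exceptional k))"
    using assms by (subst sum.delta) auto
  finally show ?thesis .
qed

text \<open>
  The divisor of a form of degree \<open>n\<close> is equivalent to \<open>n\<close> times the pullback of a line, all of whose
  coefficients are 1.
\<close>
lemma class_of_form:
  fixes g :: "'k::field_char_0 poly3"
  assumes g: "is_form n g" "g \<noteq> 0" and S: "finite S" "S \<subseteq> plane_curves" "{f \<in> plane_curves. mult_in f g \<noteq> 0} \<subseteq> S"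
    and k: "k \<le> 5"
  shows "(\<Sum>P\<in>Exceptional ` {1..5} \<union> Strict ` S. ord_along P g * class_coeff k P) = int n"
proof -
  have v: "(\<Sum>f\<in>S. int (mult_in f g) * \<nu> f) = \<nu> g" if "is_valuation \<nu>" for \<nu>
    unfolding valuation_of_form(2)[OF that g, symmetric] using S by (intro sum.mono_neutral_right) auto
  have "(\<Sum>P\<in>Exceptional ` {1..5} \<union> Strict ` S. ord_along P g * class_coeff k P)
    = (\<Sum>P\<in>Exceptional ` {1..5}. ord_along P g * class_coeff k P) + (\<Sum>P\<in>Strict ` S. ord_along P g * class_coeff k P)"
    using S by (intro sum.union_disjoint) auto
  also have "(\<Sum>P\<in>Exceptional ` {1..5}. ord_along P g * class_coeff k P) = (if k = 0 then 0 else ordE k g)"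
    by (rule sum_exceptional_class_coeff[OF k])
  also have "(\<Sum>P\<in>Strict ` S. ord_along P g * class_coeff k P)
    = (\<Sum>f\<in>S. int (mult_in f g) * int (tdeg f)) - (if k = 0 then 0 else \<Sum>f\<in>S. int (mult_in f g) * ordE k f)"
    by (subst sum.reindex) (auto simp: sum_subtractf algebra_simps)
  also have "\<dots> = int n - (if k = 0 then 0 else ordE k g)"
    using v[OF is_valuation_tdeg] v[OF is_valuation_ordE] tdeg_form[OF g] by auto
  finally show ?thesis by simp
qed

lemma open_U_edge_prime: "open_U_edge e \<subseteq> prime_divisors"
  by (auto simp: open_U_edge_def)

text \<open>
  Two forms of equal degree have divisors with equal coefficients on the whole surface, and the
  curves that are missing from the open set contribute only to the coordinates outside \<open>insert 1
  e\<close>.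
\<close>
lemma principal_divisors_coord:
  fixes d :: "'k::field_char_0 divisor"
  assumes e: "e \<subseteq> {3..7}" and d: "d \<in> principal_divisors (open_U_edge e)" and i: "i \<in> insert 1 e"
  shows "lin_ext (coord i) d = 0"
proof -
  let ?X = "open_U_edge e :: 'k prime_divisor set"
  obtain n g h where gh: "g \<noteq> 0" "h \<noteq> 0" "is_form n g" "is_form n h"
    and ord: "\<And>P. P \<in> ?X \<Longrightarrow> dcoeff d P = ord_along P g - ord_along P h"
    using d unfolding principal_divisors_def by blast
  have kX: "supp d \<subseteq> ?X" using d unfolding principal_divisors_def by blast
  define T where "T = {f \<in> plane_curves. mult_in f g \<noteq> 0} \<union> {f \<in> plane_curves. mult_in f h \<noteq> 0}"
  have T: "finite T" "T \<subseteq> plane_curves"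
    using valuation_of_form(1)[OF is_valuation_tdeg gh(3,1)] valuation_of_form(1)[OF is_valuation_tdeg gh(4,2)]
    by (auto simp: T_def)
  define S where "S = Exceptional ` {1..5} \<union> Strict ` T"
  have S: "finite S" "S \<subseteq> prime_divisors" using T by (auto simp: S_def prime_divisors_alt)
  have 0: "(\<Sum>P\<in>S. (ord_along P g - ord_along P h) * class_coeff k P) = 0" if "k \<le> 5" for k
    using class_of_form[OF gh(3,1) T _ that] class_of_form[OF gh(4,2) T _ that]
    unfolding S_def T_def by (simp add: left_diff_distrib sum_subtractf del: ord_along.simps)
  have "(\<Sum>P\<in>S. (ord_along P g - ord_along P h) * coord i P) = 0"
  proof -
    let ?c = "\<lambda>k. \<Sum>P\<in>S. (ord_along P g - ord_along P h) * class_coeff k P"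
    have "(\<Sum>P\<in>S. (ord_along P g - ord_along P h) * coord i P) =
      (if i = 1 then ?c 5 - ?c 4 else if i = 3 then ?c 1
       else if i = 4 then ?c 2 + ?c 4 else if i = 5 then ?c 3 + 2 * ?c 4
       else if i = 6 then ?c 0 - ?c 4 else ?c 4)"
      by (auto simp: coord_def sum.distrib sum_subtractf sum_distrib_left algebra_simps simp del: ord_along.simps)
    also have "\<dots> = 0" by (simp add: 0 del: ord_along.simps)
    finally show ?thesis .
  qed
  also have "(\<Sum>P\<in>S. (ord_along P g - ord_along P h) * coord i P) = (\<Sum>P\<in>S \<inter> ?X. (ord_along P g - ord_along P h) * coord i P)"
  proof (rule sum.mono_neutral_right)
    show "\<forall>P\<in>S - S \<inter> ?X. (ord_along P g - ord_along P h) * coord i P = 0"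
    proof
      fix P assume "P \<in> S - S \<inter> ?X"
      then have "P \<in> curve_A ` ({3..7} - e)" using S by (auto simp: open_U_edge_def)
      then obtain j where j: "P = curve_A j" "j \<in> {3..7} - e" by auto
      have "j \<in> {1,3,4,5,6,7}" "i \<in> {1,3,4,5,6,7}" "i \<noteq> j" using j i e by auto
      then have "coord i P = 0" using coord_curve_A j by metis
      then show "(ord_along P g - ord_along P h) * coord i P = 0" by simp
    qed
  qed (use S in auto)
  also have "\<dots> = (\<Sum>P\<in>S \<inter> ?X. dcoeff d P * coord i P)"
    using ord by (intro sum.cong) auto
  also have "\<dots> = lin_ext (coord i) d"
  proof (rule lin_superset[symmetric])
    show "supp d \<subseteq> S \<inter> ?X"
    proof
      fix P assume P: "P \<in> supp d"
      then have PX: "P \<in> ?X" using kX by auto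
      then have nz: "ord_along P g - ord_along P h \<noteq> 0" using P ord by (metis in_keys_iff)
      have "P \<in> prime_divisors" using PX open_U_edge_prime by blast
      then show "P \<in> S \<inter> ?X" using PX nz by (auto simp: S_def T_def prime_divisors_alt simp del: ord_along.simps(1))
    qed
  qed (use S in auto)
  finally show ?thesis by simp
qed

lemma valuation_mult:
  "is_valuation \<nu> \<Longrightarrow> is_form m g \<Longrightarrow> is_form n h \<Longrightarrow> g \<noteq> 0 \<Longrightarrow> h \<noteq> 0 \<Longrightarrow> \<nu> (g * h) = \<nu> g + \<nu> h"
  unfolding is_valuation_def by blast

text \<open>The forms \<open>\<Prod> f\<^sup>a\<^sup>(\<^sup>f\<^sup>)\<close> realise any prescribed multiplicities along plane curves.\<close>
lemma prod_curves:
  fixes a :: "'k::field_char_0 poly3 \<Rightarrow> nat"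
  assumes "finite F" "F \<subseteq> plane_curves"
  shows "(\<Prod>f\<in>F. f ^ a f) \<noteq> 0" "is_form (\<Sum>f\<in>F. a f * tdeg f) (\<Prod>f\<in>F. f ^ a f)"
    and "\<And>\<nu>. is_valuation \<nu> \<Longrightarrow> \<nu> (\<Prod>f\<in>F. f ^ a f) = (\<Sum>f\<in>F. int (a f) * \<nu> f)"
proof -
  have one: "is_form 0 (1 :: 'k poly3)" "\<nu> (1 :: 'k poly3) = 0" if "is_valuation \<nu>" for \<nu>
  proof -
    have "const3 (1 :: 'k) = 1" by (simp add: const3_def)
    then show "is_form 0 (1 :: 'k poly3)" "\<nu> (1 :: 'k poly3) = 0"
      using is_form_const3[of "1::'k"] that unfolding is_valuation_def by (auto, metis one_neq_zero)
  qed
  have pow: "f ^ n \<noteq> 0 \<and> is_form (n * tdeg f) (f ^ n) \<and> (\<forall>\<nu>. is_valuation \<nu> \<longrightarrow> \<nu> (f ^ n) = int n * \<nu> f)"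
    if "f \<in> plane_curves" for f :: "'k poly3" and n
  proof (induction n)
    case 0
    then show ?case using one[OF is_valuation_tdeg] one by auto
  next
    case (Suc n)
    note f = plane_curvesD[OF that]
    have "\<nu> (f * f ^ n) = \<nu> f + \<nu> (f ^ n)" if "is_valuation \<nu>" for \<nu>
      using valuation_mult[OF that f(3)] f(4) Suc by blast
    moreover have "is_form (tdeg f + n * tdeg f) (f * f ^ n)"
      using Suc by (intro is_form_mult f(3)) simp
    ultimately show ?case using f(4) Suc by (simp add: algebra_simps)
  qed
  have "(\<Prod>f\<in>F. f ^ a f) \<noteq> 0 \<and> is_form (\<Sum>f\<in>F. a f * tdeg f) (\<Prod>f\<in>F. f ^ a f) \<and>
    (\<forall>\<nu>. is_valuation \<nu> \<longrightarrow> \<nu> (\<Prod>f\<in>F. f ^ a f) = (\<Sum>f\<in>F. int (a f) * \<nu> f))"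
    using assms
  proof (induction F rule: finite_induct)
    case empty
    then show ?case using one[OF is_valuation_tdeg] one by auto
  next
    case (insert f F)
    have A: "is_form (a f * tdeg f) (f ^ a f)" "f ^ a f \<noteq> 0"
      "\<And>\<nu>. is_valuation \<nu> \<Longrightarrow> \<nu> (f ^ a f) = int (a f) * \<nu> f"
      using pow[of f "a f"] insert.prems by auto
    have B: "is_form (\<Sum>f\<in>F. a f * tdeg f) (\<Prod>f\<in>F. f ^ a f)" "(\<Prod>f\<in>F. f ^ a f) \<noteq> 0"
      "\<And>\<nu>. is_valuation \<nu> \<Longrightarrow> \<nu> (\<Prod>f\<in>F. f ^ a f) = (\<Sum>f\<in>F. int (a f) * \<nu> f)"
      using insert.IH insert.prems by auto
    have "\<nu> (f ^ a f * (\<Prod>f\<in>F. f ^ a f)) = int (a f) * \<nu> f + (\<Sum>f\<in>F. int (a f) * \<nu> f)" if "is_valuation \<nu>" for \<nu>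
      using valuation_mult[OF that A(1) B(1) A(2) B(2)] A(3)[OF that] B(3)[OF that] by simp
    moreover have "is_form (a f * tdeg f + (\<Sum>f\<in>F. a f * tdeg f)) (f ^ a f * (\<Prod>f\<in>F. f ^ a f))"
      by (rule is_form_mult[OF A(1) B(1)])
    ultimately show ?case using A(2) B(2) insert.hyps by simp
  qed
  then show "(\<Prod>f\<in>F. f ^ a f) \<noteq> 0" "is_form (\<Sum>f\<in>F. a f * tdeg f) (\<Prod>f\<in>F. f ^ a f)"
    "\<And>\<nu>. is_valuation \<nu> \<Longrightarrow> \<nu> (\<Prod>f\<in>F. f ^ a f) = (\<Sum>f\<in>F. int (a f) * \<nu> f)" by blast+
qed

text \<open>
  The divisor is completed to the whole surface by multiples of the removed boundary curves so
  that all coordinates vanish. Its positive and negative parts along plane curves then define two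
  forms of equal degree, and the vanishing coordinates say that their quotient has the right
  orders along the exceptional curves.
\<close>
lemma coord_principal_divisors:
  fixes d :: "'k::field_char_0 divisor"
  assumes e: "e \<subseteq> {3..7}" and k: "supp d \<subseteq> open_U_edge e"
    and 0: "\<And>i. i \<in> insert 1 e \<Longrightarrow> lin_ext (coord i) d = 0"
  shows "d \<in> principal_divisors (open_U_edge e)"
proof -
  let ?X = "open_U_edge e :: 'k prime_divisor set"
  define R where "R = {3..7} - e"
  have R: "finite R" "R \<subseteq> {3..7}" by (auto simp: R_def)
  \<comment> \<open>the completion to the whole surface, with all coordinates zero\<close>
  define D where "D = d - (\<Sum>j\<in>R. frag_cmul (lin_ext (coord j) d) (frag_of (curve_A j)))"
  have linD: "lin_ext (coord i) D = 0" if i: "i \<in> {1, 3, 4, 5, 6, 7}" for i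
  proof -
    have "lin_ext (coord i) D = lin_ext (coord i) d - (\<Sum>j\<in>R. lin_ext (coord j) d * coord i (curve_A j :: 'k prime_divisor))"
      by (simp add: D_def lin_diff lin_sum lin_cmul)
    also have "(\<Sum>j\<in>R. lin_ext (coord j) d * coord i (curve_A j :: 'k prime_divisor)) = (\<Sum>j\<in>R. if j = i then lin_ext (coord i) d else 0)"
    proof (intro sum.cong refl)
      fix j assume "j \<in> R"
      then have "j \<in> {1,3,4,5,6,7}" using R by auto
      then show "lin_ext (coord j) d * coord i (curve_A j :: 'k prime_divisor) = (if j = i then lin_ext (coord i) d else 0)"
        using coord_curve_A[OF _ i, of j] by auto
    qed
    also have "\<dots> = lin_ext (coord i) d"
      using R 0[of i] i by (auto simp: sum.delta R_def)
    finally show ?thesis by simp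
  qed
  have ccD: "lin_ext (class_coeff k) D = 0" if "k \<le> 5" for k
  proof -
    have "k \<in> {0,1,2,3,4,5}" using that by auto
    then show ?thesis
      using linD[of 1] linD[of 3] linD[of 4] linD[of 5] linD[of 6] linD[of 7]
      by (auto simp: lin_coord)
  qed
  have lookupD: "dcoeff D P = dcoeff d P" if "P \<in> ?X" for P
  proof -
    have "P \<noteq> curve_A j" if "j \<in> R" for j
      using that \<open>P \<in> ?X\<close> by (auto simp: R_def open_U_edge_def)
    then have "(\<Sum>j\<in>R. dcoeff (frag_cmul (lin_ext (coord j) d) (frag_of (curve_A j))) P) = 0"
      by (intro sum.neutral) auto
    then show ?thesis by (simp add: D_def lookup_minus lookup_sum del: lookup_frag_cmul)
  qed
  have keysD: "supp D \<subseteq> prime_divisors"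
  proof
    fix P assume P: "P \<in> supp D"
    show "P \<in> prime_divisors"
    proof (rule ccontr)
      assume nP: "P \<notin> prime_divisors"
      then have "P \<notin> supp d" using k open_U_edge_prime by blast
      then have "dcoeff d P = 0" by (simp add: in_keys_iff)
      moreover have "P \<noteq> curve_A j" if "j \<in> R" for j
        using that nP curve_A_prime[of j] R by auto
      then have "(\<Sum>j\<in>R. dcoeff (frag_cmul (lin_ext (coord j) d) (frag_of (curve_A j))) P) = 0"
        by (intro sum.neutral) auto
      ultimately have "dcoeff D P = 0" by (simp add: D_def lookup_minus lookup_sum del: lookup_frag_cmul)
      with P show False by (simp add: in_keys_iff)
    qed
  qed
  define F where "F = {f. Strict f \<in> supp D}"
  have F: "finite F" "F \<subseteq> plane_curves"
  proof -
    have "Strict ` F \<subseteq> supp D" by (auto simp: F_def)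
    then show "finite F" by (meson finite_imageD finite_keys finite_subset inj_Inr inj_on_subset subset_UNIV)
    show "F \<subseteq> plane_curves" using keysD by (auto simp: F_def prime_divisors_alt)
  qed
  define D' where "D' f = dcoeff D (Strict f)" for f
  define g where "g = (\<Prod>f\<in>F. f ^ nat (D' f))"
  define h where "h = (\<Prod>f\<in>F. f ^ nat (- D' f))"
  have diff: "\<nu> g - \<nu> h = (\<Sum>f\<in>F. D' f * \<nu> f)" if "is_valuation \<nu>" for \<nu>
  proof -
    have "\<nu> g - \<nu> h = (\<Sum>f\<in>F. (int (nat (D' f)) - int (nat (- D' f))) * \<nu> f)"
      unfolding g_def h_def prod_curves(3)[OF F that] by (simp add: sum_subtractf left_diff_distrib)
    also have "\<dots> = (\<Sum>f\<in>F. D' f * \<nu> f)" by (intro sum.cong) auto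
    finally show ?thesis .
  qed
  have cc: "lin_ext (class_coeff k) D = (if k = 0 then 0 else dcoeff D (Exceptional k)) +
      (\<Sum>f\<in>F. D' f * int (tdeg f)) - (if k = 0 then 0 else \<Sum>f\<in>F. D' f * ordE k f)" if "k \<le> 5" for k
  proof -
    have "supp D \<subseteq> Exceptional ` {1..5} \<union> Strict ` F"
      using keysD by (auto simp: prime_divisors_alt F_def)
    then have "lin_ext (class_coeff k) D = (\<Sum>P\<in>Exceptional ` {1..5} \<union> Strict ` F. dcoeff D P * class_coeff k P)"
      using F by (intro lin_superset) auto
    also have "\<dots> = (\<Sum>P\<in>Exceptional ` {1..5}. dcoeff D P * class_coeff k P)
       + (\<Sum>P\<in>Strict ` F. dcoeff D P * class_coeff k P)"
      using F by (intro sum.union_disjoint) auto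
    also have "(\<Sum>P\<in>Exceptional ` {1..5}. dcoeff D P * class_coeff k P)
       = (if k = 0 then 0 else dcoeff D (Exceptional k))"
      by (rule sum_exceptional_class_coeff[OF that])
    also have "(\<Sum>P\<in>Strict ` F. dcoeff D P * class_coeff k P)
       = (\<Sum>f\<in>F. D' f * int (tdeg f)) - (if k = 0 then 0 else \<Sum>f\<in>F. D' f * ordE k f)"
      by (subst sum.reindex) (auto simp: D'_def sum_subtractf algebra_simps simp del: ord_along.simps)
    finally show ?thesis by simp
  qed
  have deg0: "(\<Sum>f\<in>F. D' f * int (tdeg f)) = 0" using cc[of 0] ccD[of 0] by simp
  have "int (tdeg g) - int (tdeg h) = 0" using diff[OF is_valuation_tdeg] deg0 by simp
  moreover have gf: "is_form (tdeg g) g" "g \<noteq> 0" "is_form (tdeg h) h" "h \<noteq> 0"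
    using prod_curves[OF F] tdeg_form unfolding g_def h_def by metis+
  ultimately have hf: "is_form (tdeg g) h" by simp
  have "dcoeff d P = ord_along P g - ord_along P h" if P: "P \<in> ?X" for P
  proof -
    have "P \<in> prime_divisors" using P open_U_edge_prime by blast
    then consider k where "P = Exceptional k" "k \<in> {1..5}" | f where "P = Strict f" "f \<in> plane_curves"
      by (auto simp: prime_divisors_alt)
    then show ?thesis
    proof cases
      case 1
      then have "dcoeff D P = (\<Sum>f\<in>F. D' f * ordE k f)"
        using cc[of k] ccD[of k] deg0 by auto
      then show ?thesis using lookupD[OF P] diff[OF is_valuation_ordE, of k] 1 by simp
    next
      case 2
      have "(\<Sum>f'\<in>F. D' f' * int (mult_in f f')) = (\<Sum>f'\<in>F. if f' = f then D' f else 0)"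
        using F 2 by (intro sum.cong) (auto simp: mult_in_curve)
      also have "\<dots> = D' f" using F by (auto simp: sum.delta F_def D'_def in_keys_iff)
      finally show ?thesis using lookupD[OF P] diff[OF is_valuation_mult_in[OF 2(2)]] 2 by (simp add: D'_def)
    qed
  qed
  then show ?thesis unfolding principal_divisors_def using k gf hf by blast
qed

section \<open>Picard groups of the open subsets\<close>

lemma open_U_alt: "open_U = open_U_edge {}"
  by (simp add: open_U_def open_U_edge_def)

text \<open>
  Removing boundary curves forgets their coordinates: the class group of the open subset is free
  on \<open>A\<^sub>1\<close> and the boundary curves that are kept.
\<close>
lemma principal_divisors_eq:
  fixes e
  assumes "e \<subseteq> {3..7}"
  shows "principal_divisors (open_U_edge e :: 'k::field_char_0 prime_divisor set) =
    {d. supp d \<subseteq> open_U_edge e \<and> (\<forall>i\<in>insert 1 e. lin_ext (coord i) d = 0)}"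
proof -
  have iff: "d \<in> principal_divisors (open_U_edge e) \<longleftrightarrow>
    supp d \<subseteq> open_U_edge e \<and> (\<forall>i\<in>insert 1 e. lin_ext (coord i) d = 0)" for d :: "'k divisor"
  proof
    assume d: "d \<in> principal_divisors (open_U_edge e)"
    then have "supp d \<subseteq> open_U_edge e" by (simp add: principal_divisors_def)
    then show "supp d \<subseteq> open_U_edge e \<and> (\<forall>i\<in>insert 1 e. lin_ext (coord i) d = 0)"
      using principal_divisors_coord[OF assms d] by (intro conjI ballI)
  next
    assume "supp d \<subseteq> open_U_edge e \<and> (\<forall>i\<in>insert 1 e. lin_ext (coord i) d = 0)"
    then show "d \<in> principal_divisors (open_U_edge e)"
      by (elim conjE) (rule coord_principal_divisors[OF assms], auto)
  qed
  show ?thesis by (intro Set.set_eqI) (simp only: mem_Collect_eq iff)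
qed

lemma keys_add_subset: "supp a \<subseteq> X \<Longrightarrow> supp b \<subseteq> X \<Longrightarrow> supp (a + b :: 'a \<Rightarrow>\<^sub>0 int) \<subseteq> X"
  using Poly_Mapping.keys_add[of a b] by blast

lemma keys_diff_subset: "supp a \<subseteq> X \<Longrightarrow> supp b \<subseteq> X \<Longrightarrow> supp (a - b :: 'a \<Rightarrow>\<^sub>0 int) \<subseteq> X"
  using keys_diff[of a b] by blast

lemma principal_normal:
  assumes "e \<subseteq> {3..7}"
  shows "principal_divisors (open_U_edge e) \<lhd> free_Abelian_group (open_U_edge e :: 'k::field_char_0 prime_divisor set)"
proof -
  let ?F = "free_Abelian_group (open_U_edge e :: 'k prime_divisor set)"
  let ?K = "{d :: 'k divisor. supp d \<subseteq> open_U_edge e \<and> (\<forall>i\<in>insert 1 e. lin_ext (coord i) d = 0)}"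
  interpret comm_group ?F by (rule abelian_free_Abelian_group)
  have "subgroup (principal_divisors (open_U_edge e)) ?F"
    unfolding principal_divisors_eq[OF assms]
  proof (rule subgroupI)
    fix a b assume "a \<in> ?K"
      "b \<in> ?K"
    then show "a \<otimes>\<^bsub>?F\<^esub> b \<in> ?K"
      by (simp add: lin_add keys_add_subset)
  next
    have "0 \<in> ?K" by simp
    then show "?K \<noteq> {}" by blast
  qed (auto simp: lin_uminus)
  then show ?thesis by (rule subgroup_imp_normal)
qed

lemma comm_group_Pic:
  assumes "e \<subseteq> {3..7}"
  shows "comm_group (Pic (open_U_edge e :: 'k::field_char_0 prime_divisor set))"
  unfolding Pic_def
  by (rule comm_group.abelian_FactGroup[OF abelian_free_Abelian_group normal_imp_subgroup[OF principal_normal[OF assms]]])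

lemma divisor_class_eq:
  fixes d :: "'k::field_char_0 divisor"
  assumes e: "e \<subseteq> {3..7}" and d: "supp d \<subseteq> open_U_edge e"
  shows "divisor_class (open_U_edge e) d =
    {d'. supp d' \<subseteq> open_U_edge e \<and> (\<forall>i\<in>insert 1 e. lin_ext (coord i) d' = lin_ext (coord i) d)}"
proof -
  have "d' \<in> divisor_class (open_U_edge e) d \<longleftrightarrow> d' - d \<in> principal_divisors (open_U_edge e)" for d'
    by (auto simp: divisor_class_def r_coset_def intro: bexI[of _ "d' - d"])
  moreover have "supp (d' - d) \<subseteq> open_U_edge e \<longleftrightarrow> supp d' \<subseteq> open_U_edge e" for d'
    using keys_diff_subset[of d' "open_U_edge e" d] keys_add_subset[of "d' - d" "open_U_edge e" d] d by auto
  ultimately show ?thesis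
    unfolding principal_divisors_eq[OF e] by (auto simp: lin_diff)
qed

lemma divisor_class_eq_iff:
  fixes d :: "'k::field_char_0 divisor"
  assumes "e \<subseteq> {3..7}" "supp d \<subseteq> open_U_edge e" "supp d' \<subseteq> open_U_edge e"
  shows "divisor_class (open_U_edge e) d = divisor_class (open_U_edge e) d' \<longleftrightarrow>
    (\<forall>i\<in>insert 1 e. lin_ext (coord i) d = lin_ext (coord i) d')"
  using assms by (auto simp: divisor_class_eq)

lemma carrier_Pic: "carrier (Pic X) = divisor_class X ` {d. supp d \<subseteq> X}"
  by (auto simp: Pic_def FactGroup_def RCOSETS_def divisor_class_def)

lemma mult_Pic:
  fixes d :: "'k::field_char_0 divisor"
  assumes "e \<subseteq> {3..7}" "supp d \<subseteq> open_U_edge e" "supp d' \<subseteq> open_U_edge e"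
  shows "divisor_class (open_U_edge e) d \<otimes>\<^bsub>Pic (open_U_edge e)\<^esub> divisor_class (open_U_edge e) d'
     = divisor_class (open_U_edge e) (d + d')"
  using normal.rcos_sum[OF principal_normal[OF assms(1)], of d d'] assms
  by (simp add: Pic_def divisor_class_def)

text \<open>
  The choice of representative does not matter for the coordinates that survive on the open
  subset (\<open>class_coord_divisor_class\<close>).
\<close>
definition class_coord :: "nat \<Rightarrow> ('k::field divisor) set \<Rightarrow> int" where
  "class_coord i C = lin_ext (coord i) (SOME d. d \<in> C)"

lemma class_coord_divisor_class:
  fixes d :: "'k::field_char_0 divisor"
  assumes "e \<subseteq> {3..7}" "supp d \<subseteq> open_U_edge e" "i \<in> insert 1 e"
  shows "class_coord i (divisor_class (open_U_edge e) d) = lin_ext (coord i) d"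
proof -
  have "d \<in> divisor_class (open_U_edge e) d" using assms by (simp add: divisor_class_eq)
  then have "(SOME d'. d' \<in> divisor_class (open_U_edge e) d) \<in> divisor_class (open_U_edge e) d"
    by (rule someI)
  then show ?thesis using assms by (auto simp: class_coord_def divisor_class_eq)
qed

lemma lookup_restrict_divisor:
  "dcoeff (restrict_divisor X d) P = (if P \<in> X then dcoeff d P else 0)"
proof -
  have "dcoeff (restrict_divisor X d) P =
    (\<Sum>Q\<in>supp d. if Q = P then (if P \<in> X then dcoeff d P else 0) else 0)"
    unfolding restrict_divisor_def frag_extend_def lookup_sum
    by (intro sum.cong) (auto simp del: sum.delta sum.delta')
  also have "\<dots> = (if P \<in> X then dcoeff d P else 0)"
    by (subst sum.delta) (auto simp: in_keys_iff)
  finally show ?thesis .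
qed

lemma keys_restrict_divisor: "supp (restrict_divisor X d) = supp d \<inter> X"
  by (auto simp: in_keys_iff lookup_restrict_divisor split: if_splits)

lemma lin_coord_restrict_divisor:
  fixes d :: "'k::field_char_0 divisor"
  assumes e: "e \<subseteq> {3..7}" and k: "supp d \<subseteq> prime_divisors" and i: "i \<in> insert 1 e"
  shows "lin_ext (coord i) (restrict_divisor (open_U_edge e) d) = lin_ext (coord i) d"
proof -
  let ?r = "restrict_divisor (open_U_edge e) d"
  have "lin_ext (coord i) ?r = (\<Sum>P\<in>supp d. dcoeff ?r P * coord i P)"
    by (rule lin_superset) (auto simp: keys_restrict_divisor)
  also have "\<dots> = lin_ext (coord i) d"
    unfolding lin_ext_def
  proof (intro sum.cong refl)
    fix P assume P: "P \<in> supp d"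
    show "dcoeff ?r P * coord i P = dcoeff d P * coord i P"
    proof (cases "P \<in> open_U_edge e")
      case False
      then obtain j where j: "P = curve_A j" "j \<in> {3..7} - e" using P k by (auto simp: open_U_edge_def)
      have "j \<in> {1,3,4,5,6,7}" "i \<in> {1,3,4,5,6,7}" "i \<noteq> j" using j i e by auto
      then have "coord i P = 0" using coord_curve_A j by metis
      then show ?thesis by simp
    qed (simp add: lookup_restrict_divisor)
  qed
  finally show ?thesis .
qed

lemma restrict_class_divisor_class:
  fixes d :: "'k::field_char_0 divisor"
  assumes e: "e \<subseteq> {3..7}" and d: "supp d \<subseteq> open_U_edge e"
  shows "restrict_class open_U (divisor_class (open_U_edge e) d) = divisor_class open_U (restrict_divisor open_U d)"
proof -
  have "divisor_class open_U (restrict_divisor open_U d') = divisor_class open_U (restrict_divisor open_U d)"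
    if "d' \<in> divisor_class (open_U_edge e) d" for d'
  proof -
    have d': "supp d' \<subseteq> open_U_edge e" "lin_ext (coord 1) d' = lin_ext (coord 1) d"
      using that unfolding divisor_class_eq[OF assms] by auto
    have "supp d \<subseteq> prime_divisors" "supp d' \<subseteq> prime_divisors"
      using d d' open_U_edge_prime by blast+
    then show ?thesis
      unfolding open_U_alt using d'
      by (subst divisor_class_eq_iff) (auto simp: keys_restrict_divisor lin_coord_restrict_divisor)
  qed
  moreover have "d \<in> divisor_class (open_U_edge e) d" using assms by (simp add: divisor_class_eq)
  ultimately show ?thesis unfolding restrict_class_def by blast
qed

text \<open>
  On \<open>U\<close> only the coordinate along \<open>A\<^sub>1\<close> is left, so gluing over \<open>U\<close> means equality of that coordinate.
\<close>
lemma restrict_class_eq_iff: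
  fixes d d' :: "'k::field_char_0 divisor"
  assumes "e \<subseteq> {3..7}" "supp d \<subseteq> open_U_edge e" "e' \<subseteq> {3..7}" "supp d' \<subseteq> open_U_edge e'"
  shows "restrict_class open_U (divisor_class (open_U_edge e) d) = restrict_class open_U (divisor_class (open_U_edge e') d')
    \<longleftrightarrow> lin_ext (coord 1) d = lin_ext (coord 1) d'"
proof -
  have "supp d \<subseteq> prime_divisors" "supp d' \<subseteq> prime_divisors"
    using assms open_U_edge_prime by blast+
  then show ?thesis
    using assms unfolding open_U_alt
    by (subst (1 2) restrict_class_divisor_class[unfolded open_U_alt])
       (auto simp: divisor_class_eq_iff keys_restrict_divisor lin_coord_restrict_divisor)
qed

section \<open>Elements of the glued Picard group\<close>

text \<open>
  For an edge \<open>e\<close>, the values of the functional on the two curves of \<open>e\<close> are \<open>z\<^sub>i = edge_alpha e i \<cdot> \<lambda>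
  + edge_beta e i \<cdot> \<mu>\<close>; this inverts \<open>\<lambda> = \<Sum> lam_coeff i \<cdot> z\<^sub>i\<close> and \<open>\<mu> = \<Sum> mu_coeff i \<cdot> z\<^sub>i\<close>.
\<close>
definition edge_alpha :: "nat set \<Rightarrow> nat \<Rightarrow> int" where
  "edge_alpha e i = (if e = {5, 7} then (if i = 5 then 0 else 1)
     else if e = {4, 5} then (if i = 4 then - 1 else 1)
     else if e = {3, 4} then (if i = 3 then - 1 else 1)
     else (if i = 3 then 1 else - 1))"

definition edge_beta :: "nat set \<Rightarrow> nat \<Rightarrow> int" where
  "edge_beta e i = (if e = {5, 7} then (if i = 5 then 1 else - 3)
     else if e = {4, 5} then (if i = 4 then 3 else - 2)
     else if e = {3, 4} then (if i = 3 then 2 else - 1)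
     else (if i = 3 then 0 else 1))"

text \<open>The coefficients of the log anticanonical class along \<open>A\<^sub>3, \<dots>, A\<^sub>7\<close>.\<close>
definition lam_coeff :: "nat \<Rightarrow> int" where
  "lam_coeff i = (if i = 3 then 1 else if i = 4 then 2 else if i = 5 then 3 else if i = 6 then 0 else 1)"

text \<open>The coefficients of \<open>-K\<^sub>D - A\<^sub>1 - A\<^sub>2\<close> along \<open>A\<^sub>3, \<dots>, A\<^sub>7\<close>.\<close>
definition mu_coeff :: "nat \<Rightarrow> int" where
  "mu_coeff i = (if i = 7 then 0 else 1)"

lemma clemens_edges_cases:
  assumes "e \<in> clemens_edges"
  obtains "e = {5, 7}" | "e = {4, 5}" | "e = {3, 4}" | "e = {3, 6}"
  using assms by (auto simp: clemens_edges_def)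

lemma clemens_edges_subset: "e \<in> clemens_edges \<Longrightarrow> e \<subseteq> {3..7}"
  by (erule clemens_edges_cases) auto

lemma edges_distinct [simp]:
  "{4, 5} \<noteq> {5, 7 :: nat}" "{3, 4} \<noteq> {5, 7 :: nat}" "{3, 4} \<noteq> {4, 5 :: nat}"
  "{3, 6} \<noteq> {5, 7 :: nat}" "{3, 6} \<noteq> {4, 5 :: nat}" "{3, 6} \<noteq> {3, 4 :: nat}"
  by (auto simp: doubleton_eq_iff)

text \<open>For every edge the \<open>2 \<times> 2\<close> matrix of the coefficients has an integral inverse.\<close>
lemma edge_dual:
  assumes "e \<in> clemens_edges"
  shows "(\<Sum>i\<in>e. edge_alpha e i * lam_coeff i) = 1" "(\<Sum>i\<in>e. edge_alpha e i * mu_coeff i) = 0"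
    "(\<Sum>i\<in>e. edge_beta e i * lam_coeff i) = 0" "(\<Sum>i\<in>e. edge_beta e i * mu_coeff i) = 1"
  using assms
  by (cases rule: clemens_edges_cases; simp add: edge_alpha_def edge_beta_def lam_coeff_def mu_coeff_def)+

lemma edge_inverse:
  assumes "e \<in> clemens_edges" "i \<in> e"
  shows "K i = lam_coeff i * (\<Sum>i\<in>e. edge_alpha e i * K i) + mu_coeff i * (\<Sum>i\<in>e. edge_beta e i * K i)"
  using assms
  by (cases rule: clemens_edges_cases; auto simp add: edge_alpha_def edge_beta_def lam_coeff_def mu_coeff_def)

abbreviation places :: "'k::field place set" where "places \<equiv> archimedean_places"

text \<open>An element of the glued group, represented by one divisor for each place.\<close>
definition class_family :: "('k::field place \<Rightarrow> nat set) \<Rightarrow> ('k place \<Rightarrow> 'k divisor)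
     \<Rightarrow> 'k place \<Rightarrow> ('k divisor) set" where
  "class_family B E = (\<lambda>v\<in>places. divisor_class (open_U_edge (B v)) (E v))"

text \<open>The families of divisors that represent elements of the glued group.\<close>
definition compatible :: "('k::field place \<Rightarrow> nat set) \<Rightarrow> ('k place \<Rightarrow> 'k divisor) \<Rightarrow> bool" where
  "compatible B E \<longleftrightarrow> (\<forall>v\<in>places. supp (E v) \<subseteq> open_U_edge (B v)) \<and>
     (\<forall>v\<in>places. \<forall>v'\<in>places. lin_ext (coord 1) (E v) = lin_ext (coord 1) (E v'))"

lemma max_face_subset: "B \<in> clemens_max_faces \<Longrightarrow> v \<in> places \<Longrightarrow> B v \<in> clemens_edges \<and> B v \<subseteq> {3..7}"
  using clemens_edges_subset by (auto simp: clemens_max_faces_def)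

lemma mult_Pic_UB: "x \<otimes>\<^bsub>Pic_UB B\<^esub> y = (\<lambda>v\<in>places. x v \<otimes>\<^bsub>Pic (open_U_edge (B v))\<^esub> y v)"
  by (simp add: Pic_UB_def Let_def)

lemma carrier_Pic_UB_iff:
  "c \<in> carrier (Pic_UB B) \<longleftrightarrow> c \<in> (\<Pi>\<^sub>E v\<in>places. carrier (Pic (open_U_edge (B v)))) \<and>
    (\<forall>v\<in>places. \<forall>v'\<in>places. restrict_class open_U (c v) = restrict_class open_U (c v'))"
  by (simp add: Pic_UB_def Let_def)

lemma carrier_Pic_UB:
  fixes B :: "'k::field_char_0 place \<Rightarrow> nat set"
  assumes B: "B \<in> clemens_max_faces"
  shows "carrier (Pic_UB B) = class_family B ` {E. compatible B E}"
proof (intro Set.set_eqI iffI)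
  fix c assume c: "c \<in> carrier (Pic_UB B)"
  then have "c v \<in> divisor_class (open_U_edge (B v)) ` {d. supp d \<subseteq> open_U_edge (B v)}" if "v \<in> places" for v
    using that unfolding carrier_Pic_UB_iff carrier_Pic by (auto simp: PiE_def Pi_def)
  then have "\<forall>v\<in>places. \<exists>d. supp d \<subseteq> open_U_edge (B v) \<and> c v = divisor_class (open_U_edge (B v)) d"
    by blast
  then obtain E where E: "\<And>v. v \<in> places \<Longrightarrow> supp (E v) \<subseteq> open_U_edge (B v)"
     "\<And>v. v \<in> places \<Longrightarrow> c v = divisor_class (open_U_edge (B v)) (E v)"
    by metis
  have "lin_ext (coord 1) (E v) = lin_ext (coord 1) (E v')" if "v \<in> places" "v' \<in> places" for v v'
  proof -
    have "restrict_class open_U (c v) = restrict_class open_U (c v')" using c that unfolding carrier_Pic_UB_iff by blast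
    moreover have "B v \<subseteq> {3..7}" "B v' \<subseteq> {3..7}" using that max_face_subset[OF B] by blast+
    ultimately show ?thesis
      using restrict_class_eq_iff[OF _ E(1)[OF that(1)] _ E(1)[OF that(2)]] E(2)[OF that(1)] E(2)[OF that(2)] by metis
  qed
  then have "compatible B E" using E(1) unfolding compatible_def by blast
  moreover have "c = class_family B E"
  proof
    fix v show "c v = class_family B E v"
      using c E by (cases "v \<in> places") (auto simp: class_family_def carrier_Pic_UB_iff PiE_def extensional_def)
  qed
  ultimately show "c \<in> class_family B ` {E. compatible B E}" by blast
next
  fix c assume "c \<in> class_family B ` {E. compatible B E}"
  then obtain E where c: "c = class_family B E" and E: "compatible B E" by blast
  have "restrict_class open_U (c v) = restrict_class open_U (c v')" if "v \<in> places" "v' \<in> places" for v v'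
  proof -
    have "B v \<subseteq> {3..7}" "B v' \<subseteq> {3..7}" using that max_face_subset[OF B] by blast+
    moreover have "supp (E v) \<subseteq> open_U_edge (B v)" "supp (E v') \<subseteq> open_U_edge (B v')"
      "lin_ext (coord 1) (E v) = lin_ext (coord 1) (E v')"
      using E that unfolding compatible_def by blast+
    ultimately have "restrict_class open_U (divisor_class (open_U_edge (B v)) (E v)) =
      restrict_class open_U (divisor_class (open_U_edge (B v')) (E v'))"
      using restrict_class_eq_iff by metis
    then show ?thesis using that by (simp add: c class_family_def)
  qed
  moreover have "c \<in> (\<Pi>\<^sub>E v\<in>places. carrier (Pic (open_U_edge (B v))))"
    using E unfolding c class_family_def compatible_def carrier_Pic by (intro restrict_PiE_iff[THEN iffD2]) blast
  ultimately show "c \<in> carrier (Pic_UB B)"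
    unfolding carrier_Pic_UB_iff by blast
qed

lemma mult_class_family:
  fixes B :: "'k::field_char_0 place \<Rightarrow> nat set"
  assumes B: "B \<in> clemens_max_faces" and E: "compatible B E" "compatible B E'"
  shows "class_family B E \<otimes>\<^bsub>Pic_UB B\<^esub> class_family B E' = class_family B (\<lambda>v. E v + E' v)"
proof -
  have "divisor_class (open_U_edge (B v)) (E v) \<otimes>\<^bsub>Pic (open_U_edge (B v))\<^esub> divisor_class (open_U_edge (B v)) (E' v)
     = divisor_class (open_U_edge (B v)) (E v + E' v)" if "v \<in> places" for v
    using E that max_face_subset[OF B that] unfolding compatible_def by (intro mult_Pic) blast+
  then show ?thesis by (auto simp: mult_Pic_UB class_family_def intro!: restrict_ext)
qed

lemma compatible_add: "compatible B E \<Longrightarrow> compatible B E' \<Longrightarrow> compatible B (\<lambda>v. E v + E' v)"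
  unfolding compatible_def lin_add using keys_add_subset by metis

lemma class_family_eq_iff:
  fixes B :: "'k::field_char_0 place \<Rightarrow> nat set"
  assumes B: "B \<in> clemens_max_faces" and E: "compatible B E" "compatible B E'"
  shows "class_family B E = class_family B E' \<longleftrightarrow> (\<forall>v\<in>places. \<forall>i\<in>insert 1 (B v). lin_ext (coord i) (E v) = lin_ext (coord i) (E' v))"
proof -
  have "class_family B E = class_family B E' \<longleftrightarrow> (\<forall>v\<in>places. divisor_class (open_U_edge (B v)) (E v) = divisor_class (open_U_edge (B v)) (E' v))"
  proof
    assume eq: "class_family B E = class_family B E'"
    show "\<forall>v\<in>places. divisor_class (open_U_edge (B v)) (E v) = divisor_class (open_U_edge (B v)) (E' v)"
    proof
      fix v :: "'k place" assume "v \<in> places"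
      then show "divisor_class (open_U_edge (B v)) (E v) = divisor_class (open_U_edge (B v)) (E' v)"
        using fun_cong[OF eq, of v] by (simp add: class_family_def)
    qed
  next
    assume "\<forall>v\<in>places. divisor_class (open_U_edge (B v)) (E v) = divisor_class (open_U_edge (B v)) (E' v)"
    then show "class_family B E = class_family B E'" unfolding class_family_def by (intro restrict_ext) blast
  qed
  also have "\<dots> \<longleftrightarrow> (\<forall>v\<in>places. \<forall>i\<in>insert 1 (B v). lin_ext (coord i) (E v) = lin_ext (coord i) (E' v))"
  proof (intro ball_cong refl divisor_class_eq_iff)
    fix v :: "'k place" assume v: "v \<in> places"
    show "B v \<subseteq> {3..7}" using max_face_subset[OF B v] by blast
    show "supp (E v) \<subseteq> open_U_edge (B v)" "supp (E' v) \<subseteq> open_U_edge (B v)"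
      using E v unfolding compatible_def by blast+
  qed
  finally show ?thesis .
qed

lemma class_coord_class_family:
  fixes B :: "'k::field_char_0 place \<Rightarrow> nat set"
  assumes "B \<in> clemens_max_faces" "compatible B E" "v \<in> places" "i \<in> insert 1 (B v)"
  shows "class_coord i (class_family B E v) = lin_ext (coord i) (E v)"
proof -
  have "B v \<subseteq> {3..7}" "supp (E v) \<subseteq> open_U_edge (B v)"
    using assms max_face_subset[of B v] unfolding compatible_def by blast+
  then show ?thesis using assms by (simp add: class_family_def class_coord_divisor_class)
qed

text \<open>
  The glued group is the subgroup of compatible families in a product of abelian groups.
\<close>
lemma comm_group_Pic_UB:
  fixes B :: "'k::field_char_0 place \<Rightarrow> nat set"
  assumes B: "B \<in> clemens_max_faces"
  shows "comm_group (Pic_UB B)"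
proof -
  let ?G = "product_group places (\<lambda>v. Pic (open_U_edge (B v) :: 'k prime_divisor set))"
  have gr: "comm_group (Pic (open_U_edge (B v) :: 'k prime_divisor set))" if "v \<in> places" for v
    using that max_face_subset[OF B] by (intro comm_group_Pic) auto
  then have G: "group ?G" by (intro product_group) (auto simp: comm_group_def)
  then interpret G: group ?G .
  have eq: "Pic_UB B = ?G \<lparr>carrier := class_family B ` {E. compatible B E}\<rparr>"
    using carrier_Pic_UB[OF B] by (simp add: Pic_UB_def Let_def)
  have zero: "compatible B (\<lambda>_. 0)" by (simp add: compatible_def)
  have multG: "class_family B E \<otimes>\<^bsub>?G\<^esub> class_family B E' = class_family B (\<lambda>v. E v + E' v)" if "compatible B E" "compatible B E'" for E E'
    using mult_class_family[OF B that] by (simp add: eq)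
  have carG: "class_family B E \<in> carrier ?G" if "compatible B E" for E
  proof -
    have "class_family B E \<in> carrier (Pic_UB B)" using that carrier_Pic_UB[OF B] by blast
    then show ?thesis by (simp add: carrier_Pic_UB_iff)
  qed
  have one: "class_family B (\<lambda>_. 0) = \<one>\<^bsub>?G\<^esub>"
  proof -
    have "class_family B (\<lambda>_. 0) \<otimes>\<^bsub>?G\<^esub> class_family B (\<lambda>_. 0) = class_family B (\<lambda>_. 0)" using multG[OF zero zero] by simp
    then show ?thesis using carG[OF zero] G.l_cancel_one' by metis
  qed
  have sub: "subgroup (class_family B ` {E. compatible B E}) ?G"
  proof (rule G.subgroupI)
    show "class_family B ` {E. compatible B E} \<subseteq> carrier ?G" using carG by blast
    show "class_family B ` {E. compatible B E} \<noteq> {}" using zero by blast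
    fix a assume "a \<in> class_family B ` {E. compatible B E}"
    then obtain E where E: "a = class_family B E" "compatible B E" by blast
    have E': "compatible B (\<lambda>v. - E v)" using E(2) unfolding compatible_def lin_uminus keys_minus by metis
    have "class_family B (\<lambda>v. - E v) \<otimes>\<^bsub>?G\<^esub> a = \<one>\<^bsub>?G\<^esub>" using multG[OF E' E(2)] E one by simp
    then have "inv\<^bsub>?G\<^esub> a = class_family B (\<lambda>v. - E v)" using carG[OF E'] carG[OF E(2)] E by (metis G.inv_equality)
    then show "inv\<^bsub>?G\<^esub> a \<in> class_family B ` {E. compatible B E}" using E' by blast
    fix b assume "b \<in> class_family B ` {E. compatible B E}"
    then obtain F where F: "b = class_family B F" "compatible B F" by blast
    show "a \<otimes>\<^bsub>?G\<^esub> b \<in> class_family B ` {E. compatible B E}"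
      using multG[OF E(2) F(2)] compatible_add[OF E(2) F(2)] E F by blast
  qed
  have grp: "group (Pic_UB B)" unfolding eq by (rule G.subgroup_imp_group[OF sub])
  show ?thesis
  proof (rule group.group_comm_groupI[OF grp])
    fix x y assume "x \<in> carrier (Pic_UB B)" "y \<in> carrier (Pic_UB B)"
    then obtain E F where "x = class_family B E" "y = class_family B F" "compatible B E" "compatible B F"
      unfolding carrier_Pic_UB[OF B] by blast
    then show "x \<otimes>\<^bsub>Pic_UB B\<^esub> y = y \<otimes>\<^bsub>Pic_UB B\<^esub> x" by (simp add: mult_class_family[OF B] add.commute)
  qed
qed

section \<open>Integral bases of abelian groups\<close>

definition additive_on :: "('a, 'b) monoid_scheme \<Rightarrow> ('a \<Rightarrow> 'r::ring_1) \<Rightarrow> bool" where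
  "additive_on G \<phi> \<longleftrightarrow> (\<forall>x\<in>carrier G. \<forall>y\<in>carrier G. \<phi> (x \<otimes>\<^bsub>G\<^esub> y) = \<phi> x + \<phi> y)"

lemma additive_on_int_pow:
  fixes \<phi> :: "'a \<Rightarrow> 'r::ring_1"
  assumes G: "comm_group G" and \<phi>: "additive_on G \<phi>" and x: "x \<in> carrier G"
  shows "\<phi> (x [^]\<^bsub>G\<^esub> (k::int)) = of_int k * \<phi> x"
proof -
  interpret comm_group G by fact
  have add: "\<phi> (a \<otimes>\<^bsub>G\<^esub> b) = \<phi> a + \<phi> b" if "a \<in> carrier G" "b \<in> carrier G" for a b
    using \<phi> that by (simp add: additive_on_def)
  have one: "\<phi> \<one>\<^bsub>G\<^esub> = 0" using add[of "\<one>\<^bsub>G\<^esub>" "\<one>\<^bsub>G\<^esub>"] by simp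
  have nat: "\<phi> (x [^]\<^bsub>G\<^esub> (n::nat)) = of_nat n * \<phi> x" for n
    by (induction n) (simp_all add: one add x algebra_simps)
  have inv: "\<phi> (inv\<^bsub>G\<^esub> a) = - \<phi> a" if "a \<in> carrier G" for a
    using add[of "inv\<^bsub>G\<^esub> a" a] that one by (simp add: eq_neg_iff_add_eq_0)
  show ?thesis
  proof (cases "k \<ge> 0")
    case True
    then obtain n where "k = int n" by (metis nonneg_int_cases)
    then show ?thesis by (simp add: nat int_pow_int)
  next
    case False
    then obtain n where "k = - int n" by (metis neg_int_cases not_le)
    then show ?thesis using x by (simp add: int_pow_neg int_pow_int inv nat)
  qed
qed

lemma additive_on_finprod:
  fixes \<phi> :: "'a \<Rightarrow> 'r::ring_1" and c :: "'i \<Rightarrow> int"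
  assumes G: "comm_group G" and \<phi>: "additive_on G \<phi>" and J: "finite J" "b \<in> J \<rightarrow> carrier G"
  shows "\<phi> (finprod G (\<lambda>i. b i [^]\<^bsub>G\<^esub> c i) J) = (\<Sum>i\<in>J. of_int (c i) * \<phi> (b i))"
  using J
proof (induction J rule: finite_induct)
  case empty
  interpret comm_group G by fact
  have "\<phi> (\<one>\<^bsub>G\<^esub> \<otimes>\<^bsub>G\<^esub> \<one>\<^bsub>G\<^esub>) = \<phi> \<one>\<^bsub>G\<^esub> + \<phi> \<one>\<^bsub>G\<^esub>" using \<phi> unfolding additive_on_def by blast
  then show ?case by simp
next
  case (insert i J)
  interpret comm_group G by fact
  have "finprod G (\<lambda>i. b i [^]\<^bsub>G\<^esub> c i) (insert i J) = b i [^]\<^bsub>G\<^esub> c i \<otimes>\<^bsub>G\<^esub> finprod G (\<lambda>i. b i [^]\<^bsub>G\<^esub> c i) J"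
    using insert by (intro finprod_insert) auto
  moreover have "finprod G (\<lambda>i. b i [^]\<^bsub>G\<^esub> c i) J \<in> carrier G" using insert by (intro finprod_closed) auto
  moreover have "b i [^]\<^bsub>G\<^esub> c i \<in> carrier G" using insert by auto
  ultimately show ?case
    using insert \<phi> additive_on_int_pow[OF G \<phi>, of "b i" "c i"] by (simp add: additive_on_def)
qed

text \<open>
  The product of the powers of the \<open>b i\<close> with exponents \<open>\<theta> i x\<close> has the same coordinates as \<open>x\<close>, hence
  equals \<open>x\<close>.
\<close>
lemma is_Z_basis_dual_coordinates:
  fixes \<theta> :: "nat \<Rightarrow> 'a \<Rightarrow> int"
  assumes G: "comm_group G" and b: "\<And>i. i < n \<Longrightarrow> b i \<in> carrier G"
    and \<theta>: "\<And>i. i < n \<Longrightarrow> additive_on G (\<theta> i)"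
    and dual: "\<And>i j. i < n \<Longrightarrow> j < n \<Longrightarrow> \<theta> i (b j) = (if i = j then 1 else 0)"
    and inj: "\<And>x y. x \<in> carrier G \<Longrightarrow> y \<in> carrier G \<Longrightarrow> (\<And>i. i < n \<Longrightarrow> \<theta> i x = \<theta> i y) \<Longrightarrow> x = y"
  shows "is_Z_basis G n b"
    and "\<And>\<phi> x. additive_on G \<phi> \<Longrightarrow> x \<in> carrier G \<Longrightarrow> \<phi> x = (\<Sum>i<n. of_int (\<theta> i x) * (\<phi> (b i) :: 'r::ring_1))"
proof -
  interpret comm_group G by fact
  let ?p = "\<lambda>c. finprod G (\<lambda>i. b i [^]\<^bsub>G\<^esub> (c i :: int)) {..<n}"
  have bc: "b \<in> {..<n} \<rightarrow> carrier G" using b by auto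
  have p: "?p c \<in> carrier G" for c using b by (intro finprod_closed) auto
  have \<theta>p: "\<theta> i (?p c) = c i" if "i < n" for i c
  proof -
    have "\<theta> i (?p c) = (\<Sum>j<n. c j * \<theta> i (b j))"
      using additive_on_finprod[OF G \<theta>[OF that] _ bc] by simp
    also have "\<dots> = (\<Sum>j<n. if j = i then c i else 0)"
      using that by (intro sum.cong) (auto simp: dual)
    also have "\<dots> = c i" using that by simp
    finally show ?thesis .
  qed
  have px: "x = ?p (\<lambda>i. \<theta> i x)" if "x \<in> carrier G" for x
    using that p \<theta>p by (intro inj) auto
  show "is_Z_basis G n b"
    unfolding is_Z_basis_def
  proof (intro conjI bc bij_betw_imageI)
    show "inj_on ?p ({..<n} \<rightarrow>\<^sub>E UNIV)"
    proof (rule inj_onI)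
      fix c d assume cd: "c \<in> {..<n} \<rightarrow>\<^sub>E UNIV" "d \<in> {..<n} \<rightarrow>\<^sub>E UNIV" "?p c = ?p d"
      show "c = d"
      proof
        fix i show "c i = d i"
          using \<theta>p[of i c] \<theta>p[of i d] cd by (cases "i < n") (auto simp: PiE_def extensional_def)
      qed
    qed
    have "x \<in> ?p ` ({..<n} \<rightarrow>\<^sub>E UNIV)" if "x \<in> carrier G" for x
    proof (rule image_eqI)
      show "x = ?p (\<lambda>i\<in>{..<n}. \<theta> i x)"
        unfolding px[OF that, symmetric] by (subst px[OF that]) (use b in \<open>intro finprod_cong', auto\<close>)
      show "(\<lambda>i\<in>{..<n}. \<theta> i x) \<in> {..<n} \<rightarrow>\<^sub>E UNIV" by (rule restrict_PiE_iff[THEN iffD2]) simp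
    qed
    then show "?p ` ({..<n} \<rightarrow>\<^sub>E UNIV) = carrier G" using p by blast
  qed
  fix \<phi> :: "'a \<Rightarrow> 'r" and x assume "additive_on G \<phi>" "x \<in> carrier G"
  then show "\<phi> x = (\<Sum>i<n. of_int (\<theta> i x) * \<phi> (b i))"
    using additive_on_finprod[OF G _ _ bc, of \<phi> "\<lambda>i. \<theta> i x"] px[of x] by simp
qed

lemma Z_basis_coordinates:
  assumes "comm_group G" "is_Z_basis G n b" "x \<in> carrier G"
  shows "\<exists>c::nat \<Rightarrow> int. x = finprod G (\<lambda>i. b i [^]\<^bsub>G\<^esub> c i) {..<n}"
  using assms unfolding is_Z_basis_def bij_betw_def by blast

lemma Z_basis_unique:
  fixes c d :: "nat \<Rightarrow> int"
  assumes G: "comm_group G" and b: "is_Z_basis G n b"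
    and eq: "finprod G (\<lambda>i. b i [^]\<^bsub>G\<^esub> c i) {..<n} = finprod G (\<lambda>i. b i [^]\<^bsub>G\<^esub> d i) {..<n}" and i: "i < n"
  shows "c i = d i"
proof -
  interpret comm_group G by fact
  have bc: "b \<in> {..<n} \<rightarrow> carrier G" using b by (auto simp: is_Z_basis_def)
  have r: "finprod G (\<lambda>i. b i [^]\<^bsub>G\<^esub> (restrict c {..<n}) i) {..<n} = finprod G (\<lambda>i. b i [^]\<^bsub>G\<^esub> c i) {..<n}" for c :: "nat \<Rightarrow> int"
    using bc by (intro finprod_cong') auto
  have "inj_on (\<lambda>c. finprod G (\<lambda>i. b i [^]\<^bsub>G\<^esub> (c i :: int)) {..<n}) ({..<n} \<rightarrow>\<^sub>E UNIV)"
    using b by (auto simp: is_Z_basis_def bij_betw_def)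
  moreover have "restrict c {..<n} \<in> {..<n} \<rightarrow>\<^sub>E UNIV" "restrict d {..<n} \<in> {..<n} \<rightarrow>\<^sub>E UNIV" by auto
  ultimately have "restrict c {..<n} = restrict d {..<n}"
    using eq[folded r[of c] r[of d]] by (elim inj_onD)
  then have "restrict c {..<n} i = restrict d {..<n} i" by (rule fun_cong)
  then show ?thesis using i by simp
qed

text \<open>
  The matrices hold the coefficients of each basis in terms of the other. They are inverse to
  each other because the coefficients of an element in one basis are unique.
\<close>
lemma Z_basis_change:
  assumes G: "comm_group G" and b: "is_Z_basis G n b" and b': "is_Z_basis G n' b'"
  obtains M M' :: "nat \<Rightarrow> nat \<Rightarrow> int" where
    "\<And>\<phi> i. additive_on G \<phi> \<Longrightarrow> i < n' \<Longrightarrow> (\<phi> (b' i) :: real) = (\<Sum>j<n. of_int (M i j) * \<phi> (b j))"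
    "\<And>\<phi> i. additive_on G \<phi> \<Longrightarrow> i < n \<Longrightarrow> (\<phi> (b i) :: real) = (\<Sum>j<n'. of_int (M' i j) * \<phi> (b' j))"
    "\<And>i k. i < n \<Longrightarrow> k < n \<Longrightarrow> (\<Sum>j<n'. M' i j * M j k) = (if i = k then 1 else 0)"
    "\<And>i k. i < n' \<Longrightarrow> k < n' \<Longrightarrow> (\<Sum>j<n. M i j * M' j k) = (if i = k then 1 else 0)"
proof -
  interpret comm_group G by fact
  let ?p = "\<lambda>(n::nat) b (c::nat \<Rightarrow> int). finprod G (\<lambda>i. b i [^]\<^bsub>G\<^esub> (c i)) {..<n}"
  have bc: "b \<in> {..<n} \<rightarrow> carrier G" "b' \<in> {..<n'} \<rightarrow> carrier G" using b b' by (auto simp: is_Z_basis_def)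
  have "\<forall>i. \<exists>c. i < n' \<longrightarrow> b' i = ?p n b c" using Z_basis_coordinates[OF G b] bc by blast
  then obtain M where M: "\<And>i. i < n' \<Longrightarrow> b' i = ?p n b (M i)" by metis
  have "\<forall>i. \<exists>c. i < n \<longrightarrow> b i = ?p n' b' c" using Z_basis_coordinates[OF G b'] bc by blast
  then obtain M' where M': "\<And>i. i < n \<Longrightarrow> b i = ?p n' b' (M' i)" by metis
  have key: "(\<Sum>j<n'. M' i j * M j k) = (if i = k then 1 else 0)"
    if b: "is_Z_basis G n b" and b': "is_Z_basis G n' b'"
      and M: "\<And>i. i < n' \<Longrightarrow> b' i = ?p n b (M i)" and M': "\<And>i. i < n \<Longrightarrow> b i = ?p n' b' (M' i)"
      and ik: "i < n" "k < n" for b b' n n' and M M' :: "nat \<Rightarrow> nat \<Rightarrow> int" and i k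
  proof -
    have bc: "b \<in> {..<n} \<rightarrow> carrier G" "b' \<in> {..<n'} \<rightarrow> carrier G" using b b' by (auto simp: is_Z_basis_def)
    have pc: "?p n b c \<in> carrier G" for c using bc by (intro finprod_closed) auto
    define co where "co x = (THE c. c \<in> {..<n} \<rightarrow>\<^sub>E UNIV \<and> x = ?p n b c)" for x
    have co: "co (?p n b c) j = c j" if "j < n" for c j
    proof -
      have "?p n b (restrict c {..<n}) = ?p n b c" using bc by (intro finprod_cong') auto
      then have eq: "?p n b c = ?p n b (restrict c {..<n})" by simp
      have "co (?p n b c) = restrict c {..<n}"
        unfolding co_def
      proof (rule the_equality)
        show "restrict c {..<n} \<in> {..<n} \<rightarrow>\<^sub>E UNIV \<and> ?p n b c = ?p n b (restrict c {..<n})"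
          using eq by (intro conjI restrict_PiE_iff[THEN iffD2]) auto
        fix d assume d: "d \<in> {..<n} \<rightarrow>\<^sub>E UNIV \<and> ?p n b c = ?p n b d"
        show "d = restrict c {..<n}"
        proof
          fix i show "d i = restrict c {..<n} i"
            using Z_basis_unique[OF G b, of c d i] d by (cases "i < n") (auto simp: PiE_def extensional_def)
        qed
      qed
      then show ?thesis using that by simp
    qed
    have add: "additive_on G (\<lambda>x. co x k)"
      unfolding additive_on_def
    proof (intro ballI)
      fix x y assume "x \<in> carrier G" "y \<in> carrier G"
      then obtain c d where cd: "x = ?p n b c" "y = ?p n b d" using Z_basis_coordinates[OF G b] by blast
      have "x \<otimes>\<^bsub>G\<^esub> y = finprod G (\<lambda>i. b i [^]\<^bsub>G\<^esub> c i \<otimes>\<^bsub>G\<^esub> b i [^]\<^bsub>G\<^esub> d i) {..<n}"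
        unfolding cd using bc by (subst finprod_multf) auto
      also have "\<dots> = ?p n b (\<lambda>i. c i + d i)"
        using bc by (intro finprod_cong') (auto simp: int_pow_mult[symmetric] Pi_iff)
      finally show "co (x \<otimes>\<^bsub>G\<^esub> y) k = co x k + co y k"
        using co[OF ik(2), of "\<lambda>i. c i + d i"] co[OF ik(2), of c] co[OF ik(2), of d] cd by simp
    qed
    have b1: "b i = ?p n b (\<lambda>j. if j = i then 1 else 0)"
    proof -
      have "x [^]\<^bsub>G\<^esub> (1::int) = x" if "x \<in> carrier G" for x
        using int_pow_int[of G x 1] that by simp
      then have "?p n b (\<lambda>j. if j = i then 1 else 0) = finprod G (\<lambda>j. if i = j then b j else \<one>\<^bsub>G\<^esub>) {..<n}"
        using bc by (intro finprod_cong') (auto simp: Pi_iff)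
      also have "\<dots> = b i" using bc ik by (intro finprod_singleton) auto
      finally show ?thesis by simp
    qed
    have "(\<Sum>j<n'. M' i j * co (b' j) k) = co (b i) k"
      using additive_on_finprod[OF G add _ bc(2), of "M' i"] M'[OF ik(1)] by simp
    also have "co (b i) k = (if i = k then 1 else 0)" by (subst b1) (simp add: co[OF ik(2)])
    also have "(\<Sum>j<n'. M' i j * co (b' j) k) = (\<Sum>j<n'. M' i j * M j k)"
      using co[OF ik(2)] M by (intro sum.cong) auto
    finally show ?thesis .
  qed
  show thesis
  proof (rule that[of M M'])
    show "(\<phi> (b' i) :: real) = (\<Sum>j<n. of_int (M i j) * \<phi> (b j))" if "additive_on G \<phi>" "i < n'" for \<phi> i
      using additive_on_finprod[OF G that(1) _ bc(1), of "M i"] M[OF that(2)] by simp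
    show "(\<phi> (b i) :: real) = (\<Sum>j<n'. of_int (M' i j) * \<phi> (b' j))" if "additive_on G \<phi>" "i < n" for \<phi> i
      using additive_on_finprod[OF G that(1) _ bc(2), of "M' i"] M'[OF that(2)] by simp
    show "(\<Sum>j<n'. M' i j * M j k) = (if i = k then 1 else 0)" if "i < n" "k < n" for i k
      by (rule key[OF b b' M M' that])
    show "(\<Sum>j<n. M i j * M' j k) = (if i = k then 1 else 0)" if "i < n'" "k < n'" for i k
      by (rule key[OF b' b M' M that])
  qed
qed

lemma integer_matrix_inverse_apply:
  fixes A A' :: "nat \<Rightarrow> nat \<Rightarrow> int" and x :: "nat \<Rightarrow> 'r::ring_1"
  assumes "\<And>i k. i < n \<Longrightarrow> k < n \<Longrightarrow> (\<Sum>j<n'. A i j * A' j k) = (if i = k then 1 else 0)" and i: "i < n"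
  shows "(\<Sum>j<n'. of_int (A i j) * (\<Sum>k<n. of_int (A' j k) * x k)) = x i"
proof -
  have "(\<Sum>j<n'. of_int (A i j) * (\<Sum>k<n. of_int (A' j k) * x k)) = (\<Sum>j<n'. \<Sum>k<n. of_int (A i j * A' j k) * x k)"
    by (simp add: sum_distrib_left mult.assoc)
  also have "\<dots> = (\<Sum>k<n. \<Sum>j<n'. of_int (A i j * A' j k) * x k)" by (rule sum.swap)
  also have "\<dots> = (\<Sum>k<n. of_int (\<Sum>j<n'. A i j * A' j k) * x k)" by (simp add: sum_distrib_right)
  also have "\<dots> = (\<Sum>k<n. if k = i then x i else 0)" using assms by (intro sum.cong) auto
  also have "\<dots> = x i" using i by simp
  finally show ?thesis .
qed

text \<open>
  The rank is well defined: multiplication by the integral matrix induces an injection of the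
  vectors modulo 2, and there are \<open>2\<^sup>n\<close> of them.
\<close>
lemma integer_inverse_dims:
  fixes M M' :: "nat \<Rightarrow> nat \<Rightarrow> int"
  assumes 1: "\<And>i k. i < n \<Longrightarrow> k < n \<Longrightarrow> (\<Sum>j<n'. M' i j * M j k) = (if i = k then 1 else 0)"
  shows "n \<le> n'"
proof -
  define P where "P c = (\<lambda>j\<in>{..<n'}. (\<Sum>k<n. M j k * c k) mod 2)" for c :: "nat \<Rightarrow> int"
  have recover: "(\<Sum>j<n'. M' i j * (\<Sum>k<n. M j k * c k)) = c i" if "i < n" for i c
    using integer_matrix_inverse_apply[OF 1 that, where x = c] by simp
  have "inj_on P ({..<n} \<rightarrow>\<^sub>E {0, 1})"
  proof (rule inj_onI)
    fix c d assume cd: "c \<in> {..<n} \<rightarrow>\<^sub>E {0, 1}" "d \<in> {..<n} \<rightarrow>\<^sub>E {0, 1}" "P c = P d"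
    have "c i = d i" if i: "i < n" for i
    proof -
      have "(\<Sum>k<n. M j k * c k) mod 2 = (\<Sum>k<n. M j k * d k) mod 2" if "j < n'" for j
        using fun_cong[OF cd(3), of j] that by (simp add: P_def)
      then have "2 dvd (\<Sum>k<n. M j k * c k) - (\<Sum>k<n. M j k * d k)" if "j < n'" for j
        using that by (simp add: mod_eq_dvd_iff)
      then have "2 dvd (\<Sum>j<n'. M' i j * ((\<Sum>k<n. M j k * c k) - (\<Sum>k<n. M j k * d k)))"
        by (intro dvd_sum dvd_mult) auto
      then have "2 dvd c i - d i"
        using recover[OF i, of c] recover[OF i, of d] by (simp add: right_diff_distrib sum_subtractf)
      moreover have "c i \<in> {0, 1}" "d i \<in> {0, 1}" using cd i by (auto simp: PiE_def Pi_def)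
      ultimately show ?thesis by auto
    qed
    then show "c = d" using cd by (intro PiE_ext[OF cd(1,2)]) auto
  qed
  moreover have "P ` ({..<n} \<rightarrow>\<^sub>E {0, 1}) \<subseteq> {..<n'} \<rightarrow>\<^sub>E {0, 1}"
  proof
    fix y assume "y \<in> P ` ({..<n} \<rightarrow>\<^sub>E {0, 1})"
    then obtain c where y: "y = P c" by blast
    have "x mod 2 \<in> {0, 1}" for x :: int by auto
    then show "y \<in> {..<n'} \<rightarrow>\<^sub>E {0, 1}" unfolding y P_def by (intro restrict_PiE_iff[THEN iffD2]) blast
  qed
  moreover have "finite ({..<n'} \<rightarrow>\<^sub>E {0, 1 :: int})" by (intro finite_PiE) auto
  ultimately have "card ({..<n} \<rightarrow>\<^sub>E {0, 1 :: int}) \<le> card ({..<n'} \<rightarrow>\<^sub>E {0, 1 :: int})"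
    by (rule card_inj_on_le)
  then have "(2::nat) ^ n \<le> 2 ^ n'" by (simp add: card_PiE numeral_2_eq_2)
  then show ?thesis by simp
qed

section \<open>A basis of the glued Picard group\<close>

text \<open>The part of \<open>\<Sum> k\<^sub>i A\<^sub>i\<close> supported on an edge.\<close>
definition edge_divisor :: "(nat \<Rightarrow> int) \<Rightarrow> nat set \<Rightarrow> 'k::field divisor" where
  "edge_divisor k e = (\<Sum>i\<in>e. frag_cmul (k i) (frag_of (curve_A i)))"

lemma curve_A_open_U_edge:
  assumes "e \<subseteq> {3..7}" "i \<in> {1, 2} \<union> e"
  shows "(curve_A i :: 'k::field_char_0 prime_divisor) \<in> open_U_edge e"
proof -
  have i: "i \<in> {1..7}" using assms by auto
  have "curve_A i \<noteq> (curve_A j :: 'k prime_divisor)" if "j \<in> {3..7} - e" for j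
  proof
    assume "curve_A i = (curve_A j :: 'k prime_divisor)"
    then have "i = j" using i that by (intro curve_A_inj) auto
    then show False using that assms by auto
  qed
  then show ?thesis using curve_A_prime[OF i] unfolding open_U_edge_def by blast
qed

lemma keys_edge_divisor:
  assumes "e \<subseteq> {3..7}"
  shows "supp (edge_divisor k e :: 'k::field_char_0 divisor) \<subseteq> open_U_edge e"
proof
  fix P :: "'k prime_divisor" assume P: "P \<in> supp (edge_divisor k e)"
  show "P \<in> open_U_edge e"
  proof (rule ccontr)
    assume "P \<notin> open_U_edge e"
    then have "P \<noteq> curve_A i" if "i \<in> e" for i using curve_A_open_U_edge[OF assms] that by blast
    then have "(\<Sum>i\<in>e. dcoeff (frag_cmul (k i) (frag_of (curve_A i))) P) = 0"
      by (intro sum.neutral) auto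
    then show False using P by (simp add: edge_divisor_def lookup_sum in_keys_iff del: lookup_frag_cmul)
  qed
qed

lemma lin_edge_divisor:
  assumes "e \<subseteq> {3..7}"
  shows "i \<in> e \<Longrightarrow> lin_ext (coord i) (edge_divisor k e :: 'k::field_char_0 divisor) = k i"
    "lin_ext (coord 1) (edge_divisor k e :: 'k::field_char_0 divisor) = 0"
proof -
  have fin: "finite e" using assms finite_subset by blast
  have *: "lin_ext (coord i) (edge_divisor k e :: 'k::field_char_0 divisor) = (\<Sum>j\<in>e. if j = i then k i else 0)"
    if "i \<in> {1,3,4,5,6,7}" for i
    unfolding edge_divisor_def lin_sum lin_cmul lin_frag_of
  proof (intro sum.cong refl)
    fix j assume "j \<in> e"
    then have "j \<in> {1,3,4,5,6,7}" using assms by auto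
    then show "k j * coord i (curve_A j :: 'k prime_divisor) = (if j = i then k i else 0)"
      using coord_curve_A[OF _ that, of j] by auto
  qed
  show "lin_ext (coord i) (edge_divisor k e :: 'k divisor) = k i" if "i \<in> e"
  proof -
    have "i \<in> {1,3,4,5,6,7}" using that assms by auto
    then show ?thesis using fin that by (subst *) auto
  qed
  have "1 \<notin> e" using assms by auto
  then show "lin_ext (coord 1) (edge_divisor k e :: 'k divisor) = 0"
    using fin by (subst *) auto
qed

text \<open>A maximal face \<open>B\<close> together with an enumeration \<open>h\<close> of the places.\<close>
locale max_face_chart =
  fixes B :: "'k::field_char_0 place \<Rightarrow> nat set" and m :: nat and h :: "nat \<Rightarrow> 'k place"
  assumes B: "B \<in> clemens_max_faces" and h: "bij_betw h {..<m} places" and m: "m > 0"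
begin

lemma h_place: "j < m \<Longrightarrow> h j \<in> places"
  using h by (auto simp: bij_betw_def)

lemma h_inj: "i < m \<Longrightarrow> j < m \<Longrightarrow> h i = h j \<longleftrightarrow> i = j"
  using h by (auto simp: bij_betw_def inj_on_def)

lemma edge: "j < m \<Longrightarrow> B (h j) \<in> clemens_edges" "j < m \<Longrightarrow> B (h j) \<subseteq> {3..7}"
  using max_face_subset[OF B h_place] by blast+

definition at_place :: "nat \<Rightarrow> ('k divisor) \<Rightarrow> 'k place \<Rightarrow> 'k divisor" where
  "at_place j D = (\<lambda>v. if v = h j then D else 0)"

text \<open>
  The basis of the glued group is chosen such that the values of a functional on it are \<open>\<lambda>\<^sub>0, \<dots>,
  \<lambda>\<^sub>m\<^sub>-\<^sub>1, \<mu>\<^sub>0, \<dots>, \<mu>\<^sub>m\<^sub>-\<^sub>1, x\<close>, because in these coordinates the polytopes of different faces fit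
  together.
\<close>
definition basis_divisor :: "nat \<Rightarrow> 'k place \<Rightarrow> 'k divisor" where
  "basis_divisor j =
    (if j < m then at_place j (edge_divisor lam_coeff (B (h j)))
     else if j < 2 * m then at_place (j - m) (edge_divisor mu_coeff (B (h (j - m))))
     else (\<lambda>_. frag_of (curve_A 1)))"

definition basis :: "nat \<Rightarrow> 'k place \<Rightarrow> ('k divisor) set" where
  "basis j = class_family B (basis_divisor j)"

text \<open>
  The coordinates dual to \<open>basis\<close>, with the two coordinates along an edge combined as in \<open>edge_dual\<close>.
\<close>
definition dual_coord :: "nat \<Rightarrow> ('k place \<Rightarrow> ('k divisor) set) \<Rightarrow> int" where
  "dual_coord j c =
    (if j < m then \<Sum>i\<in>B (h j). edge_alpha (B (h j)) i * class_coord i (c (h j))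
     else if j < 2 * m then \<Sum>i\<in>B (h (j - m)). edge_beta (B (h (j - m))) i * class_coord i (c (h (j - m)))
     else class_coord 1 (c (h 0)))"

lemma compatible_at_place:
  assumes "j < m" "supp D \<subseteq> open_U_edge (B (h j))" "lin_ext (coord 1) D = 0"
  shows "compatible B (at_place j D)"
  using assms by (auto simp: compatible_def at_place_def)

lemma compatible_const:
  assumes "supp D \<subseteq> open_U_edge {}"
  shows "compatible B (\<lambda>_. D)"
proof -
  have "open_U_edge {} \<subseteq> open_U_edge (B v)" for v by (auto simp: open_U_edge_def)
  then show ?thesis using assms by (auto simp: compatible_def)
qed

lemma compatible_basis_divisor: "compatible B (basis_divisor j)"
proof -
  have "supp (frag_of (curve_A 1 :: 'k prime_divisor)) \<subseteq> open_U_edge {}"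
    using curve_A_open_U_edge[of "{}" 1] by simp
  then have "compatible B (\<lambda>_. frag_of (curve_A 1))" by (rule compatible_const)
  moreover have "compatible B (at_place i (edge_divisor k (B (h i))))" if "i < m" for i k
    using that edge(2)[OF that] by (intro compatible_at_place keys_edge_divisor lin_edge_divisor)
  ultimately show ?thesis by (simp add: basis_divisor_def)
qed

lemma dual_coord_family:
  assumes E: "compatible B E"
  shows "dual_coord j (class_family B E) =
    (if j < m then \<Sum>i\<in>B (h j). edge_alpha (B (h j)) i * lin_ext (coord i) (E (h j))
     else if j < 2 * m then \<Sum>i\<in>B (h (j - m)). edge_beta (B (h (j - m))) i * lin_ext (coord i) (E (h (j - m)))
     else lin_ext (coord 1) (E (h 0)))"
proof -
  have *: "class_coord i (class_family B E (h j)) = lin_ext (coord i) (E (h j))" if "j < m" "i \<in> insert 1 (B (h j))" for i j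
    using class_coord_class_family[OF B E h_place[OF that(1)] that(2)] .
  have "(\<Sum>i\<in>B (h j). k i * class_coord i (class_family B E (h j))) = (\<Sum>i\<in>B (h j). k i * lin_ext (coord i) (E (h j)))"
    if "j < m" for j k using * that by (intro sum.cong) auto
  then show ?thesis using *[OF m] by (simp add: dual_coord_def)
qed

lemma dual_coord_basis:
  assumes "i < 2 * m + 1" "j < 2 * m + 1"
  shows "dual_coord i (basis j) = (if i = j then 1 else 0)"
proof -
  have at: "lin_ext (coord l) (at_place j' D (h i')) = (if i' = j' then lin_ext (coord l) D else 0)" if "i' < m" "j' < m" for i' j' l D
    using h_inj[OF that] by (simp add: at_place_def)
  have ed: "(\<Sum>l\<in>B (h i'). k l * lin_ext (coord l) (edge_divisor k' (B (h i')) :: 'k divisor)) = (\<Sum>l\<in>B (h i'). k l * k' l)" if "i' < m" for i' k k'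
    using lin_edge_divisor(1)[OF edge(2)[OF that]] by (intro sum.cong) auto
  have A1: "(\<Sum>l\<in>B (h i'). k l * coord l (curve_A 1 :: 'k prime_divisor)) = 0" if "i' < m" for i' k
  proof (intro sum.neutral ballI)
    fix l assume "l \<in> B (h i')"
    then have "l \<in> {1,3,4,5,6,7}" "l \<noteq> 1" using edge(2)[OF that] by auto
    then show "k l * coord l (curve_A 1 :: 'k prime_divisor) = 0" by (subst coord_curve_A) auto
  qed
  have c11: "coord 1 (curve_A 1 :: 'k prime_divisor) = 1" by (subst coord_curve_A) auto
  have l1: "lin_ext (coord 1) (edge_divisor k (B (h i')) :: 'k divisor) = 0" if "i' < m" for i' k
    using lin_edge_divisor(2)[OF edge(2)[OF that]] .
  note th = dual_coord_family[OF compatible_basis_divisor[of j], of i, folded basis_def]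
  consider "i < m" | i' where "i = m + i'" "i' < m" | "i = 2 * m"
    using assms(1) by (metis add_diff_inverse_nat less_antisym mult_2 nat_add_left_cancel_less not_less Suc_eq_plus1)
  note ci = this
  consider "j < m" | j' where "j = m + j'" "j' < m" | "j = 2 * m"
    using assms(2) by (metis add_diff_inverse_nat less_antisym mult_2 nat_add_left_cancel_less not_less Suc_eq_plus1)
  then show ?thesis
  proof cases
    case 1
    show ?thesis using ci
    proof cases
      case c: 1
      then show ?thesis using 1 edge_dual(1)[OF edge(1)[OF c]] ed[OF c]
        unfolding th by (auto simp: basis_divisor_def at)
    next
      case c: 2
      then show ?thesis using 1 edge_dual(3)[OF edge(1)[OF c(2)]] ed[OF c(2)]
        unfolding th by (cases "i' = j") (auto simp: basis_divisor_def at)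
    next
      case c: 3
      then show ?thesis using 1 m l1
        unfolding th by (auto simp: basis_divisor_def at)
    qed
  next
    case 2
    show ?thesis using ci
    proof cases
      case c: 1
      then show ?thesis using 2 edge_dual(2)[OF edge(1)[OF c]] ed[OF c]
        unfolding th by (cases "i = j'") (auto simp: basis_divisor_def at)
    next
      case c: 2
      then show ?thesis using 2 edge_dual(4)[OF edge(1)[OF c(2)]] ed[OF c(2)]
        unfolding th by (cases "i' = j'") (auto simp: basis_divisor_def at)
    next
      case c: 3
      then show ?thesis using 2 m l1
        unfolding th by (auto simp: basis_divisor_def at)
    qed
  next
    case 3
    show ?thesis using ci
      unfolding th by cases (use 3 m A1 c11 in \<open>auto simp: basis_divisor_def\<close>)
  qed
qed

lemma dual_coord_additive: "additive_on (Pic_UB B) (dual_coord j)"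
  unfolding additive_on_def carrier_Pic_UB[OF B]
proof (intro ballI)
  fix x y assume "x \<in> class_family B ` {E. compatible B E}" "y \<in> class_family B ` {E. compatible B E}"
  then obtain E F where E: "compatible B E" "x = class_family B E" and F: "compatible B F" "y = class_family B F" by blast
  show "dual_coord j (x \<otimes>\<^bsub>Pic_UB B\<^esub> y) = dual_coord j x + dual_coord j y"
    unfolding E(2) F(2) mult_class_family[OF B E(1) F(1)]
    by (simp add: dual_coord_family E F compatible_add lin_add sum.distrib algebra_simps)
qed

text \<open>
  The coordinates along the edge at each place are recovered from the dual coordinates by
  \<open>edge_inverse\<close>, and those along \<open>A\<^sub>1\<close> agree at all places.
\<close>
lemma dual_coord_inj:
  assumes "x \<in> carrier (Pic_UB B)" "y \<in> carrier (Pic_UB B)" "\<And>j. j < 2 * m + 1 \<Longrightarrow> dual_coord j x = dual_coord j y"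
  shows "x = y"
proof -
  obtain E F where E: "compatible B E" "x = class_family B E" and F: "compatible B F" "y = class_family B F"
    using assms(1,2) unfolding carrier_Pic_UB[OF B] by blast
  have eq: "lin_ext (coord i) (E (h j)) = lin_ext (coord i) (F (h j))" if j: "j < m" and i: "i \<in> insert 1 (B (h j))" for i j
  proof (cases "i = 1")
    case True
    have "lin_ext (coord 1) (E (h 0)) = lin_ext (coord 1) (F (h 0))"
      using assms(3)[of "2 * m"] by (simp add: E F dual_coord_family)
    moreover have "lin_ext (coord 1) (E (h 0)) = lin_ext (coord 1) (E (h j))" "lin_ext (coord 1) (F (h 0)) = lin_ext (coord 1) (F (h j))"
      using E(1) F(1) h_place[OF m] h_place[OF j] unfolding compatible_def by blast+
    ultimately show ?thesis using True by simp
  next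
    case False
    then have i: "i \<in> B (h j)" using i by simp
    have "dual_coord j x = dual_coord j y" "dual_coord (m + j) x = dual_coord (m + j) y" using assms(3) j by simp_all
    then show ?thesis
      unfolding edge_inverse[OF edge(1)[OF j] i, of "\<lambda>i. lin_ext (coord i) (E (h j))"]
        edge_inverse[OF edge(1)[OF j] i, of "\<lambda>i. lin_ext (coord i) (F (h j))"]
      using j by (simp add: E F dual_coord_family)
  qed
  show ?thesis
    unfolding E(2) F(2) class_family_eq_iff[OF B E(1) F(1)]
  proof (intro ballI)
    fix v i assume v: "v \<in> places" and i: "i \<in> insert 1 (B v)"
    then obtain j where "j < m" "v = h j" using h by (auto simp: bij_betw_def)
    then show "lin_ext (coord i) (E v) = lin_ext (coord i) (F v)" using eq i by blast
  qed
qed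

lemma basis_carrier: "basis j \<in> carrier (Pic_UB B)"
  unfolding basis_def carrier_Pic_UB[OF B] using compatible_basis_divisor by blast

lemma is_Z_basis_basis: "is_Z_basis (Pic_UB B) (2 * m + 1) basis"
  by (rule is_Z_basis_dual_coordinates(1)[where \<theta> = dual_coord, OF comm_group_Pic_UB[OF B]])
    (use basis_carrier dual_coord_additive dual_coord_basis dual_coord_inj in blast)+

lemma functional_expansion:
  assumes "additive_on (Pic_UB B) (\<phi> :: _ \<Rightarrow> real)" "x \<in> carrier (Pic_UB B)"
  shows "\<phi> x = (\<Sum>j<2 * m + 1. of_int (dual_coord j x) * \<phi> (basis j))"
  by (rule is_Z_basis_dual_coordinates(2)[where \<theta> = dual_coord, OF comm_group_Pic_UB[OF B]])
    (use basis_carrier dual_coord_additive dual_coord_basis dual_coord_inj assms in blast)+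

text \<open>
  The value on the boundary curve \<open>A\<^sub>i\<close> at the place \<open>h j\<close> of the functional with values \<open>y\<close> on \<open>basis\<close>.
\<close>
definition boundary_coord :: "(nat \<Rightarrow> real) \<Rightarrow> nat \<Rightarrow> nat \<Rightarrow> real" where
  "boundary_coord y j i = of_int (edge_alpha (B (h j)) i) * y j + of_int (edge_beta (B (h j)) i) * y (m + j)"

text \<open>
  The value of a functional on a class, in terms of its values on \<open>A\<^sub>1\<close> and on the boundary curves.
\<close>
lemma sum_dual_coord_family:
  assumes E: "compatible B E"
  shows "(\<Sum>j<2 * m + 1. of_int (dual_coord j (class_family B E)) * y j) =
    of_int (lin_ext (coord 1) (E (h 0))) * y (2 * m) +
    (\<Sum>j<m. \<Sum>i\<in>B (h j). of_int (lin_ext (coord i) (E (h j))) * boundary_coord y j i)"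
proof -
  have split: "(\<Sum>j<2 * m + 1. f j) = (\<Sum>j<m. f j + f (m + j)) + f (2 * m)" for f :: "nat \<Rightarrow> real"
  proof -
    have "(\<Sum>j<m + m. f j) = (\<Sum>j<m. f j) + (\<Sum>j\<in>{m..<m + m}. f j)"
      by (metis atLeast0LessThan le_add1 sum.atLeastLessThan_concat zero_le)
    also have "(\<Sum>j\<in>{m..<m + m}. f j) = (\<Sum>j<m. f (m + j))"
      using sum.shift_bounds_nat_ivl[of f 0 m m] by (simp add: atLeast0LessThan add.commute)
    finally show ?thesis by (simp add: sum.distrib mult_2)
  qed
  show ?thesis
    unfolding split
    by (simp add: dual_coord_family[OF E] boundary_coord_def sum.distrib sum_distrib_left sum_distrib_right algebra_simps)
qed

end

section \<open>The polytope in coordinates\<close>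

text \<open>The coefficients of \<open>A\<^sub>1 + A\<^sub>2\<close> along \<open>A\<^sub>3, \<dots>, A\<^sub>7\<close>.\<close>
definition rho_coeff :: "nat \<Rightarrow> int" where "rho_coeff i = lam_coeff i - mu_coeff i"

lemma edge_elem_cases: "e \<subseteq> {3..7} \<Longrightarrow> i \<in> e \<Longrightarrow> i \<in> {3, 4, 5, 6, 7 :: nat}"
  by auto

text \<open>
  The coefficients along \<open>A\<^sub>3, \<dots>, A\<^sub>6\<close> in the basis \<open>A\<^sub>1, \<dots>, A\<^sub>6\<close>, in which every curve that meets \<open>U\<close> has
  nonnegative coefficients; the value 0 at the index 7 allows sums over edges that contain \<open>A\<^sub>7\<close>.
\<close>
definition effective_coeff :: "nat \<Rightarrow> 'k::field prime_divisor \<Rightarrow> int" where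
  "effective_coeff i P = (if i = 3 then class_coeff 1 P else if i = 4 then class_coeff 2 P
     else if i = 5 then class_coeff 3 P else if i = 6 then class_coeff 0 P else 0)"

lemma coord_effective_coeff:
  assumes "i \<in> {3, 4, 5, 6, 7}"
  shows "coord i P = effective_coeff i P + class_coeff 4 P * rho_coeff i"
  using assms by (auto simp: coord_def effective_coeff_def rho_coeff_def lam_coeff_def mu_coeff_def)

text \<open>
  In the basis \<open>A\<^sub>6, E\<^sub>1, \<dots>, E\<^sub>5\<close> a plane curve has the coefficients \<open>d\<close> and \<open>d - ord\<^sub>k\<close>, and \<open>A\<^sub>7\<close> is the
  only curve with a negative one.
\<close>
lemma class_coeff_nonneg:
  fixes P :: "'k::field_char_0 prime_divisor"
  assumes "P \<in> open_U"
  shows "0 \<le> class_coeff k P"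
proof (cases P)
  case (Inr f)
  have "P \<in> prime_divisors" "P \<noteq> curve_A 7" using assms by (auto simp: open_U_def)
  then have "f \<in> plane_curves" "f \<noteq> form_v + form_w"
    using Inr by (auto simp: prime_divisors_alt curve_A_def)
  then show ?thesis using ordE_le_tdeg[of f k] Inr by (simp del: ord_along.simps)
qed simp

text \<open>
  Expanding the definition gives \<open>-K - D = 2 A\<^sub>1 + 2 A\<^sub>2 + A\<^sub>3 - A\<^sub>5 + 2 A\<^sub>6 - A\<^sub>7\<close>, from which \<open>A\<^sub>2\<close> is
  eliminated.
\<close>
lemma coord_log_anticanonical:
  "lin_ext (coord 1) (log_anticanonical_divisor :: 'k::field_char_0 divisor) = 0"
  "i \<in> {3, 4, 5, 6, 7} \<Longrightarrow> lin_ext (coord i) (log_anticanonical_divisor :: 'k::field_char_0 divisor) = lam_coeff i"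
proof -
  have t0: "lin_ext (coord i) (total_l 0 :: 'k divisor) = coord i (Strict form_u :: 'k prime_divisor) +
    coord i (Exceptional 1 :: 'k prime_divisor) + coord i (Exceptional 2 :: 'k prime_divisor) + coord i (Exceptional 3 :: 'k prime_divisor) + coord i (Exceptional 4 :: 'k prime_divisor) + coord i (Exceptional 5 :: 'k prime_divisor)" for i
    by (simp add: total_l_def lin_add lin_sum lin_cmul atLeastAtMost_1_5[simplified] ordE_form_u add.assoc del: ord_along.simps)
  have t: "lin_ext (coord i) (\<Sum>j\<in>{1..5}. total_l j :: 'k divisor) =
    coord i (Exceptional 1 :: 'k prime_divisor) + 2 * coord i (Exceptional 2 :: 'k prime_divisor) + 3 * coord i (Exceptional 3 :: 'k prime_divisor) + coord i (Exceptional 4 :: 'k prime_divisor) + coord i (Exceptional 5 :: 'k prime_divisor)" for i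
    by (simp add: atLeastAtMost_1_5[simplified] total_l_def lin_add)
  have b: "lin_ext (coord i) (boundary :: 'k divisor) = coord i (curve_A 3 :: 'k prime_divisor) + coord i (curve_A 4 :: 'k prime_divisor) +
    coord i (curve_A 5 :: 'k prime_divisor) + coord i (curve_A 6 :: 'k prime_divisor) + coord i (curve_A 7 :: 'k prime_divisor)" for i
    by (simp add: boundary_def atLeastAtMost_3_7 lin_add)
  have l: "lin_ext (coord i) (log_anticanonical_divisor :: 'k divisor) =
    3 * (coord i (curve_A 6 :: 'k prime_divisor) + coord i (curve_A 3 :: 'k prime_divisor) + coord i (curve_A 4 :: 'k prime_divisor) + coord i (curve_A 5 :: 'k prime_divisor) + coord i (curve_A 2 :: 'k prime_divisor) + coord i (curve_A 1 :: 'k prime_divisor))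
    - (coord i (curve_A 3 :: 'k prime_divisor) + 2 * coord i (curve_A 4 :: 'k prime_divisor) + 3 * coord i (curve_A 5 :: 'k prime_divisor) + coord i (curve_A 2 :: 'k prime_divisor) + coord i (curve_A 1 :: 'k prime_divisor))
    - (coord i (curve_A 3 :: 'k prime_divisor) + coord i (curve_A 4 :: 'k prime_divisor) + coord i (curve_A 5 :: 'k prime_divisor) + coord i (curve_A 6 :: 'k prime_divisor) + coord i (curve_A 7 :: 'k prime_divisor))" for i
    unfolding log_anticanonical_divisor_def canonical_divisor_def lin_diff lin_uminus lin_add lin_cmul t0 t b
    by (simp add: curve_A_def)
  have A: "coord i (curve_A j :: 'k prime_divisor) = (if i = j then 1 else 0)"
    if "i \<in> {1,3,4,5,6,7}" "j \<in> {1,3,4,5,6,7}" for i j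
    using coord_curve_A[OF that(2,1)] .
  show "lin_ext (coord 1) (log_anticanonical_divisor :: 'k divisor) = 0"
    unfolding l using coord_curve_A2(1)[where 'k = 'k] by (simp add: A)
  show "lin_ext (coord i) (log_anticanonical_divisor :: 'k divisor) = lam_coeff i" if "i \<in> {3, 4, 5, 6, 7}"
    using that unfolding l by (auto simp: A coord_curve_A2 lam_coeff_def)
qed

lemma keys_log_anticanonical: "supp (log_anticanonical_divisor :: 'k::field_char_0 divisor) \<subseteq> prime_divisors"
proof -
  let ?N = "{d :: 'k divisor. supp d \<subseteq> prime_divisors}"
  have add: "a + b \<in> ?N" if "a \<in> ?N" "b \<in> ?N" for a b using that keys_add_subset by blast
  have diff: "a - b \<in> ?N" if "a \<in> ?N" "b \<in> ?N" for a b using that keys_diff_subset by blast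
  have cmul: "frag_cmul c a \<in> ?N" if "a \<in> ?N" for a c using that keys_cmul[of c a] by blast
  have sum: "sum a S \<in> ?N" if "\<And>i. i \<in> S \<Longrightarrow> a i \<in> ?N" for a and S :: "nat set"
    using that
  proof (induction S rule: infinite_finite_induct)
    case (insert i S)
    have "a i + sum a S \<in> ?N" using insert by (intro add) auto
    then show ?case using insert.hyps by simp
  qed auto
  have E: "frag_of (Exceptional k) \<in> ?N" if "k \<in> {1..5}" for k using that by (simp add: prime_divisors_alt)
  have u: "frag_of (Strict form_u) \<in> ?N" by (simp add: prime_divisors_alt linear_plane_curves)
  have t0: "total_l 0 \<in> ?N"
    unfolding total_l_def by (simp only: nth_Cons_0) (intro add u sum cmul E)
  have "total_l i \<in> ?N" if "i \<in> {1..5}" for i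
  proof -
    have "i \<in> {1,2,3,4,5}" using that by auto
    moreover have "frag_of (Exceptional 1) + frag_of (Exceptional 2) + frag_of (Exceptional 3) \<in> ?N"
      "frag_of (Exceptional 2) + frag_of (Exceptional 3) \<in> ?N"
      by (intro add E; simp)+
    ultimately show ?thesis using E[of 3] E[of 4] E[of 5] by (auto simp: total_l_def)
  qed
  then have "canonical_divisor \<in> ?N" unfolding canonical_divisor_def by (intro add sum cmul t0)
  moreover have "boundary \<in> ?N" unfolding boundary_def
    by (intro sum) (simp add: curve_A_prime)
  moreover have "- d \<in> ?N" if "d \<in> ?N" for d using that by simp
  ultimately have "log_anticanonical_divisor \<in> ?N" unfolding log_anticanonical_divisor_def by (intro diff)
  then show ?thesis by simp
qed

context max_face_chart
begin

text \<open>
  The dual of the effective cone: the functional is nonnegative on \<open>A\<^sub>1\<close>, on the boundary curves at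
  each place and on \<open>A\<^sub>2\<close>.
\<close>
definition in_cone :: "(nat \<Rightarrow> real) \<Rightarrow> bool" where
  "in_cone y \<longleftrightarrow> 0 \<le> y (2 * m) \<and> (\<forall>j<m. \<forall>i\<in>B (h j). 0 \<le> boundary_coord y j i) \<and>
     y (2 * m) + (\<Sum>j<m. y (m + j)) \<le> (\<Sum>j<m. y j)"

lemma sum_boundary_coord:
  assumes j: "j < m"
  shows "(\<Sum>i\<in>B (h j). of_int (lam_coeff i) * boundary_coord y j i) = y j"
    "(\<Sum>i\<in>B (h j). of_int (mu_coeff i) * boundary_coord y j i) = y (m + j)"
    "(\<Sum>i\<in>B (h j). of_int (rho_coeff i) * boundary_coord y j i) = y j - y (m + j)"
proof -
  let ?e = "B (h j)"
  have *: "(\<Sum>i\<in>?e. of_int (k i) * boundary_coord y j i) =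
     of_int (\<Sum>i\<in>?e. edge_alpha ?e i * k i) * y j + of_int (\<Sum>i\<in>?e. edge_beta ?e i * k i) * y (m + j)" for k
    by (simp add: boundary_coord_def sum.distrib sum_distrib_left algebra_simps)
  show 1: "(\<Sum>i\<in>?e. of_int (lam_coeff i) * boundary_coord y j i) = y j"
    and 2: "(\<Sum>i\<in>?e. of_int (mu_coeff i) * boundary_coord y j i) = y (m + j)"
    unfolding * by (simp_all add: edge_dual[OF edge(1)[OF j]])
  show "(\<Sum>i\<in>?e. of_int (rho_coeff i) * boundary_coord y j i) = y j - y (m + j)"
    using 1 2 by (simp add: rho_coeff_def left_diff_distrib sum_subtractf)
qed

abbreviation pairing :: "(nat \<Rightarrow> real) \<Rightarrow> ('k place \<Rightarrow> ('k divisor) set) \<Rightarrow> real" where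
  "pairing y c \<equiv> (\<Sum>j<2 * m + 1. of_int (dual_coord j c) * y j)"

lemma log_anticanonical_class_family:
  "log_anticanonical_class B = class_family B (\<lambda>v. restrict_divisor (open_U_edge (B v)) log_anticanonical_divisor)"
  by (simp add: log_anticanonical_class_def class_family_def)

lemma compatible_log_anticanonical:
  "compatible B (\<lambda>v. restrict_divisor (open_U_edge (B v)) log_anticanonical_divisor)"
  unfolding compatible_def
proof (intro conjI ballI)
  fix v v' :: "'k place" assume v: "v \<in> places" "v' \<in> places"
  show "supp (restrict_divisor (open_U_edge (B v)) log_anticanonical_divisor) \<subseteq> open_U_edge (B v)"
    by (simp add: keys_restrict_divisor)
  have "B v \<subseteq> {3..7}" "B v' \<subseteq> {3..7}" using max_face_subset[OF B] v by blast+
  then show "lin_ext (coord 1) (restrict_divisor (open_U_edge (B v)) log_anticanonical_divisor :: 'k divisor) =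
    lin_ext (coord 1) (restrict_divisor (open_U_edge (B v')) log_anticanonical_divisor :: 'k divisor)"
    by (simp add: lin_coord_restrict_divisor keys_log_anticanonical)
qed

lemma log_anticanonical_carrier: "log_anticanonical_class B \<in> carrier (Pic_UB B)"
  unfolding log_anticanonical_class_family carrier_Pic_UB[OF B] using compatible_log_anticanonical by blast

lemma pairing_log_anticanonical: "pairing y (log_anticanonical_class B) = (\<Sum>j<m. y j)"
proof -
  have r: "lin_ext (coord i) (restrict_divisor (open_U_edge (B (h j))) log_anticanonical_divisor :: 'k divisor)
    = lin_ext (coord i) (log_anticanonical_divisor :: 'k divisor)" if "j < m" "i \<in> insert 1 (B (h j))" for i j
    using lin_coord_restrict_divisor[OF edge(2)[OF that(1)] keys_log_anticanonical that(2)] .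
  have 0: "lin_ext (coord 1) (restrict_divisor (open_U_edge (B (h 0))) log_anticanonical_divisor :: 'k divisor) = 0"
    using r[OF m, of 1] coord_log_anticanonical(1) by simp
  have "(\<Sum>i\<in>B (h j). of_int (lin_ext (coord i) (restrict_divisor (open_U_edge (B (h j))) log_anticanonical_divisor :: 'k divisor)) * boundary_coord y j i)
     = y j" if j: "j < m" for j
  proof -
    have "(\<Sum>i\<in>B (h j). of_int (lin_ext (coord i) (restrict_divisor (open_U_edge (B (h j))) log_anticanonical_divisor :: 'k divisor)) * boundary_coord y j i)
      = (\<Sum>i\<in>B (h j). of_int (lam_coeff i) * boundary_coord y j i)"
    proof (intro sum.cong refl)
      fix i assume i: "i \<in> B (h j)"
      then show "of_int (lin_ext (coord i) (restrict_divisor (open_U_edge (B (h j))) log_anticanonical_divisor :: 'k divisor)) * boundary_coord y j i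
        = of_int (lam_coeff i) * boundary_coord y j i"
        using r[OF j, of i] coord_log_anticanonical(2)[where 'k = 'k, OF edge_elem_cases[OF edge(2)[OF j] i]] by simp
    qed
    then show ?thesis using sum_boundary_coord(1)[OF j] by simp
  qed
  then show ?thesis
    unfolding log_anticanonical_class_family sum_dual_coord_family[OF compatible_log_anticanonical]
    using 0 by simp
qed

definition effective_family :: "('k place \<Rightarrow> 'k divisor) \<Rightarrow> bool" where
  "effective_family E \<longleftrightarrow> (\<forall>v\<in>places. E v \<in> effective_divisors (open_U_edge (B v))) \<and>
     (\<forall>v\<in>places. \<forall>v'\<in>places. restrict_divisor open_U (E v) = restrict_divisor open_U (E v'))"

lemma effective_classes_class_family: "effective_classes B = class_family B ` {E. effective_family E}"
  unfolding effective_classes_def effective_family_def class_family_def by blast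

lemma effective_family_compatible:
  assumes "effective_family E"
  shows "compatible B E"
  unfolding compatible_def
proof (intro conjI ballI)
  fix v v' :: "'k place" assume v: "v \<in> places" "v' \<in> places"
  have k: "supp (E v) \<subseteq> open_U_edge (B v)" if "v \<in> places" for v
    using assms that by (auto simp: effective_family_def effective_divisors_def)
  then show "supp (E v) \<subseteq> open_U_edge (B v)" using v by blast
  have "lin_ext (coord 1) (restrict_divisor open_U (E v)) = lin_ext (coord 1) (E v)" if "v \<in> places" for v
    using k[OF that] open_U_edge_prime unfolding open_U_alt by (intro lin_coord_restrict_divisor) blast+
  moreover have "restrict_divisor open_U (E v) = restrict_divisor open_U (E v')"
    using assms v unfolding effective_family_def by blast
  ultimately show "lin_ext (coord 1) (E v) = lin_ext (coord 1) (E v')" using v by metis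
qed

text \<open>
  An effective family is a common effective divisor \<open>d\<close> on \<open>U\<close> plus effective boundary divisors at
  the places. A curve \<open>P\<close> in \<open>U\<close> has value \<open>\<Phi> P\<close>, which is a nonnegative combination of the values on
  \<open>A\<^sub>1\<close>, \<open>A\<^sub>2\<close> and the boundary curves by \<open>class_coeff_nonneg\<close>.
\<close>
lemma pairing_nonneg:
  assumes y: "in_cone y" and E: "effective_family E"
  shows "0 \<le> pairing y (class_family B E)"
proof -
  \<comment> \<open>the common part on \<open>U\<close>, which is the same at every place\<close>
  define d where "d = restrict_divisor open_U (E (h 0))"
  have dk: "supp d \<subseteq> open_U" by (simp add: d_def keys_restrict_divisor)
  have kE: "supp (E (h j)) \<subseteq> open_U_edge (B (h j))" and pos: "\<And>P. 0 \<le> dcoeff (E (h j)) P"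
    and res: "restrict_divisor open_U (E (h j)) = d" if "j < m" for j
    using E h_place[OF that] h_place[OF m] unfolding effective_family_def effective_divisors_def d_def by blast+
  have dpos: "0 \<le> dcoeff d P" for P using pos[OF m] by (simp add: d_def lookup_restrict_divisor)
  define w where "w j i = dcoeff (E (h j)) (curve_A i)" for j i
  have decomp: "E (h j) = d + edge_divisor (w j) (B (h j))" if j: "j < m" for j
  proof (rule poly_mapping_eqI)
    fix P
    have eD: "dcoeff (edge_divisor (w j) (B (h j))) P = (\<Sum>i\<in>B (h j). if P = curve_A i then dcoeff (E (h j)) P else 0)"
      unfolding edge_divisor_def lookup_sum by (intro sum.cong refl) (auto simp: w_def)
    have dl: "dcoeff d P = (if P \<in> open_U then dcoeff (E (h j)) P else 0)"
      using lookup_restrict_divisor[of open_U "E (h j)" P] by (simp add: res[OF j])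
    have fin: "finite (B (h j))" using edge(2)[OF j] finite_subset by blast
    show "dcoeff (E (h j)) P = dcoeff (d + edge_divisor (w j) (B (h j))) P"
    proof (cases "\<exists>i\<in>B (h j). P = curve_A i")
      case True
      then obtain i where i: "i \<in> B (h j)" "P = curve_A i" by blast
      have nU: "P \<notin> open_U" using i edge(2)[OF j] by (auto simp: open_U_def)
      have "P = curve_A i' \<longleftrightarrow> i' = i" if "i' \<in> B (h j)" for i'
      proof
        assume "P = curve_A i'"
        moreover have "i' \<in> {1..7}" "i \<in> {3..7}"
          using edge_elem_cases[OF edge(2)[OF j]] that i by fastforce+
        ultimately show "i' = i" using curve_A_inj i(2) by metis
      qed (use i in simp)
      then have "(\<Sum>i\<in>B (h j). if P = curve_A i then dcoeff (E (h j)) P else 0)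
        = (\<Sum>i'\<in>B (h j). if i' = i then dcoeff (E (h j)) P else 0)" by (intro sum.cong) auto
      also have "\<dots> = dcoeff (E (h j)) P" using fin i by simp
      finally show ?thesis using nU by (simp add: lookup_add eD dl)
    next
      case False
      then have "(\<Sum>i\<in>B (h j). if P = curve_A i then dcoeff (E (h j)) P else 0) = 0"
        by (intro sum.neutral) auto
      moreover have "dcoeff (E (h j)) P = 0" if "P \<notin> open_U"
      proof (rule ccontr)
        assume "dcoeff (E (h j)) P \<noteq> 0"
        then have "P \<in> open_U_edge (B (h j))" using kE[OF j] by (auto simp: in_keys_iff)
        then show False using that False by (auto simp: open_U_def open_U_edge_def)
      qed
      ultimately show ?thesis by (simp add: lookup_add eD dl)
    qed
  qed
  have z: "0 \<le> boundary_coord y j i" if "j < m" "i \<in> B (h j)" for j i using y that by (auto simp: in_cone_def)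
  \<comment> \<open>the value of the functional on a curve that meets \<open>U\<close>, taken at all places at once\<close>
  define \<Phi> where "\<Phi> P = of_int (coord 1 P) * y (2 * m) + (\<Sum>j<m. \<Sum>i\<in>B (h j). of_int (coord i P) * boundary_coord y j i)" for P :: "'k prime_divisor"
  have \<Phi>: "0 \<le> \<Phi> P" if P: "P \<in> open_U" for P
  proof -
    note a = class_coeff_nonneg[OF P]
    have "(\<Sum>i\<in>B (h j). of_int (coord i P) * boundary_coord y j i) =
      (\<Sum>i\<in>B (h j). of_int (effective_coeff i P) * boundary_coord y j i) + of_int (class_coeff 4 P) * (y j - y (m + j))" if j: "j < m" for j
    proof -
      have "(\<Sum>i\<in>B (h j). of_int (coord i P) * boundary_coord y j i) =
        (\<Sum>i\<in>B (h j). of_int (effective_coeff i P) * boundary_coord y j i + of_int (class_coeff 4 P) * (of_int (rho_coeff i) * boundary_coord y j i))"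
        using coord_effective_coeff[OF edge_elem_cases[OF edge(2)[OF j]], of _ P]
        by (intro sum.cong) (auto simp: algebra_simps)
      then show ?thesis by (simp add: sum.distrib sum_distrib_left[symmetric] sum_boundary_coord(3)[OF j])
    qed
    then have "\<Phi> P = of_int (coord 1 P) * y (2 * m) +
       ((\<Sum>j<m. \<Sum>i\<in>B (h j). of_int (effective_coeff i P) * boundary_coord y j i) + of_int (class_coeff 4 P) * ((\<Sum>j<m. y j) - (\<Sum>j<m. y (m + j))))"
      by (simp add: \<Phi>_def sum.distrib sum_distrib_left sum_subtractf right_diff_distrib)
    also have "\<dots> = of_int (class_coeff 5 P) * y (2 * m) + of_int (class_coeff 4 P) * ((\<Sum>j<m. y j) - (\<Sum>j<m. y (m + j)) - y (2 * m))
      + (\<Sum>j<m. \<Sum>i\<in>B (h j). of_int (effective_coeff i P) * boundary_coord y j i)"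
      by (simp add: coord_def algebra_simps)
    also have "\<dots> \<ge> 0"
    proof (intro add_nonneg_nonneg mult_nonneg_nonneg sum_nonneg)
      show "0 \<le> y (2 * m)" "0 \<le> (\<Sum>j<m. y j) - (\<Sum>j<m. y (m + j)) - y (2 * m)" using y by (auto simp: in_cone_def)
    qed (use a z in \<open>auto simp: effective_coeff_def\<close>)
    finally show ?thesis .
  qed
  have wpos: "0 \<le> w j i" if "j < m" for j i using pos[OF that] by (simp add: w_def)
  have l1: "lin_ext (coord 1) (E (h 0)) = lin_ext (coord 1) d"
    using decomp[OF m] lin_edge_divisor(2)[OF edge(2)[OF m]] by (simp add: lin_add)
  have li: "lin_ext (coord i) (E (h j)) = lin_ext (coord i) d + w j i" if "j < m" "i \<in> B (h j)" for i j
    using decomp[OF that(1)] lin_edge_divisor(1)[OF edge(2)[OF that(1)] that(2)] by (simp add: lin_add)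
  have "pairing y (class_family B E) = of_int (lin_ext (coord 1) d) * y (2 * m) +
    (\<Sum>j<m. \<Sum>i\<in>B (h j). of_int (lin_ext (coord i) d + w j i) * boundary_coord y j i)"
    unfolding sum_dual_coord_family[OF effective_family_compatible[OF E]] l1
    by (intro arg_cong2[of _ _ _ _ "(+)"] refl sum.cong) (simp_all add: li)
  also have "\<dots> = (of_int (lin_ext (coord 1) d) * y (2 * m) + (\<Sum>j<m. \<Sum>i\<in>B (h j). of_int (lin_ext (coord i) d) * boundary_coord y j i))
     + (\<Sum>j<m. \<Sum>i\<in>B (h j). of_int (w j i) * boundary_coord y j i)"
    by (simp add: sum.distrib distrib_right)
  also have "of_int (lin_ext (coord 1) d) * y (2 * m) + (\<Sum>j<m. \<Sum>i\<in>B (h j). of_int (lin_ext (coord i) d) * boundary_coord y j i)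
     = (\<Sum>P\<in>supp d. of_int (dcoeff d P) * \<Phi> P)"
  proof -
    have "(\<Sum>j<m. \<Sum>i\<in>B (h j). of_int (lin_ext (coord i) d) * boundary_coord y j i)
      = (\<Sum>j<m. \<Sum>i\<in>B (h j). \<Sum>P\<in>supp d. of_int (dcoeff d P) * (of_int (coord i P) * boundary_coord y j i))"
      by (simp add: lin_ext_def sum_distrib_right mult.assoc)
    also have "\<dots> = (\<Sum>j<m. \<Sum>P\<in>supp d. \<Sum>i\<in>B (h j). of_int (dcoeff d P) * (of_int (coord i P) * boundary_coord y j i))"
      by (intro sum.cong refl sum.swap)
    also have "\<dots> = (\<Sum>P\<in>supp d. \<Sum>j<m. \<Sum>i\<in>B (h j). of_int (dcoeff d P) * (of_int (coord i P) * boundary_coord y j i))"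
      by (rule sum.swap)
    finally show ?thesis
      by (simp add: \<Phi>_def lin_ext_def sum_distrib_right sum_distrib_left distrib_left sum.distrib mult.assoc)
  qed
  finally have "pairing y (class_family B E) = (\<Sum>P\<in>supp d. of_int (dcoeff d P) * \<Phi> P)
     + (\<Sum>j<m. \<Sum>i\<in>B (h j). of_int (w j i) * boundary_coord y j i)" .
  moreover have "0 \<le> (\<Sum>P\<in>supp d. of_int (dcoeff d P) * \<Phi> P)"
    using dpos dk \<Phi> by (intro sum_nonneg mult_nonneg_nonneg) auto
  moreover have "0 \<le> (\<Sum>j<m. \<Sum>i\<in>B (h j). of_int (w j i) * boundary_coord y j i)"
    using wpos z by (intro sum_nonneg mult_nonneg_nonneg) auto
  ultimately show ?thesis by simp
qed

text \<open>
  The inequalities of the cone are the values on the effective families \<open>A\<^sub>1\<close>, \<open>A\<^sub>2\<close>, and \<open>A\<^sub>i\<close> at one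
  place only.
\<close>
lemma in_cone_if_pairing_nonneg:
  assumes nn: "\<And>E. effective_family E \<Longrightarrow> 0 \<le> pairing y (class_family B E)"
  shows "in_cone y"
proof -
  have eff: "effective_family (\<lambda>_. frag_of (curve_A k))" if "k \<in> {1, 2}" for k
    using curve_A_open_U_edge[OF max_face_subset[OF B, THEN conjunct2], of _ k] that
    by (auto simp: effective_family_def effective_divisors_def)
  have A: "coord i (curve_A j :: 'k prime_divisor) = (if i = j then 1 else 0)"
    if "i \<in> {1,3,4,5,6,7}" "j \<in> {1,3,4,5,6,7}" for i j
    using coord_curve_A[OF that(2,1)] .
  have A1: "0 \<le> y (2 * m)"
  proof -
    have e: "effective_family (\<lambda>_. frag_of (curve_A 1))" by (rule eff) simp
    have "(\<Sum>j<m. \<Sum>i\<in>B (h j). of_int (lin_ext (coord i) (frag_of (curve_A 1 :: 'k prime_divisor))) * boundary_coord y j i) = 0"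
    proof (intro sum.neutral ballI)
      fix j i assume "j \<in> {..<m}" "i \<in> B (h j)"
      then have "i \<in> {3,4,5,6,7}" using edge_elem_cases[OF edge(2)] by blast
      then have "coord i (curve_A 1 :: 'k prime_divisor) = 0" by (subst A) auto
      then show "of_int (lin_ext (coord i) (frag_of (curve_A 1 :: 'k prime_divisor))) * boundary_coord y j i = 0" by simp
    qed
    then show ?thesis using nn[OF e] A[of 1 1] unfolding sum_dual_coord_family[OF effective_family_compatible[OF e]] by simp
  qed
  have A2: "y (2 * m) + (\<Sum>j<m. y (m + j)) \<le> (\<Sum>j<m. y j)"
  proof -
    have e: "effective_family (\<lambda>_. frag_of (curve_A 2))" by (rule eff) simp
    have "(\<Sum>j<m. \<Sum>i\<in>B (h j). of_int (lin_ext (coord i) (frag_of (curve_A 2 :: 'k prime_divisor))) * boundary_coord y j i)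
      = (\<Sum>j<m. \<Sum>i\<in>B (h j). of_int (rho_coeff i) * boundary_coord y j i)"
    proof (intro sum.cong refl)
      fix j i assume "j \<in> {..<m}" "i \<in> B (h j)"
      then have i: "i \<in> {3,4,5,6,7}" using edge_elem_cases[OF edge(2)] by blast
      have "coord i (curve_A 2 :: 'k prime_divisor) = rho_coeff i"
        using i by (subst coord_effective_coeff[OF i]) (auto simp: curve_A_def effective_coeff_def)
      then show "of_int (lin_ext (coord i) (frag_of (curve_A 2 :: 'k prime_divisor))) * boundary_coord y j i = of_int (rho_coeff i) * boundary_coord y j i" by simp
    qed
    also have "\<dots> = (\<Sum>j<m. y j) - (\<Sum>j<m. y (m + j))"
      by (simp add: sum_boundary_coord(3) sum_subtractf)
    finally show ?thesis
      using nn[OF e] coord_curve_A2(1)[where 'k = 'k] unfolding sum_dual_coord_family[OF effective_family_compatible[OF e]] by simp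
  qed
  have "0 \<le> boundary_coord y j i" if j: "j < m" and i: "i \<in> B (h j)" for j i
  proof -
    let ?D = "frag_of (curve_A i) :: 'k divisor"
    have i7: "i \<in> {3,4,5,6,7}" using edge_elem_cases[OF edge(2)[OF j] i] .
    have nU: "(curve_A i :: 'k prime_divisor) \<notin> open_U" using i7 by (auto simp: open_U_def)
    have r0: "restrict_divisor open_U ?D = 0" "restrict_divisor open_U (0 :: 'k divisor) = 0"
      using nU by (auto intro!: poly_mapping_eqI simp: lookup_restrict_divisor lookup_frag_of)
    have e: "effective_family (at_place j ?D)"
      using curve_A_open_U_edge[OF edge(2)[OF j], of i] i r0
      by (auto simp: effective_family_def effective_divisors_def at_place_def)
    have "(\<Sum>j'<m. \<Sum>i'\<in>B (h j'). of_int (lin_ext (coord i') (at_place j ?D (h j'))) * boundary_coord y j' i')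
      = (\<Sum>j'<m. if j' = j then boundary_coord y j i else 0)"
    proof (intro sum.cong refl)
      fix j' assume j': "j' \<in> {..<m}"
      show "(\<Sum>i'\<in>B (h j'). of_int (lin_ext (coord i') (at_place j ?D (h j'))) * boundary_coord y j' i') = (if j' = j then boundary_coord y j i else 0)"
      proof (cases "j' = j")
        case True
        have "(\<Sum>i'\<in>B (h j). of_int (coord i' (curve_A i :: 'k prime_divisor)) * boundary_coord y j i') = (\<Sum>i'\<in>B (h j). if i' = i then boundary_coord y j i else 0)"
        proof (intro sum.cong refl)
          fix i' assume "i' \<in> B (h j)"
          then have "i' \<in> {3,4,5,6,7}" using edge_elem_cases[OF edge(2)[OF j]] by blast
          then show "of_int (coord i' (curve_A i :: 'k prime_divisor)) * boundary_coord y j i' = (if i' = i then boundary_coord y j i else 0)"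
            using i7 by (subst A) auto
        qed
        moreover have "finite (B (h j))" using edge(2)[OF j] finite_subset by blast
        ultimately show ?thesis using True i by (simp add: at_place_def)
      next
        case False
        then show ?thesis using h_inj[of j' j] j j' by (simp add: at_place_def)
      qed
    qed
    also have "\<dots> = boundary_coord y j i" using j by simp
    moreover have "lin_ext (coord 1) (at_place j ?D (h 0)) = 0"
      using i7 A[of 1 i] by (auto simp: at_place_def)
    ultimately show ?thesis
      using nn[OF e] unfolding sum_dual_coord_family[OF effective_family_compatible[OF e]] by simp
  qed
  then show ?thesis using A1 A2 by (simp add: in_cone_def)
qed

definition polytope_coords :: "(nat \<Rightarrow> real) set" where
  "polytope_coords = {y \<in> {..<2 * m + 1} \<rightarrow>\<^sub>E UNIV. in_cone y \<and> (\<Sum>j<m. y j) \<le> 1}"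

text \<open>
  One inclusion is \<open>in_cone_if_pairing_nonneg\<close>. For the other, the functional with the values \<open>y\<close> on
  the basis is \<open>pairing y\<close>, and \<open>pairing_nonneg\<close> applies.
\<close>
lemma polytope_image: "(\<lambda>\<phi>. \<lambda>i\<in>{..<2 * m + 1}. \<phi> (basis i)) ` polytope_B B = polytope_coords"
proof (intro Set.set_eqI iffI)
  fix y assume "y \<in> (\<lambda>\<phi>. \<lambda>i\<in>{..<2 * m + 1}. \<phi> (basis i)) ` polytope_B B"
  then obtain \<phi> where y: "y = (\<lambda>i\<in>{..<2 * m + 1}. \<phi> (basis i))" and \<phi>: "\<phi> \<in> polytope_B B" by blast
  have add: "additive_on (Pic_UB B) \<phi>" using \<phi> by (simp add: polytope_B_def dual_effective_cone_def real_dual_def additive_on_def)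
  have ex: "\<phi> x = pairing y x" if "x \<in> carrier (Pic_UB B)" for x
    unfolding functional_expansion[OF add that] y by (intro sum.cong) auto
  have "in_cone y"
  proof (rule in_cone_if_pairing_nonneg)
    fix E assume E: "effective_family E"
    then have "class_family B E \<in> effective_classes B" unfolding effective_classes_class_family by blast
    then have "0 \<le> \<phi> (class_family B E)" using \<phi> by (simp add: polytope_B_def dual_effective_cone_def)
    moreover have "class_family B E \<in> carrier (Pic_UB B)" unfolding carrier_Pic_UB[OF B] using effective_family_compatible[OF E] by blast
    ultimately show "0 \<le> pairing y (class_family B E)" using ex by simp
  qed
  moreover have "(\<Sum>j<m. y j) \<le> 1"
    using ex[OF log_anticanonical_carrier] \<phi> pairing_log_anticanonical[of y] by (simp add: polytope_B_def)
  ultimately show "y \<in> polytope_coords" unfolding polytope_coords_def using y by (simp add: restrict_PiE_iff del: PiE_iff)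
next
  fix y assume y: "y \<in> polytope_coords"
  define \<phi> where "\<phi> = pairing y"
  have "additive_on (Pic_UB B) \<phi>"
    unfolding additive_on_def
  proof (intro ballI)
    fix a b assume "a \<in> carrier (Pic_UB B)" "b \<in> carrier (Pic_UB B)"
    then have "dual_coord j (a \<otimes>\<^bsub>Pic_UB B\<^esub> b) = dual_coord j a + dual_coord j b" for j
      using dual_coord_additive unfolding additive_on_def by blast
    then show "\<phi> (a \<otimes>\<^bsub>Pic_UB B\<^esub> b) = \<phi> a + \<phi> b" by (simp add: \<phi>_def sum.distrib distrib_right)
  qed
  moreover have "0 \<le> \<phi> c" if "c \<in> effective_classes B" for c
    using that y pairing_nonneg unfolding effective_classes_class_family polytope_coords_def \<phi>_def by blast
  moreover have "\<phi> (log_anticanonical_class B) \<le> 1"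
    using y unfolding \<phi>_def pairing_log_anticanonical by (simp add: polytope_coords_def)
  ultimately have "\<phi> \<in> polytope_B B"
    by (simp add: polytope_B_def dual_effective_cone_def real_dual_def additive_on_def)
  moreover have "y = (\<lambda>i\<in>{..<2 * m + 1}. \<phi> (basis i))"
  proof
    fix i
    show "y i = (\<lambda>i\<in>{..<2 * m + 1}. \<phi> (basis i)) i"
    proof (cases "i < 2 * m + 1")
      case True
      have "\<phi> (basis i) = (\<Sum>j<2 * m + 1. if j = i then y i else 0)"
        unfolding \<phi>_def using dual_coord_basis[OF _ True] by (intro sum.cong) auto
      also have "\<dots> = y i" using True by (subst sum.delta) auto
      finally show ?thesis using True by simp
    next
      case False
      then show ?thesis using y by (auto simp: polytope_coords_def PiE_def extensional_def)
    qed
  qed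
  ultimately show "y \<in> (\<lambda>\<phi>. \<lambda>i\<in>{..<2 * m + 1}. \<phi> (basis i)) ` polytope_B B" by blast
qed

end

section \<open>Unimodular invariance of Lebesgue measure\<close>

abbreviation lborel_pow :: "nat \<Rightarrow> (nat \<Rightarrow> real) measure" where
  "lborel_pow n \<equiv> PiM {..<n} (\<lambda>_. lborel)"

definition translate :: "nat \<Rightarrow> (nat \<Rightarrow> real) \<Rightarrow> (nat \<Rightarrow> real) \<Rightarrow> nat \<Rightarrow> real" where
  "translate n a y = (\<lambda>i\<in>{..<n}. y i + a i)"

definition mat_apply :: "nat \<Rightarrow> (nat \<Rightarrow> nat \<Rightarrow> int) \<Rightarrow> (nat \<Rightarrow> real) \<Rightarrow> nat \<Rightarrow> real" where
  "mat_apply n M y = (\<lambda>i\<in>{..<n}. \<Sum>j<n. of_int (M i j) * y j)"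

lemma product_sigma_finite_lborel: "product_sigma_finite (\<lambda>_. lborel :: real measure)"
  by standard

lemma component_measurable: "i < n \<Longrightarrow> (\<lambda>y. y i) \<in> borel_measurable (lborel_pow n)"
  using measurable_component_singleton[of i "{..<n}" "\<lambda>_. lborel"] by (simp add: measurable_lborel1)

lemma measurable_lborel_pow:
  assumes "\<And>i. i < n \<Longrightarrow> (\<lambda>x. f x i) \<in> borel_measurable N"
  shows "(\<lambda>x. \<lambda>i\<in>{..<n}. f x i) \<in> measurable N (lborel_pow n)"
  using assms by (intro measurable_restrict) simp

lemma translate_measurable [measurable]: "translate n a \<in> measurable (lborel_pow n) (lborel_pow n)"
  unfolding translate_def[abs_def] by (intro measurable_lborel_pow borel_measurable_add component_measurable) auto

lemma mat_apply_measurable [measurable]: "mat_apply n M \<in> measurable (lborel_pow n) (lborel_pow n)"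
  unfolding mat_apply_def[abs_def]
  by (intro measurable_lborel_pow borel_measurable_sum borel_measurable_times component_measurable) auto

lemma space_lborel_pow: "space (lborel_pow n) = {..<n} \<rightarrow>\<^sub>E UNIV"
  by (simp add: space_PiM)

lemma emeasure_lborel_translate:
  assumes "A \<in> sets borel"
  shows "emeasure lborel ((\<lambda>x. x + c) -` A) = emeasure lborel (A :: real set)"
proof -
  have "emeasure (distr lborel borel ((+) c)) A = emeasure lborel A" by (simp add: lborel_distr_plus)
  moreover have "(+) c = (\<lambda>x. x + c)" by (simp add: fun_eq_iff add.commute)
  ultimately show ?thesis using assms by (simp add: emeasure_distr)
qed

lemma distr_translate: "distr (lborel_pow n) (lborel_pow n) (translate n a) = lborel_pow n"
proof -
  interpret product_sigma_finite "\<lambda>_. lborel :: real measure" by (rule product_sigma_finite_lborel)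
  show ?thesis
  proof (rule PiM_eqI)
    fix A :: "nat \<Rightarrow> real set" assume A: "\<And>i. i \<in> {..<n} \<Longrightarrow> A i \<in> sets lborel"
    have "translate n a -` PiE {..<n} A \<inter> space (lborel_pow n) = PiE {..<n} (\<lambda>i. (\<lambda>x. x + a i) -` A i)"
      by (auto simp: space_PiM translate_def PiE_def Pi_def extensional_def)
    moreover have B: "(\<lambda>x. x + a i) -` A i \<in> sets lborel" if "i < n" for i
      using A[of i] that measurable_sets_borel[of "\<lambda>x. x + a i" borel "A i"] by simp
    ultimately have "emeasure (distr (lborel_pow n) (lborel_pow n) (translate n a)) (PiE {..<n} A)
        = emeasure (lborel_pow n) (PiE {..<n} (\<lambda>i. (\<lambda>x. x + a i) -` A i))"
      using A by (subst emeasure_distr) (auto intro!: sets_PiM_I_finite)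
    also have "\<dots> = (\<Prod>i\<in>{..<n}. emeasure lborel ((\<lambda>x. x + a i) -` A i))"
      using B by (intro emeasure_PiM) auto
    also have "\<dots> = (\<Prod>i\<in>{..<n}. emeasure lborel (A i))"
      using A by (intro prod.cong refl emeasure_lborel_translate) simp
    finally show "emeasure (distr (lborel_pow n) (lborel_pow n) (translate n a)) (PiE {..<n} A) = (\<Prod>i\<in>{..<n}. emeasure lborel (A i))" .
  qed auto
qed

lemma nn_integral_translate:
  assumes "f \<in> borel_measurable (lborel_pow n)"
  shows "(\<integral>\<^sup>+ y. f (translate n a y) \<partial>lborel_pow n) = (\<integral>\<^sup>+ y. f y \<partial>lborel_pow n)"
proof -
  have "(\<integral>\<^sup>+ y. f y \<partial>lborel_pow n) = (\<integral>\<^sup>+ y. f y \<partial>distr (lborel_pow n) (lborel_pow n) (translate n a))"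
    by (simp only: distr_translate)
  also have "\<dots> = (\<integral>\<^sup>+ y. f (translate n a y) \<partial>lborel_pow n)"
    by (rule nn_integral_distr) (use assms in auto)
  finally show ?thesis by simp
qed

definition unit_cube :: "nat \<Rightarrow> (nat \<Rightarrow> real) set" where
  "unit_cube n = PiE {..<n} (\<lambda>_. {0..<1})"

lemma unit_cube_sets [measurable]: "unit_cube n \<in> sets (lborel_pow n)"
  unfolding unit_cube_def by (intro sets_PiM_I_finite) auto

lemma emeasure_unit_cube: "emeasure (lborel_pow n) (unit_cube n) = 1"
proof -
  interpret product_sigma_finite "\<lambda>_. lborel :: real measure" by (rule product_sigma_finite_lborel)
  show ?thesis unfolding unit_cube_def by (subst emeasure_PiM) auto
qed

lemma mat_apply_add: "mat_apply n M (translate n a y) = translate n (mat_apply n M a) (mat_apply n M y)"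
  by (auto simp: mat_apply_def translate_def algebra_simps sum.distrib)

lemma mat_apply_space: "mat_apply n M y \<in> space (lborel_pow n)" "translate n a y \<in> space (lborel_pow n)"
  by (simp_all add: space_lborel_pow mat_apply_def translate_def)

lemma mat_apply_inverse:
  assumes "\<And>i k. i < n \<Longrightarrow> k < n \<Longrightarrow> (\<Sum>j<n. M i j * M' j k) = (if i = k then 1 else 0)"
    and y: "y \<in> space (lborel_pow n)"
  shows "mat_apply n M (mat_apply n M' y) = y"
proof
  fix i
  show "mat_apply n M (mat_apply n M' y) i = y i"
  proof (cases "i < n")
    case True
    then show ?thesis using integer_matrix_inverse_apply[OF assms(1) True, where x = y] by (simp add: mat_apply_def)
  next
    case False
    then show ?thesis using y by (auto simp: mat_apply_def space_lborel_pow PiE_def extensional_def)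
  qed
qed

text \<open>
  Both measures equal \<open>\<Sum>\<^sub>k \<mu>(F \<inter> (F' - k))\<close>, since the translates of either set by \<open>\<int>\<^sup>n\<close> tile the
  space. The opposite signs of the translations in the two hypotheses save a reindexing of the
  sum.
\<close>
lemma fundamental_domains_same_measure:
  assumes F: "F \<in> sets (lborel_pow n)" and F': "F' \<in> sets (lborel_pow n)"
    and 1: "\<And>y. y \<in> space (lborel_pow n) \<Longrightarrow> \<exists>!k. k \<in> {..<n} \<rightarrow>\<^sub>E (UNIV :: int set) \<and> translate n (\<lambda>i. of_int (- k i)) y \<in> F"
    and 2: "\<And>y. y \<in> space (lborel_pow n) \<Longrightarrow> \<exists>!k. k \<in> {..<n} \<rightarrow>\<^sub>E (UNIV :: int set) \<and> translate n (\<lambda>i. of_int (k i)) y \<in> F'"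
  shows "emeasure (lborel_pow n) F = emeasure (lborel_pow n) F'"
proof -
  let ?L = "{..<n} \<rightarrow>\<^sub>E (UNIV :: int set)"
  let ?M = "lborel_pow n"
  have L: "countable ?L" by (intro countable_PiE) auto
  have one: "(\<integral>\<^sup>+ k. indicator A (g k) \<partial>count_space ?L) = (1 :: ennreal)" if ex1: "\<exists>!k. k \<in> ?L \<and> g k \<in> A" for A and g :: "_ \<Rightarrow> nat \<Rightarrow> real"
  proof -
    obtain k where k: "k \<in> ?L \<and> g k \<in> A" "\<forall>k'. k' \<in> ?L \<and> g k' \<in> A \<longrightarrow> k' = k" using ex1 by (rule ex1E)
    have "(\<integral>\<^sup>+ k. indicator A (g k) \<partial>count_space ?L) = (\<integral>\<^sup>+ k'. indicator {k} k' \<partial>count_space ?L)"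
    proof (intro nn_integral_cong)
      fix k' assume "k' \<in> space (count_space ?L)"
      then have k': "k' \<in> ?L" by (simp only: space_count_space)
      have "g k' \<in> A \<longleftrightarrow> k' = k"
      proof
        show "k' = k" if "g k' \<in> A" using that k' spec[OF k(2), of k'] by (elim mp) (rule conjI)
        show "g k' \<in> A" if "k' = k" using k(1) that by simp
      qed
      then show "indicator A (g k') = (indicator {k} k' :: ennreal)" by (simp add: indicator_def)
    qed
    also have "\<dots> = 1" using k(1) by simp
    finally show ?thesis .
  qed
  have tr: "translate n (\<lambda>i. of_int (k i)) (translate n (\<lambda>i. of_int (- k i)) y) = y" if "y \<in> space ?M" for k :: "nat \<Rightarrow> int" and y
    using that by (auto simp: translate_def space_lborel_pow PiE_def extensional_def)
  note [measurable] = F F'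
  have "emeasure ?M F = (\<integral>\<^sup>+ y. indicator F y * 1 \<partial>?M)" using F by simp
  also have "\<dots> = (\<integral>\<^sup>+ y. indicator F y * (\<integral>\<^sup>+ k. indicator F' (translate n (\<lambda>i. of_int (k i)) y) \<partial>count_space ?L) \<partial>?M)"
    using one[OF 2] by (intro nn_integral_cong) simp
  also have "\<dots> = (\<integral>\<^sup>+ y. (\<integral>\<^sup>+ k. indicator F y * indicator F' (translate n (\<lambda>i. of_int (k i)) y) \<partial>count_space ?L) \<partial>?M)"
    by (simp add: nn_integral_cmult)
  also have "\<dots> = (\<integral>\<^sup>+ k. (\<integral>\<^sup>+ y. indicator F y * indicator F' (translate n (\<lambda>i. of_int (k i)) y) \<partial>?M) \<partial>count_space ?L)"
    by (rule nn_integral_count_space_nn_integral[OF L]) measurable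
  also have "\<dots> = (\<integral>\<^sup>+ k. (\<integral>\<^sup>+ y. indicator F (translate n (\<lambda>i. of_int (- k i)) y) * indicator F' y \<partial>?M) \<partial>count_space ?L)"
  proof (rule nn_integral_cong)
    fix k :: "nat \<Rightarrow> int"
    let ?f = "\<lambda>y. indicator F y * indicator F' (translate n (\<lambda>i. of_int (k i)) y) :: ennreal"
    have "(\<integral>\<^sup>+ y. ?f y \<partial>?M) = (\<integral>\<^sup>+ y. ?f (translate n (\<lambda>i. of_int (- k i)) y) \<partial>?M)"
      by (rule nn_integral_translate[symmetric]) measurable
    also have "\<dots> = (\<integral>\<^sup>+ y. indicator F (translate n (\<lambda>i. of_int (- k i)) y) * indicator F' y \<partial>?M)"
      by (intro nn_integral_cong) (simp only: tr)
    finally show "(\<integral>\<^sup>+ y. ?f y \<partial>?M) = (\<integral>\<^sup>+ y. indicator F (translate n (\<lambda>i. of_int (- k i)) y) * indicator F' y \<partial>?M)" .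
  qed
  also have "\<dots> = (\<integral>\<^sup>+ y. (\<integral>\<^sup>+ k. indicator F (translate n (\<lambda>i. of_int (- k i)) y) * indicator F' y \<partial>count_space ?L) \<partial>?M)"
    by (rule nn_integral_count_space_nn_integral[OF L, symmetric]) measurable
  also have "\<dots> = (\<integral>\<^sup>+ y. (\<integral>\<^sup>+ k. indicator F (translate n (\<lambda>i. of_int (- k i)) y) \<partial>count_space ?L) * indicator F' y \<partial>?M)"
    by (simp add: nn_integral_multc)
  also have "\<dots> = (\<integral>\<^sup>+ y. 1 * indicator F' y \<partial>?M)"
    by (intro nn_integral_cong arg_cong2[of _ _ _ _ "(*)"] one[OF 1] refl)
  also have "\<dots> = emeasure ?M F'" using F' by simp
  finally show ?thesis .
qed

lemma sigma_finite_lborel_pow: "sigma_finite_measure (lborel_pow n)"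
  by (rule product_sigma_finite.sigma_finite[OF product_sigma_finite_lborel]) simp

lemma Fubini_lborel_pow:
  assumes [measurable]: "case_prod f \<in> borel_measurable (lborel_pow n \<Otimes>\<^sub>M lborel_pow n)"
  shows "(\<integral>\<^sup>+ y. \<integral>\<^sup>+ z. f y z \<partial>lborel_pow n \<partial>lborel_pow n) = (\<integral>\<^sup>+ z. \<integral>\<^sup>+ y. f y z \<partial>lborel_pow n \<partial>lborel_pow n)"
proof -
  interpret pair_sigma_finite "lborel_pow n" "lborel_pow n"
    by (intro pair_sigma_finite.intro sigma_finite_lborel_pow)
  show ?thesis using Fubini'[OF assms] by simp
qed

lemma translate_prod_measurable:
  assumes [measurable]: "g \<in> measurable N (lborel_pow n)" "h \<in> measurable N (lborel_pow n)"
  shows "(\<lambda>x. translate n (g x) (h x)) \<in> measurable N (lborel_pow n)"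
  unfolding translate_def
  by (intro measurable_lborel_pow borel_measurable_add
      measurable_compose[OF assms(1) component_measurable] measurable_compose[OF assms(2) component_measurable])

text \<open>Negation on vectors that are undefined outside \<open>{..<n}\<close>.\<close>
definition neg_vec :: "nat \<Rightarrow> (nat \<Rightarrow> real) \<Rightarrow> nat \<Rightarrow> real" where
  "neg_vec n y = (\<lambda>i\<in>{..<n}. - y i)"

lemma neg_vec_measurable [measurable]: "neg_vec n \<in> measurable (lborel_pow n) (lborel_pow n)"
  unfolding neg_vec_def[abs_def] by (intro measurable_lborel_pow borel_measurable_uminus component_measurable)

lemma mat_apply_image_eq_vimage:
  assumes inv: "\<And>i k. i < n \<Longrightarrow> k < n \<Longrightarrow> (\<Sum>j<n. M i j * M' j k) = (if i = k then 1 else 0)"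
    and inv': "\<And>i k. i < n \<Longrightarrow> k < n \<Longrightarrow> (\<Sum>j<n. M' i j * M j k) = (if i = k then 1 else 0)"
    and S: "S \<subseteq> space (lborel_pow n)"
  shows "mat_apply n M ` S = mat_apply n M' -` S \<inter> space (lborel_pow n)"
proof (intro Set.set_eqI iffI)
  fix y assume "y \<in> mat_apply n M ` S"
  then obtain x where x: "x \<in> S" "y = mat_apply n M x" by blast
  then have "mat_apply n M' y = x" using mat_apply_inverse[OF inv'] S by blast
  then show "y \<in> mat_apply n M' -` S \<inter> space (lborel_pow n)" using x mat_apply_space by simp
next
  fix y assume y: "y \<in> mat_apply n M' -` S \<inter> space (lborel_pow n)"
  then have "y = mat_apply n M (mat_apply n M' y)" using mat_apply_inverse[OF inv] by simp
  then show "y \<in> mat_apply n M ` S" using y by blast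
qed

text \<open>
  The uniqueness argument for Haar measure: Tonelli's theorem is applied twice to \<open>\<integral>\<integral> 1\<^sub>Q(y) 1\<^sub>S(M'z
  + y)\<close>, where \<open>Q\<close> is the unit cube. Translation of \<open>z\<close> gives the measure of the preimage of \<open>S\<close>, and
  translation of \<open>y\<close> makes \<open>S\<close> separate from a constant.
\<close>
lemma vimage_mat_apply_scaling:
  fixes M M' :: "nat \<Rightarrow> nat \<Rightarrow> int"
  assumes inv': "\<And>i k. i < n \<Longrightarrow> k < n \<Longrightarrow> (\<Sum>j<n. M' i j * M j k) = (if i = k then 1 else 0)"
  obtains c where "\<And>S. S \<in> sets (lborel_pow n) \<Longrightarrow>
     emeasure (lborel_pow n) (mat_apply n M' -` S \<inter> space (lborel_pow n)) = c * emeasure (lborel_pow n) S"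
proof
  let ?M = "lborel_pow n" and ?T = "mat_apply n M" and ?T' = "mat_apply n M'"
  \<comment> \<open>the measure of the set of \<open>z\<close> with \<open>- M'z\<close> in the unit cube\<close>
  define c where "c = (\<integral>\<^sup>+ z. indicator (unit_cube n) (neg_vec n (?T' z)) \<partial>?M)"
  fix S assume S [measurable]: "S \<in> sets (lborel_pow n)"
  have T'T: "?T' (?T y) = y" if "y \<in> space ?M" for y
    using mat_apply_inverse[OF inv' that] .
  have "emeasure ?M (?T' -` S \<inter> space ?M) = (\<integral>\<^sup>+ z. indicator S (?T' z) \<partial>?M)"
  proof -
    have "emeasure ?M (?T' -` S \<inter> space ?M) = (\<integral>\<^sup>+ z. indicator (?T' -` S \<inter> space ?M) z \<partial>?M)"
      by (rule nn_integral_indicator[symmetric]) measurable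
    also have "\<dots> = (\<integral>\<^sup>+ z. indicator S (?T' z) \<partial>?M)"
      by (rule nn_integral_cong) (simp add: indicator_def)
    finally show ?thesis .
  qed
  also have "\<dots> = (\<integral>\<^sup>+ y. indicator (unit_cube n) y * (\<integral>\<^sup>+ z. indicator S (?T' z) \<partial>?M) \<partial>?M)"
    by (subst nn_integral_multc) (simp_all add: emeasure_unit_cube)
  also have "\<dots> = (\<integral>\<^sup>+ y. \<integral>\<^sup>+ z. indicator (unit_cube n) y * indicator S (translate n y (?T' z)) \<partial>?M \<partial>?M)"
  proof (rule nn_integral_cong)
    fix y assume y: "y \<in> space ?M"
    have "(\<integral>\<^sup>+ z. indicator S (?T' z) \<partial>?M) = (\<integral>\<^sup>+ z. indicator S (?T' (translate n (?T y) z)) \<partial>?M)"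
      by (rule nn_integral_translate[symmetric]) measurable
    also have "\<dots> = (\<integral>\<^sup>+ z. indicator S (translate n y (?T' z)) \<partial>?M)"
      by (simp only: mat_apply_add T'T[OF y])
    finally show "indicator (unit_cube n) y * (\<integral>\<^sup>+ z. indicator S (?T' z) \<partial>?M)
      = (\<integral>\<^sup>+ z. indicator (unit_cube n) y * indicator S (translate n y (?T' z)) \<partial>?M)"
      by (simp add: nn_integral_cmult)
  qed
  also have "\<dots> = (\<integral>\<^sup>+ z. \<integral>\<^sup>+ y. indicator (unit_cube n) y * indicator S (translate n y (?T' z)) \<partial>?M \<partial>?M)"
  proof (rule Fubini_lborel_pow)
    have [measurable]: "(\<lambda>p. translate n (fst p) (?T' (snd p))) \<in> measurable (?M \<Otimes>\<^sub>M ?M) ?M"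
      by (intro translate_prod_measurable) measurable
    show "(\<lambda>(y, z). indicator (unit_cube n) y * indicator S (translate n y (?T' z)) :: ennreal) \<in> borel_measurable (?M \<Otimes>\<^sub>M ?M)"
      unfolding split_beta by measurable
  qed
  also have "\<dots> = (\<integral>\<^sup>+ z. \<integral>\<^sup>+ y. indicator (unit_cube n) (translate n y (neg_vec n (?T' z))) * indicator S y \<partial>?M \<partial>?M)"
  proof (rule nn_integral_cong)
    fix z
    let ?f = "\<lambda>y. indicator (unit_cube n) y * indicator S (translate n y (?T' z)) :: ennreal"
    have "(\<lambda>y. translate n y (?T' z)) \<in> measurable ?M ?M"
      using mat_apply_space(1) by (intro translate_prod_measurable) (auto intro!: measurable_const)
    note [measurable] = this
    have "(\<integral>\<^sup>+ y. ?f y \<partial>?M) = (\<integral>\<^sup>+ y. ?f (translate n (neg_vec n (?T' z)) y) \<partial>?M)"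
      by (rule nn_integral_translate[symmetric]) measurable
    also have "\<dots> = (\<integral>\<^sup>+ y. indicator (unit_cube n) (translate n y (neg_vec n (?T' z))) * indicator S y \<partial>?M)"
    proof (rule nn_integral_cong)
      fix y assume y: "y \<in> space ?M"
      have "translate n (translate n (neg_vec n (?T' z)) y) (?T' z) = y"
        using y by (auto simp: translate_def neg_vec_def space_lborel_pow PiE_def extensional_def)
      moreover have "translate n (neg_vec n (?T' z)) y = translate n y (neg_vec n (?T' z))"
        by (auto simp: translate_def)
      ultimately show "?f (translate n (neg_vec n (?T' z)) y) = indicator (unit_cube n) (translate n y (neg_vec n (?T' z))) * indicator S y"
        by simp
    qed
    finally show "(\<integral>\<^sup>+ y. ?f y \<partial>?M) = (\<integral>\<^sup>+ y. indicator (unit_cube n) (translate n y (neg_vec n (?T' z))) * indicator S y \<partial>?M)" .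
  qed
  also have "\<dots> = (\<integral>\<^sup>+ y. \<integral>\<^sup>+ z. indicator (unit_cube n) (translate n y (neg_vec n (?T' z))) * indicator S y \<partial>?M \<partial>?M)"
  proof (rule Fubini_lborel_pow)
    have [measurable]: "(\<lambda>p. translate n (snd p) (neg_vec n (?T' (fst p)))) \<in> measurable (?M \<Otimes>\<^sub>M ?M) ?M"
      by (intro translate_prod_measurable) measurable
    show "(\<lambda>(z, y). indicator (unit_cube n) (translate n y (neg_vec n (?T' z))) * indicator S y :: ennreal) \<in> borel_measurable (?M \<Otimes>\<^sub>M ?M)"
      unfolding split_beta by measurable
  qed
  also have "\<dots> = (\<integral>\<^sup>+ y. c * indicator S y \<partial>?M)"
  proof (rule nn_integral_cong)
    fix y assume y: "y \<in> space ?M"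
    have [measurable]: "(\<lambda>z. translate n y (neg_vec n (?T' z))) \<in> measurable ?M ?M"
      using y by (intro translate_prod_measurable) (auto intro!: measurable_const)
    have "c = (\<integral>\<^sup>+ z. indicator (unit_cube n) (neg_vec n (?T' (translate n (?T (neg_vec n y)) z))) \<partial>?M)"
      unfolding c_def by (rule nn_integral_translate[symmetric]) measurable
    also have "\<dots> = (\<integral>\<^sup>+ z. indicator (unit_cube n) (translate n y (neg_vec n (?T' z))) \<partial>?M)"
    proof (rule nn_integral_cong)
      fix z
      have "?T' (?T (neg_vec n y)) = neg_vec n y" by (rule T'T) (simp add: neg_vec_def space_lborel_pow)
      then have "neg_vec n (?T' (translate n (?T (neg_vec n y)) z)) = translate n y (neg_vec n (?T' z))"
        unfolding mat_apply_add by (simp only:) (auto simp: neg_vec_def translate_def)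
      then show "indicator (unit_cube n) (neg_vec n (?T' (translate n (?T (neg_vec n y)) z))) =
        (indicator (unit_cube n) (translate n y (neg_vec n (?T' z))) :: ennreal)" by simp
    qed
    finally show "(\<integral>\<^sup>+ z. indicator (unit_cube n) (translate n y (neg_vec n (?T' z))) * indicator S y \<partial>?M) = c * indicator S y"
      by (subst nn_integral_multc) simp_all
  qed
  also have "\<dots> = c * emeasure ?M S" by (simp add: nn_integral_cmult)
  finally show "emeasure ?M (?T' -` S \<inter> space ?M) = c * emeasure ?M S" .
qed

text \<open>The translation vector consists of the integral parts of the coordinates.\<close>
lemma unit_cube_tiles:
  assumes "y \<in> space (lborel_pow n)"
  shows "\<exists>!k. k \<in> {..<n} \<rightarrow>\<^sub>E (UNIV :: int set) \<and> translate n (\<lambda>i. of_int (- k i)) y \<in> unit_cube n"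
proof -
  have iff: "translate n (\<lambda>i. of_int (- k i)) y \<in> unit_cube n \<longleftrightarrow> (\<forall>i<n. y i - of_int (k i) \<in> {0..<1})" for k :: "nat \<Rightarrow> int"
    by (auto simp: unit_cube_def translate_def PiE_def Pi_def)
  show ?thesis
    unfolding iff
  proof (rule ex1I)
    show "(\<lambda>i\<in>{..<n}. \<lfloor>y i\<rfloor>) \<in> {..<n} \<rightarrow>\<^sub>E UNIV \<and> (\<forall>i<n. y i - of_int ((\<lambda>i\<in>{..<n}. \<lfloor>y i\<rfloor>) i) \<in> {0..<1})"
      by (auto simp: restrict_PiE_iff frac_def[symmetric] frac_lt_1 simp del: PiE_iff)
    fix k assume k: "k \<in> {..<n} \<rightarrow>\<^sub>E UNIV \<and> (\<forall>i<n. y i - of_int (k i) \<in> {0..<1})"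
    show "k = (\<lambda>i\<in>{..<n}. \<lfloor>y i\<rfloor>)"
    proof
      fix i
      show "k i = (\<lambda>i\<in>{..<n}. \<lfloor>y i\<rfloor>) i"
      proof (cases "i < n")
        case True
        then have "y i - of_int (k i) \<in> {0..<1}" using k by blast
        then have "\<lfloor>y i\<rfloor> = k i" by (intro floor_unique) auto
        then show ?thesis using True by simp
      next
        case False
        then show ?thesis using k by (auto simp: PiE_def extensional_def)
      qed
    qed
  qed
qed

text \<open>
  The scaling factor is the measure of the preimage of the unit cube, which is again a
  fundamental domain of \<open>\<int>\<^sup>n\<close> because the matrix maps this lattice onto itself. So the factor is 1,
  without recourse to determinants.
\<close>
lemma emeasure_mat_apply:
  fixes M M' :: "nat \<Rightarrow> nat \<Rightarrow> int"
  assumes inv: "\<And>i k. i < n \<Longrightarrow> k < n \<Longrightarrow> (\<Sum>j<n. M i j * M' j k) = (if i = k then 1 else 0)"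
    and inv': "\<And>i k. i < n \<Longrightarrow> k < n \<Longrightarrow> (\<Sum>j<n. M' i j * M j k) = (if i = k then 1 else 0)"
    and S: "S \<in> sets (lborel_pow n)"
  shows "emeasure (lborel_pow n) (mat_apply n M ` S) = emeasure (lborel_pow n) S"
proof -
  let ?M = "lborel_pow n" and ?T = "mat_apply n M" and ?T' = "mat_apply n M'"
  have img: "?T ` S = ?T' -` S \<inter> space ?M" if "S \<in> sets ?M" for S
    using mat_apply_image_eq_vimage[OF inv inv'] sets.sets_into_space[OF that] by blast
  obtain c where c: "\<And>S. S \<in> sets ?M \<Longrightarrow> emeasure ?M (?T' -` S \<inter> space ?M) = c * emeasure ?M S"
    using vimage_mat_apply_scaling[OF inv'] by blast
  let ?F' = "?T' -` unit_cube n \<inter> space ?M"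
  have "emeasure ?M (unit_cube n) = emeasure ?M ?F'"
  proof (rule fundamental_domains_same_measure)
    show "?F' \<in> sets ?M" by measurable
    fix y assume y: "y \<in> space ?M"
    let ?L = "{..<n} \<rightarrow>\<^sub>E (UNIV :: int set)"
    \<comment> \<open>the two mutually inverse maps on the lattice\<close>
    define P where "P k = (\<lambda>i\<in>{..<n}. \<Sum>j<n. M' i j * k j)" for k
    define Q where "Q k = (\<lambda>i\<in>{..<n}. \<Sum>j<n. M i j * k j)" for k
    have P: "?T' (\<lambda>i. of_int (k i)) = (\<lambda>i\<in>{..<n}. of_int (P k i))" for k
      by (auto simp: P_def mat_apply_def)
    have iff: "translate n (\<lambda>i. of_int (k i)) y \<in> ?F' \<longleftrightarrow> translate n (\<lambda>i. of_int (- (- P k i))) (?T' y) \<in> unit_cube n" for k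
    proof -
      have "?T' (translate n (\<lambda>i. of_int (k i)) y) = translate n (\<lambda>i. of_int (- (- P k i))) (?T' y)"
        unfolding mat_apply_add P by (auto simp: translate_def)
      then show ?thesis using mat_apply_space(2) by simp
    qed
    obtain l where l: "l \<in> ?L \<and> translate n (\<lambda>i. of_int (- l i)) (?T' y) \<in> unit_cube n"
      "\<forall>l'. l' \<in> ?L \<and> translate n (\<lambda>i. of_int (- l' i)) (?T' y) \<in> unit_cube n \<longrightarrow> l' = l"
      using unit_cube_tiles[OF mat_apply_space(1)] by (rule ex1E)
    define k0 where "k0 = Q (\<lambda>i. - l i)"
    have Pk0: "P k0 i = - l i" if "i < n" for i
      using integer_matrix_inverse_apply[OF inv' that, where x = "\<lambda>i. - l i"] that by (simp add: P_def k0_def Q_def)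
    show "\<exists>!k. k \<in> ?L \<and> translate n (\<lambda>i. of_int (k i)) y \<in> ?F'"
      unfolding iff
    proof (rule ex1I)
      have "translate n (\<lambda>i. of_int (- (- P k0 i))) (?T' y) = translate n (\<lambda>i. of_int (- l i)) (?T' y)"
        by (auto simp: translate_def Pk0)
      then show "k0 \<in> ?L \<and> translate n (\<lambda>i. of_int (- (- P k0 i))) (?T' y) \<in> unit_cube n"
        using l(1) by (simp add: k0_def Q_def restrict_PiE_iff del: PiE_iff)
      fix k assume k: "k \<in> ?L \<and> translate n (\<lambda>i. of_int (- (- P k i))) (?T' y) \<in> unit_cube n"
      define l' where "l' = (\<lambda>i\<in>{..<n}. - P k i)"
      have "translate n (\<lambda>i. of_int (- l' i)) (?T' y) = translate n (\<lambda>i. of_int (- (- P k i))) (?T' y)"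
        by (auto simp: translate_def l'_def)
      moreover have "l' \<in> ?L" unfolding l'_def by (rule restrict_PiE_iff[THEN iffD2]) simp
      ultimately have "l' = l" using l(2) k by metis
      then have Pk: "P k i = - l i" if "i < n" for i using that by (auto simp: l'_def)
      show "k = k0"
      proof
        fix i
        show "k i = k0 i"
        proof (cases "i < n")
          case True
          have "k i = (\<Sum>j<n. M i j * (\<Sum>ka<n. M' j ka * k ka))"
            using integer_matrix_inverse_apply[OF inv True, where x = k] by simp
          also have "\<dots> = (\<Sum>j<n. M i j * P k j)" by (simp add: P_def)
          also have "\<dots> = k0 i" using True by (simp add: k0_def Q_def Pk)
          finally show ?thesis .
        next
          case False
          then show ?thesis using k by (auto simp: k0_def Q_def PiE_def extensional_def)
        qed
      qed
    qed
  qed (use unit_cube_tiles in auto)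
  then have "c = 1" using c[of "unit_cube n"] by (simp add: emeasure_unit_cube)
  then show ?thesis using c[OF S] img[OF S] by simp
qed

text \<open>Another basis transforms the image of \<open>P\<close> by an integral matrix with integral inverse.\<close>
lemma dual_volume_eq:
  assumes G: "comm_group G" and b: "is_Z_basis G n b" and P: "P \<subseteq> real_dual G"
    and S: "(\<lambda>\<phi>. \<lambda>i\<in>{..<n}. \<phi> (b i)) ` P \<in> sets (lborel_pow n)"
  shows "dual_volume G P = measure (lborel_pow n) ((\<lambda>\<phi>. \<lambda>i\<in>{..<n}. \<phi> (b i)) ` P)"
proof -
  obtain n' b' where nb: "(SOME (n, b). is_Z_basis G n b) = (n', b')" by fastforce
  have "case (n', b') of (n, b) \<Rightarrow> is_Z_basis G n b"
    unfolding nb[symmetric] by (rule someI[of _ "(n, b)"]) (simp add: b)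
  then have b': "is_Z_basis G n' b'" by simp
  obtain M M' :: "nat \<Rightarrow> nat \<Rightarrow> int" where
    M: "\<And>\<phi> i. additive_on G \<phi> \<Longrightarrow> i < n' \<Longrightarrow> (\<phi> (b' i) :: real) = (\<Sum>j<n. of_int (M i j) * \<phi> (b j))"
    and "\<And>\<phi> i. additive_on G \<phi> \<Longrightarrow> i < n \<Longrightarrow> (\<phi> (b i) :: real) = (\<Sum>j<n'. of_int (M' i j) * \<phi> (b' j))"
    and inv': "\<And>i k. i < n \<Longrightarrow> k < n \<Longrightarrow> (\<Sum>j<n'. M' i j * M j k) = (if i = k then 1 else 0)"
    and inv: "\<And>i k. i < n' \<Longrightarrow> k < n' \<Longrightarrow> (\<Sum>j<n. M i j * M' j k) = (if i = k then 1 else 0)"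
    by (rule Z_basis_change[OF G b b']) (rule that)
  have "n \<le> n'" by (rule integer_inverse_dims) (rule inv')
  moreover have "n' \<le> n" by (rule integer_inverse_dims) (rule inv)
  ultimately have [simp]: "n' = n" by simp
  have "(\<lambda>\<phi>. \<lambda>i\<in>{..<n}. \<phi> (b' i)) ` P = mat_apply n M ` ((\<lambda>\<phi>. \<lambda>i\<in>{..<n}. \<phi> (b i)) ` P)"
    unfolding image_image
  proof (intro image_cong refl)
    fix \<phi> assume "\<phi> \<in> P"
    then have "additive_on G \<phi>" using P by (auto simp: real_dual_def additive_on_def)
    then show "(\<lambda>i\<in>{..<n}. \<phi> (b' i)) = mat_apply n M (\<lambda>i\<in>{..<n}. \<phi> (b i))"
      using M by (auto simp: mat_apply_def)
  qed
  moreover have "emeasure (lborel_pow n) (mat_apply n M ` ((\<lambda>\<phi>. \<lambda>i\<in>{..<n}. \<phi> (b i)) ` P)) = emeasure (lborel_pow n) ((\<lambda>\<phi>. \<lambda>i\<in>{..<n}. \<phi> (b i)) ` P)"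
    by (rule emeasure_mat_apply[where M' = M', OF _ _ S]) (use inv inv' in auto)
  ultimately show ?thesis unfolding dual_volume_def nb by (simp add: measure_def)
qed

section \<open>Volumes\<close>

text \<open>The inner integral is \<open>(1 - t\<^sub>1)\<^sup>q\<^sup>+\<^sup>1/(q + 1)\<close>.\<close>
lemma triangle_integral:
  "(LINT t:{t :: real \<times> real. 0 \<le> fst t \<and> 0 \<le> snd t \<and> fst t + snd t \<le> 1}|lborel. (1 - fst t - snd t) ^ q)
    = 1 / (real (q + 1) * real (q + 2))"
proof -
  let ?D = "{t :: real \<times> real. 0 \<le> fst t \<and> 0 \<le> snd t \<and> fst t + snd t \<le> 1}"
  let ?f = "\<lambda>t :: real \<times> real. indicator ?D t * (1 - fst t - snd t) ^ q"
  have D: "closed ?D"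
    by (intro closed_Collect_conj closed_Collect_le continuous_intros)
  then have Dm: "?D \<in> sets borel" by (rule borel_closed)
  have m0: "?f \<in> borel_measurable (borel :: (real \<times> real) measure)"
    using Dm by (intro borel_measurable_times borel_measurable_indicator borel_measurable_power borel_measurable_diff
      borel_measurable_const borel_measurable_continuous_onI continuous_on_fst continuous_on_snd continuous_on_id)
  have nn: "0 \<le> ?f t" for t by (auto simp: indicator_def)
  have "(\<integral>\<^sup>+ t. ennreal (?f t) \<partial>lborel) = (\<integral>\<^sup>+ t. ennreal (?f t) \<partial>(lborel \<Otimes>\<^sub>M lborel))"
    by (simp only: lborel_prod)
  also have "\<dots> = (\<integral>\<^sup>+ x. \<integral>\<^sup>+ y. ennreal (?f (x, y)) \<partial>lborel \<partial>lborel)"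
    by (rule lborel.nn_integral_fst[symmetric]) (use m0 in \<open>simp add: lborel_prod\<close>)
  also have "\<dots> = (\<integral>\<^sup>+ x. ennreal ((1 - x) ^ (q + 1) / real (q + 1)) * indicator {0..1} x \<partial>lborel)"
  proof (rule nn_integral_cong)
    fix x :: real
    show "(\<integral>\<^sup>+ y. ennreal (?f (x, y)) \<partial>lborel) = ennreal ((1 - x) ^ (q + 1) / real (q + 1)) * indicator {0..1} x"
    proof (cases "x \<in> {0..1}")
      case True
      have "(\<integral>\<^sup>+ y. ennreal (?f (x, y)) \<partial>lborel) = (\<integral>\<^sup>+ y. ennreal ((1 - x - y) ^ q) * indicator {0..1 - x} y \<partial>lborel)"
        using True by (intro nn_integral_cong) (auto simp: indicator_def)
      also have "\<dots> = ennreal (- ((1 - x - (1 - x)) ^ (q + 1) / real (q + 1)) - (- ((1 - x - 0) ^ (q + 1) / real (q + 1))))"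
      proof (rule nn_integral_FTC_Icc)
        fix y assume "y \<in> {0..1 - x}"
        have "((\<lambda>y. (1 - x - y) ^ (q + 1)) has_real_derivative - (real (q + 1) * (1 - x - y) ^ q)) (at y)"
          by (rule derivative_eq_intros refl | simp)+
        then have "((\<lambda>y. - ((1 - x - y) ^ (q + 1) / real (q + 1))) has_real_derivative - (- (real (q + 1) * (1 - x - y) ^ q) / real (q + 1))) (at y)"
          by (intro DERIV_minus DERIV_cdivide)
        then show "((\<lambda>y. - ((1 - x - y) ^ (q + 1) / real (q + 1))) has_real_derivative (1 - x - y) ^ q) (at y)"
          by (simp del: of_nat_add of_nat_Suc)
      qed (use True in auto)
      finally show ?thesis using True by simp
    next
      case False
      then have "(\<integral>\<^sup>+ y. ennreal (?f (x, y)) \<partial>lborel) = (\<integral>\<^sup>+ y. 0 \<partial>(lborel :: real measure))"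
        by (intro nn_integral_cong) (auto simp: indicator_def)
      then show ?thesis using False by simp
    qed
  qed
  also have "\<dots> = ennreal (- ((1 - 1) ^ (q + 2) / (real (q + 1) * real (q + 2))) - (- ((1 - 0) ^ (q + 2) / (real (q + 1) * real (q + 2)))))"
  proof (rule nn_integral_FTC_Icc)
    fix x :: real assume "x \<in> {0..1}"
    have "((\<lambda>x. (1 - x) ^ (q + 2)) has_real_derivative - (real (q + 2) * (1 - x) ^ (q + 1))) (at x)"
      by (rule derivative_eq_intros refl | simp)+
    then have "((\<lambda>x. - ((1 - x) ^ (q + 2) / (real (q + 1) * real (q + 2)))) has_real_derivative - (- (real (q + 2) * (1 - x) ^ (q + 1)) / (real (q + 1) * real (q + 2)))) (at x)"
      by (intro DERIV_minus DERIV_cdivide)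
    then show "((\<lambda>x. - ((1 - x) ^ (q + 2) / (real (q + 1) * real (q + 2)))) has_real_derivative (1 - x) ^ (q + 1) / real (q + 1)) (at x)"
      by (simp add: divide_simps)
  qed auto
  finally have *: "(\<integral>\<^sup>+ t. ennreal (?f t) \<partial>lborel) = ennreal (1 / (real (q + 1) * real (q + 2)))" by simp
  have "(LINT t:?D|lborel. (1 - fst t - snd t) ^ q) = (\<integral> t. ?f t \<partial>lborel)"
    by (simp add: set_lebesgue_integral_def)
  also have "\<dots> = enn2real (\<integral>\<^sup>+ t. ennreal (?f t) \<partial>lborel)"
    by (rule integral_eq_nn_integral) (use m0 nn in auto)
  also have "\<dots> = 1 / (real (q + 1) * real (q + 2))" unfolding * by simp
  finally show ?thesis .
qed

definition std_simplex :: "nat set \<Rightarrow> real \<Rightarrow> (nat \<Rightarrow> real) set" where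
  "std_simplex A t = {x. (\<forall>i\<in>A. 0 \<le> x i) \<and> sum x A \<le> t} \<inter> space (PiM A (\<lambda>_. lborel))"

lemma emeasure_simplex:
  "finite A \<Longrightarrow> t \<ge> 0 \<Longrightarrow> emeasure (PiM A (\<lambda>_. lborel)) (std_simplex A t) = ennreal (t ^ card A / fact (card A))"
  unfolding std_simplex_def by (rule emeasure_std_simplex_aux)

lemma simplex_sets:
  assumes "finite A"
  shows "std_simplex A t \<in> sets (PiM A (\<lambda>_. lborel))"
proof -
  have "std_simplex A t = Pi\<^sub>E A (\<lambda>_. {0..}) \<inter> (\<lambda>x. sum x A) -` {..t} \<inter> space (PiM A (\<lambda>_. lborel))"
    by (auto simp: std_simplex_def space_PiM)
  also have "\<dots> \<in> sets (PiM A (\<lambda>_. lborel))" using assms by measurable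
  finally show ?thesis .
qed

text \<open>
  Writing a power as an integral of its derivative turns a moment into an integral of measures of
  superlevel sets.
\<close>
lemma power_eq_nn_integral:
  assumes "0 \<le> L" "L \<le> 1"
  shows "ennreal (L ^ Suc k) = (\<integral>\<^sup>+ s. ennreal (real (Suc k) * s ^ k) * indicator {0..1} s * indicator {s. s < L} s \<partial>lborel)"
proof -
  have "(\<integral>\<^sup>+ s. ennreal (real (Suc k) * s ^ k) * indicator {0..1} s * indicator {s. s < L} s \<partial>lborel)
     = (\<integral>\<^sup>+ s. ennreal (real (Suc k) * s ^ k) * indicator {0..L} s \<partial>lborel)"
    by (rule nn_integral_cong_AE, rule AE_mp[OF AE_lborel_singleton[of L]], rule AE_I2)
      (use assms in \<open>auto simp: indicator_def\<close>)
  also have "\<dots> = ennreal (L ^ Suc k - 0 ^ Suc k)"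
  proof (rule nn_integral_FTC_Icc)
    fix x :: real
    show "((\<lambda>x. x ^ Suc k) has_real_derivative real (Suc k) * x ^ k) (at x)"
      by (rule derivative_eq_intros refl | simp)+
  qed (use assms in auto)
  finally show ?thesis by simp
qed

text \<open>
  The part of the simplex where the sum of the coordinates exceeds \<open>s\<close> has measure \<open>(1 - s\<^sup>m)/m!\<close>;
  this is integrated against the derivative of \<open>s\<^sup>m\<^sup>+\<^sup>1\<close>.
\<close>
lemma simplex_moment:
  assumes A: "finite A" and m: "card A = m" "m > 0"
  shows "(\<integral>\<^sup>+ x. indicator (std_simplex A 1) x * ennreal ((sum x A) ^ (m + 1)) \<partial>PiM A (\<lambda>_. lborel))
    = ennreal (real m / (real (2 * m + 1) * fact m))"
proof -
  let ?M = "PiM A (\<lambda>_. lborel :: real measure)"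
  have sf: "sigma_finite_measure ?M"
    by (rule product_sigma_finite.sigma_finite[OF product_sigma_finite_lborel A])
  interpret pair_sigma_finite ?M "lborel :: real measure"
    by (intro pair_sigma_finite.intro sf) (rule lborel.sigma_finite_measure_axioms)
  note [measurable] = simplex_sets[OF A]
  have summ [measurable]: "(\<lambda>x. sum x A) \<in> borel_measurable ?M"
    using A by measurable
  \<comment> \<open>the derivative of \<open>s\<^sup>m\<^sup>+\<^sup>1\<close> on the unit interval\<close>
  define w where "w s = ennreal (real (Suc m) * s ^ m) * indicator {0..1} s" for s :: real
  have w [measurable]: "w \<in> borel_measurable borel" unfolding w_def[abs_def] by measurable
  have "(\<integral>\<^sup>+ x. indicator (std_simplex A 1) x * ennreal ((sum x A) ^ (m + 1)) \<partial>?M)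
    = (\<integral>\<^sup>+ x. \<integral>\<^sup>+ s. indicator (std_simplex A 1) x * (w s * indicator {s. s < sum x A} s) \<partial>lborel \<partial>?M)"
  proof (rule nn_integral_cong)
    fix x assume "x \<in> space ?M"
    show "indicator (std_simplex A 1) x * ennreal ((sum x A) ^ (m + 1)) =
      (\<integral>\<^sup>+ s. indicator (std_simplex A 1) x * (w s * indicator {s. s < sum x A} s) \<partial>lborel)"
    proof (cases "x \<in> std_simplex A 1")
      case True
      then have "0 \<le> sum x A" "sum x A \<le> 1" by (auto simp: std_simplex_def intro: sum_nonneg)
      from power_eq_nn_integral[OF this, of m] show ?thesis using True by (simp add: w_def)
    qed simp
  qed
  also have "\<dots> = (\<integral>\<^sup>+ s. \<integral>\<^sup>+ x. indicator (std_simplex A 1) x * (w s * indicator {s. s < sum x A} s) \<partial>?M \<partial>lborel)"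
  proof (rule Fubini'[symmetric])
    have "(\<lambda>p. indicator (std_simplex A 1) (fst p) * (w (snd p) * (if snd p < sum (fst p) A then 1 else 0)) :: ennreal) \<in> borel_measurable (?M \<Otimes>\<^sub>M lborel)"
      by measurable
    moreover have "(\<lambda>(x, s). indicator (std_simplex A 1) x * (w s * indicator {s. s < sum x A} s) :: ennreal)
       = (\<lambda>p. indicator (std_simplex A 1) (fst p) * (w (snd p) * (if snd p < sum (fst p) A then 1 else 0)))"
      by (auto simp: fun_eq_iff indicator_def)
    ultimately show "(\<lambda>(x, s). indicator (std_simplex A 1) x * (w s * indicator {s. s < sum x A} s) :: ennreal) \<in> borel_measurable (?M \<Otimes>\<^sub>M lborel)"
      by simp
  qed
  also have "\<dots> = (\<integral>\<^sup>+ s. w s * ennreal ((1 - s ^ m) / fact m) \<partial>lborel)"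
  proof (rule nn_integral_cong)
    fix s :: real
    show "(\<integral>\<^sup>+ x. indicator (std_simplex A 1) x * (w s * indicator {s. s < sum x A} s) \<partial>?M) = w s * ennreal ((1 - s ^ m) / fact m)"
    proof (cases "s \<in> {0..1}")
      case True
      have "std_simplex A s \<subseteq> std_simplex A 1" using True by (auto simp: std_simplex_def)
      have "(\<integral>\<^sup>+ x. indicator (std_simplex A 1) x * (w s * indicator {s. s < sum x A} s) \<partial>?M)
        = (\<integral>\<^sup>+ x. w s * indicator (std_simplex A 1 - std_simplex A s) x \<partial>?M)"
        by (intro nn_integral_cong) (auto simp: indicator_def std_simplex_def)
      also have "\<dots> = w s * emeasure ?M (std_simplex A 1 - std_simplex A s)"
        by (rule nn_integral_cmult_indicator) measurable
      also have "emeasure ?M (std_simplex A 1 - std_simplex A s) = emeasure ?M (std_simplex A 1) - emeasure ?M (std_simplex A s)"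
        using True A \<open>std_simplex A s \<subseteq> std_simplex A 1\<close> by (intro emeasure_Diff) (auto simp: emeasure_simplex)
      also have "\<dots> = ennreal ((1 - s ^ m) / fact m)"
        using True A m by (simp add: emeasure_simplex ennreal_minus diff_divide_distrib)
      finally show ?thesis .
    qed (simp add: w_def)
  qed
  also have "\<dots> = (\<integral>\<^sup>+ s. ennreal (real (Suc m) * s ^ m * ((1 - s ^ m) / fact m)) * indicator {0..1} s \<partial>lborel)"
    by (intro nn_integral_cong) (auto simp: w_def indicator_def ennreal_mult'[symmetric] power_le_one)
  also have "\<dots> = ennreal ((1 ^ (m + 1) - real (m + 1) * 1 ^ (2 * m + 1) / real (2 * m + 1)) / fact m
      - (0 ^ (m + 1) - real (m + 1) * 0 ^ (2 * m + 1) / real (2 * m + 1)) / fact m)"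
  proof (rule nn_integral_FTC_Icc)
    fix s :: real assume s: "s \<in> {0..1}"
    have "((\<lambda>s. (s ^ (m + 1) - real (m + 1) * s ^ (2 * m + 1) / real (2 * m + 1)) / fact m) has_real_derivative
       (real (m + 1) * s ^ m - real (m + 1) * (real (2 * m + 1) * s ^ (2 * m)) / real (2 * m + 1)) / fact m) (at s)"
      by (intro DERIV_cdivide DERIV_diff DERIV_cmult) (rule derivative_eq_intros refl | simp)+
    moreover have "(real (m + 1) * s ^ m - real (m + 1) * (real (2 * m + 1) * s ^ (2 * m)) / real (2 * m + 1)) / fact m
      = real (Suc m) * s ^ m * ((1 - s ^ m) / fact m)"
    proof -
      have "real (m + 1) * (real (2 * m + 1) * s ^ (2 * m)) / real (2 * m + 1) = real (m + 1) * (s ^ m * s ^ m)"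
        by (simp add: mult_2 power_add del: of_nat_add of_nat_Suc of_nat_mult)
      then show ?thesis by (simp add: right_diff_distrib del: of_nat_Suc)
    qed
    ultimately show "((\<lambda>s. (s ^ (m + 1) - real (m + 1) * s ^ (2 * m + 1) / real (2 * m + 1)) / fact m) has_real_derivative
       real (Suc m) * s ^ m * ((1 - s ^ m) / fact m)) (at s)" by simp
    show "0 \<le> real (Suc m) * s ^ m * ((1 - s ^ m) / fact m)" using s by (simp add: power_le_one)
  qed auto
  also have "(1 ^ (m + 1) - real (m + 1) * 1 ^ (2 * m + 1) / real (2 * m + 1)) / fact m
      - (0 ^ (m + 1) - real (m + 1) * 0 ^ (2 * m + 1) / real (2 * m + 1)) / fact m = real m / (real (2 * m + 1) * fact m)"
    by (simp add: field_simps)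
  finally show ?thesis .
qed

text \<open>The union of the polytopes of all faces, with \<open>y\<close> listing \<open>\<lambda>\<^sub>0, \<dots>, \<lambda>\<^sub>m\<^sub>-\<^sub>1, \<mu>\<^sub>0, \<dots>, \<mu>\<^sub>m\<^sub>-\<^sub>1, x\<close>.\<close>
definition total_region :: "nat \<Rightarrow> (nat \<Rightarrow> real) set" where
  "total_region m = {y \<in> {..<2 * m + 1} \<rightarrow>\<^sub>E UNIV. (\<forall>j<2 * m + 1. 0 \<le> y j) \<and>
     y (2 * m) + (\<Sum>j<m. y (m + j)) \<le> (\<Sum>j<m. y j) \<and> (\<Sum>j<m. y j) \<le> 1}"

lemma component_sum_measurable:
  assumes "\<And>j. j \<in> J \<Longrightarrow> g j < n"
  shows "(\<lambda>y. \<Sum>j\<in>J. y (g j)) \<in> borel_measurable (lborel_pow n)"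
  using assms by (intro borel_measurable_sum component_measurable)

lemma total_region_sets: "total_region m \<in> sets (lborel_pow (2 * m + 1))"
proof -
  have s: "(\<lambda>y. \<Sum>j<m. y (m + j)) \<in> borel_measurable (lborel_pow (2 * m + 1))"
    "(\<lambda>y. \<Sum>j<m. y j) \<in> borel_measurable (lborel_pow (2 * m + 1))"
    by (intro component_sum_measurable; simp)+
  have c: "(\<lambda>y. y j) \<in> borel_measurable (lborel_pow (2 * m + 1))" if "j \<in> {..<2 * m + 1}" for j
    using that by (intro component_measurable) simp
  have "total_region m = {y \<in> space (lborel_pow (2 * m + 1)). (\<forall>j\<in>{..<2 * m + 1}. 0 \<le> y j) \<and>
     y (2 * m) + (\<Sum>j<m. y (m + j)) \<le> (\<Sum>j<m. y j) \<and> (\<Sum>j<m. y j) \<le> 1}"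
    by (auto simp: total_region_def space_lborel_pow)
  also have "\<dots> \<in> sets (lborel_pow (2 * m + 1))"
    by (intro sets.sets_Collect_conj sets.sets_Collect_finite_All borel_measurable_le borel_measurable_add
        borel_measurable_const s c) auto
  finally show ?thesis .
qed

text \<open>
  For fixed \<open>\<lambda>\<close> in the standard simplex, \<open>(\<mu>, x)\<close> ranges over a simplex of size \<open>L = \<Sum>\<lambda>\<close> in dimension \<open>m
  + 1\<close>, with volume \<open>L\<^sup>m\<^sup>+\<^sup>1/(m + 1)!\<close>.
\<close>
lemma emeasure_total_region:
  assumes "m > 0"
  shows "emeasure (lborel_pow (2 * m + 1)) (total_region m) = ennreal (1 / (real (2 * m + 1) * fact (m - 1) * fact (m + 1)))"
proof -
  interpret product_sigma_finite "\<lambda>_. lborel :: real measure" by (rule product_sigma_finite_lborel)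
  let ?I = "{..<m}" and ?J = "{m..<2 * m + 1}"
  let ?M = "\<lambda>A. PiM A (\<lambda>_. lborel :: real measure)"
  have IJ: "{..<2 * m + 1} = ?I \<union> ?J" by auto
  have cJ: "card ?J = m + 1" by simp
  have sumJ: "sum y ?J = y (2 * m) + (\<Sum>j<m. y (m + j))" for y :: "nat \<Rightarrow> real"
  proof -
    have "?J = insert (2 * m) {m..<2 * m}" by auto
    moreover have "sum y {m..<2 * m} = (\<Sum>j<m. y (m + j))"
      using sum.shift_bounds_nat_ivl[of y 0 m m] by (simp add: atLeast0LessThan add.commute mult_2)
    ultimately show ?thesis by simp
  qed
  have "emeasure (lborel_pow (2 * m + 1)) (total_region m) = (\<integral>\<^sup>+ y. indicator (total_region m) y \<partial>?M (?I \<union> ?J))"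
    using total_region_sets[of m] unfolding IJ by simp
  also have "\<dots> = (\<integral>\<^sup>+ x. \<integral>\<^sup>+ y. indicator (total_region m) (merge ?I ?J (x, y)) \<partial>?M ?J \<partial>?M ?I)"
    using total_region_sets[of m] unfolding IJ by (intro product_nn_integral_fold) auto
  also have "\<dots> = (\<integral>\<^sup>+ x. \<integral>\<^sup>+ y. indicator (std_simplex ?I 1) x * indicator (std_simplex ?J (sum x ?I)) y \<partial>?M ?J \<partial>?M ?I)"
  proof (intro nn_integral_cong)
    fix x y assume xy: "x \<in> space (?M ?I)" "y \<in> space (?M ?J)"
    have "merge ?I ?J (x, y) \<in> total_region m \<longleftrightarrow> x \<in> std_simplex ?I 1 \<and> y \<in> std_simplex ?J (sum x ?I)"
    proof -
      have "merge ?I ?J (x, y) \<in> {..<2 * m + 1} \<rightarrow>\<^sub>E UNIV"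
        unfolding IJ by (auto simp: merge_def PiE_def extensional_def)
      moreover have "(\<Sum>j<m. merge ?I ?J (x, y) j) = sum x ?I"
        by (intro sum.cong) (auto simp: merge_def)
      moreover have "merge ?I ?J (x, y) (2 * m) + (\<Sum>j<m. merge ?I ?J (x, y) (m + j)) = sum y ?J"
        unfolding sumJ[symmetric] by (intro sum.cong) (auto simp: merge_def)
      moreover have "(\<forall>j<2 * m + 1. 0 \<le> merge ?I ?J (x, y) j) \<longleftrightarrow> (\<forall>j\<in>?I. 0 \<le> x j) \<and> (\<forall>j\<in>?J. 0 \<le> y j)"
      proof -
        have "(\<forall>j<2 * m + 1. 0 \<le> merge ?I ?J (x, y) j) \<longleftrightarrow> (\<forall>j\<in>?I \<union> ?J. 0 \<le> merge ?I ?J (x, y) j)"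
          unfolding IJ[symmetric] by auto
        also have "\<dots> \<longleftrightarrow> (\<forall>j\<in>?I. 0 \<le> x j) \<and> (\<forall>j\<in>?J. 0 \<le> y j)"
          unfolding ball_Un by (intro arg_cong2[of _ _ _ _ "(\<and>)"] ball_cong) (auto simp: merge_def)
        finally show ?thesis .
      qed
      ultimately show ?thesis using xy unfolding total_region_def std_simplex_def by auto
    qed
    then show "indicator (total_region m) (merge ?I ?J (x, y)) = (indicator (std_simplex ?I 1) x * indicator (std_simplex ?J (sum x ?I)) y :: ennreal)"
      by (simp add: indicator_def)
  qed
  also have "\<dots> = (\<integral>\<^sup>+ x. (indicator (std_simplex ?I 1) x * ennreal ((sum x ?I) ^ (m + 1))) * ennreal (1 / fact (m + 1)) \<partial>?M ?I)"
  proof (rule nn_integral_cong)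
    fix x
    have J: "std_simplex ?J (sum x ?I) \<in> sets (?M ?J)" by (intro simplex_sets) simp
    have "(\<integral>\<^sup>+ y. indicator (std_simplex ?I 1) x * indicator (std_simplex ?J (sum x ?I)) y \<partial>?M ?J)
      = indicator (std_simplex ?I 1) x * emeasure (?M ?J) (std_simplex ?J (sum x ?I))"
      using J by (rule nn_integral_cmult_indicator)
    also have "\<dots> = (indicator (std_simplex ?I 1) x * ennreal ((sum x ?I) ^ (m + 1))) * ennreal (1 / fact (m + 1))"
    proof (cases "x \<in> std_simplex ?I 1")
      case True
      then have "0 \<le> sum x ?I" by (auto simp: std_simplex_def intro: sum_nonneg)
      then have "emeasure (?M ?J) (std_simplex ?J (sum x ?I)) = ennreal ((sum x ?I) ^ (m + 1) / fact (m + 1))"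
        using emeasure_simplex[of ?J "sum x ?I"] cJ by simp
      also have "\<dots> = ennreal ((sum x ?I) ^ (m + 1)) * ennreal (1 / fact (m + 1))"
        using \<open>0 \<le> sum x ?I\<close> by (subst ennreal_mult[symmetric]) (auto intro: zero_le_power)
      finally show ?thesis using True by simp
    qed simp
    finally show "(\<integral>\<^sup>+ y. indicator (std_simplex ?I 1) x * indicator (std_simplex ?J (sum x ?I)) y \<partial>?M ?J)
      = (indicator (std_simplex ?I 1) x * ennreal ((sum x ?I) ^ (m + 1))) * ennreal (1 / fact (m + 1))" .
  qed
  also have "\<dots> = (\<integral>\<^sup>+ x. indicator (std_simplex ?I 1) x * ennreal ((sum x ?I) ^ (m + 1)) \<partial>?M ?I) * ennreal (1 / fact (m + 1))"
  proof (rule nn_integral_multc)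
    have [measurable]: "std_simplex ?I 1 \<in> sets (?M ?I)" by (intro simplex_sets) simp
    have [measurable]: "(\<lambda>x. sum x ?I) \<in> borel_measurable (?M ?I)" by measurable
    show "(\<lambda>x. indicator (std_simplex ?I 1) x * ennreal ((sum x ?I) ^ (m + 1))) \<in> borel_measurable (?M ?I)"
      by measurable
  qed
  also have "\<dots> = ennreal (real m / (real (2 * m + 1) * fact m)) * ennreal (1 / fact (m + 1))"
    using simplex_moment[of ?I m] assms by simp
  also have "\<dots> = ennreal (real m / (real (2 * m + 1) * fact m) * (1 / fact (m + 1)))"
    by (rule ennreal_mult[symmetric]) auto
  also have "real m / (real (2 * m + 1) * fact m) * (1 / fact (m + 1)) = 1 / (real (2 * m + 1) * fact (m - 1) * fact (m + 1))"
  proof -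
    have "fact m = real m * fact (m - 1)" using assms by (simp add: fact_reduce)
    moreover have "r / (n * (r * a)) * (1 / b) = 1 / (n * a * b)" if "r \<noteq> 0" for r n a b :: real
      using that by simp
    ultimately show ?thesis using assms by (metis of_nat_0_eq_iff less_irrefl)
  qed
  finally show ?thesis .
qed

section \<open>Summation over the Clemens complex\<close>

text \<open>The pairs \<open>(\<lambda>, \<mu>)\<close> for which the functional is nonnegative on both curves of the edge.\<close>
definition edge_cone :: "nat set \<Rightarrow> (real \<times> real) set" where
  "edge_cone e = {(l, u). \<forall>i\<in>e. 0 \<le> of_int (edge_alpha e i) * l + of_int (edge_beta e i) * u}"

lemma edge_cone_iff:
  "(l, u) \<in> edge_cone {5, 7} \<longleftrightarrow> 0 \<le> u \<and> 3 * u \<le> l"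
  "(l, u) \<in> edge_cone {4, 5} \<longleftrightarrow> l \<le> 3 * u \<and> 2 * u \<le> l"
  "(l, u) \<in> edge_cone {3, 4} \<longleftrightarrow> l \<le> 2 * u \<and> u \<le> l"
  "(l, u) \<in> edge_cone {3, 6} \<longleftrightarrow> 0 \<le> l \<and> l \<le> u"
  by (auto simp: edge_cone_def edge_alpha_def edge_beta_def)

text \<open>
  The rays of the four cones are spanned by \<open>(1,0)\<close>, \<open>(3,1)\<close>, \<open>(2,1)\<close>, \<open>(1,1)\<close>, \<open>(0,1)\<close>, in the order in
  which they sweep out the quadrant.
\<close>
lemma edge_cones_subdivide:
  assumes "l \<noteq> u" "l \<noteq> 2 * u" "l \<noteq> 3 * u"
  shows "(\<Sum>e\<in>clemens_edges. indicator (edge_cone e) (l, u)) = (if 0 \<le> l \<and> 0 \<le> u then 1 else 0 :: ennreal)"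
proof -
  have "(\<Sum>e\<in>clemens_edges. indicator (edge_cone e) (l, u)) =
     (indicator (edge_cone {5, 7}) (l, u) + (indicator (edge_cone {4, 5}) (l, u) +
     (indicator (edge_cone {3, 4}) (l, u) + indicator (edge_cone {3, 6}) (l, u))) :: ennreal)"
    using edges_distinct edges_distinct[symmetric] by (simp add: clemens_edges_def)
  also have "\<dots> = (if 0 \<le> l \<and> 0 \<le> u then 1 else 0)"
    unfolding indicator_def edge_cone_iff using assms by auto
  finally show ?thesis .
qed

text \<open>A line in the direction of the coordinate \<open>a\<close> meets the hyperplane in one point.\<close>
lemma AE_not_multiple:
  fixes c :: real
  assumes ab: "a < n" "b < n" "a \<noteq> b"
  shows "AE y in lborel_pow n. y a \<noteq> c * y b"
proof -
  interpret product_sigma_finite "\<lambda>_. lborel :: real measure" by (rule product_sigma_finite_lborel)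
  let ?N = "{y \<in> space (lborel_pow n). y a = c * y b}"
  let ?A = "{..<n} - {a}"
  have n: "{..<n} = insert a ?A" using ab by auto
  have N: "?N \<in> sets (lborel_pow n)"
    using component_measurable[OF ab(1)] component_measurable[OF ab(2)]
    by (intro borel_measurable_eq borel_measurable_times borel_measurable_const)
  have "emeasure (lborel_pow n) ?N = (\<integral>\<^sup>+ y. indicator ?N y \<partial>PiM (insert a ?A) (\<lambda>_. lborel))"
    using N unfolding n[symmetric] by simp
  also have "\<dots> = (\<integral>\<^sup>+ x. \<integral>\<^sup>+ t. indicator ?N (x(a := t)) \<partial>lborel \<partial>PiM ?A (\<lambda>_. lborel))"
    using N unfolding n[symmetric] by (intro product_nn_integral_insert[of ?A a "\<lambda>y. indicator ?N y", unfolded n[symmetric]]) auto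
  also have "\<dots> = (\<integral>\<^sup>+ x. 0 \<partial>PiM ?A (\<lambda>_. lborel :: real measure))"
  proof (rule nn_integral_cong)
    fix x :: "nat \<Rightarrow> real"
    have "(\<integral>\<^sup>+ t. indicator ?N (x(a := t)) \<partial>lborel) \<le> (\<integral>\<^sup>+ t. indicator {c * x b} t \<partial>(lborel :: real measure))"
      using ab by (intro nn_integral_mono) (auto simp: indicator_def)
    also have "\<dots> = 0" by simp
    finally show "(\<integral>\<^sup>+ t. indicator ?N (x(a := t)) \<partial>lborel) = (0 :: ennreal)" by simp
  qed
  finally have "emeasure (lborel_pow n) ?N = 0" by simp
  then show ?thesis using N by (intro AE_I[of _ _ ?N]) auto
qed

context max_face_chart
begin

lemma polytope_coords_alt:
  "polytope_coords = {y \<in> space (lborel_pow (2 * m + 1)). (0 \<le> y (2 * m) \<and>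
     y (2 * m) + (\<Sum>j<m. y (m + j)) \<le> (\<Sum>j<m. y j) \<and> (\<Sum>j<m. y j) \<le> 1) \<and>
     (\<forall>j<m. (y j, y (m + j)) \<in> edge_cone (B (h j)))}"
  by (auto simp: polytope_coords_def in_cone_def space_lborel_pow boundary_coord_def edge_cone_def simp del: PiE_iff)

lemma polytope_coords_sets: "polytope_coords \<in> sets (lborel_pow (2 * m + 1))"
proof -
  have s: "(\<lambda>y. \<Sum>j<m. y (m + j)) \<in> borel_measurable (lborel_pow (2 * m + 1))"
    "(\<lambda>y. \<Sum>j<m. y j) \<in> borel_measurable (lborel_pow (2 * m + 1))"
    by (intro component_sum_measurable; simp)+
  have c: "(\<lambda>y. y j) \<in> borel_measurable (lborel_pow (2 * m + 1))" if "j < 2 * m + 1" for j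
    using that by (rule component_measurable)
  have z: "(\<lambda>y. boundary_coord y j i) \<in> borel_measurable (lborel_pow (2 * m + 1))" if "j \<in> {..<m}" for i j
    unfolding boundary_coord_def using that
    by (intro borel_measurable_add borel_measurable_times borel_measurable_const c) auto
  have f: "finite (B (h j))" if "j \<in> {..<m}" for j using edge(2)[of j] that finite_subset by blast
  have "polytope_coords = {y \<in> space (lborel_pow (2 * m + 1)). 0 \<le> y (2 * m) \<and>
     (\<forall>j\<in>{..<m}. \<forall>i\<in>B (h j). 0 \<le> boundary_coord y j i) \<and>
     y (2 * m) + (\<Sum>j<m. y (m + j)) \<le> (\<Sum>j<m. y j) \<and> (\<Sum>j<m. y j) \<le> 1}"
    by (auto simp: polytope_coords_def in_cone_def space_lborel_pow simp del: PiE_iff)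
  also have "\<dots> \<in> sets (lborel_pow (2 * m + 1))"
    by (intro sets.sets_Collect_conj sets.sets_Collect_finite_All borel_measurable_le borel_measurable_add
        borel_measurable_const s c z f) auto
  finally show ?thesis .
qed

lemma alpha_B_eq:
  "alpha_B B = real (2 * m + 1) * measure (lborel_pow (2 * m + 1)) polytope_coords"
proof -
  have card: "card (places :: 'k place set) = m" using bij_betw_same_card[OF h] by simp
  have "polytope_B B \<subseteq> real_dual (Pic_UB B)" by (auto simp: polytope_B_def dual_effective_cone_def)
  then have "dual_volume (Pic_UB B) (polytope_B B) = measure (lborel_pow (2 * m + 1)) polytope_coords"
    using dual_volume_eq[OF comm_group_Pic_UB[OF B] is_Z_basis_basis] polytope_coords_sets
    unfolding polytope_image[symmetric] by blast
  then show ?thesis by (simp add: alpha_B_def card)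
qed

end

text \<open>
  Away from the walls, the sum over all faces of the products over the places is the product over
  the places of the sums over the edges, and each of these sums is the indicator of the quadrant.
\<close>
lemma sum_indicator_polytopes:
  fixes h :: "nat \<Rightarrow> 'k::field_char_0 place"
  assumes h: "bij_betw h {..<m} places" and m: "m > 0"
    and y: "y \<in> space (lborel_pow (2 * m + 1))"
    and gen: "\<And>j. j < m \<Longrightarrow> y j \<noteq> y (m + j) \<and> y j \<noteq> 2 * y (m + j) \<and> y j \<noteq> 3 * y (m + j)"
  shows "(\<Sum>B\<in>(clemens_max_faces :: ('k place \<Rightarrow> nat set) set). indicator (max_face_chart.polytope_coords B m h) y)
    = (indicator (total_region m) y :: ennreal)"
proof -
  define Q where "Q \<longleftrightarrow> 0 \<le> y (2 * m) \<and> y (2 * m) + (\<Sum>j<m. y (m + j)) \<le> (\<Sum>j<m. y j) \<and> (\<Sum>j<m. y j) \<le> 1"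
  define g where "g = inv_into {..<m} h"
  have gh: "g (h j) = j" if "j < m" for j using h that by (simp add: g_def bij_betw_inv_into_left)
  have fin: "finite (places :: 'k place set)" using h bij_betw_finite by blast
  have pr: "(\<Prod>v\<in>places. f v) = (\<Prod>j<m. f (h j))" for f :: "_ \<Rightarrow> ennreal"
    using prod.reindex_bij_betw[OF h, of f] by simp
  have ind: "indicator (max_face_chart.polytope_coords B m h) y =
      (if Q then 1 else 0) * (\<Prod>v\<in>places. indicator (edge_cone (B v)) (y (g v), y (m + g v)) :: ennreal)"
    if "B \<in> clemens_max_faces" for B :: "'k place \<Rightarrow> nat set"
  proof -
    interpret max_face_chart B m h using that h m by unfold_locales
    have p: "(\<Prod>j<m. indicator (S j) (z j) :: ennreal) = (if \<forall>j<m. z j \<in> S j then 1 else 0)" for S and z :: "nat \<Rightarrow> real \<times> real"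
      by (auto simp: indicator_def)
    have "(\<Prod>v\<in>places. indicator (edge_cone (B v)) (y (g v), y (m + g v)) :: ennreal)
      = (\<Prod>j<m. indicator (edge_cone (B (h j))) (y j, y (m + j)))"
      unfolding pr by (intro prod.cong) (auto simp: gh)
    also have "\<dots> = (if \<forall>j<m. (y j, y (m + j)) \<in> edge_cone (B (h j)) then 1 else 0)" by (rule p)
    finally have "(\<Prod>v\<in>places. indicator (edge_cone (B v)) (y (g v), y (m + g v)) :: ennreal)
      = (if \<forall>j<m. (y j, y (m + j)) \<in> edge_cone (B (h j)) then 1 else 0)" .
    moreover have "y \<in> polytope_coords \<longleftrightarrow> Q \<and> (\<forall>j<m. (y j, y (m + j)) \<in> edge_cone (B (h j)))"
      using y unfolding polytope_coords_alt Q_def by blast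
    ultimately show ?thesis by (simp add: indicator_def)
  qed
  have "(\<Sum>B\<in>(clemens_max_faces :: ('k place \<Rightarrow> nat set) set). indicator (max_face_chart.polytope_coords B m h) y)
    = (\<Sum>B\<in>places \<rightarrow>\<^sub>E clemens_edges. (if Q then 1 else 0) * (\<Prod>v\<in>places. indicator (edge_cone (B v)) (y (g v), y (m + g v)) :: ennreal))"
    unfolding clemens_max_faces_def[symmetric] using ind by (intro sum.cong) auto
  also have "\<dots> = (if Q then 1 else 0) * (\<Prod>v\<in>places. \<Sum>e\<in>clemens_edges. indicator (edge_cone e) (y (g v), y (m + g v)))"
    unfolding sum_distrib_left[symmetric]
    by (subst prod_sum_PiE) (use fin in \<open>auto simp: clemens_edges_def\<close>)
  also have "(\<Prod>v\<in>places. \<Sum>e\<in>clemens_edges. indicator (edge_cone e) (y (g v), y (m + g v)) :: ennreal)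
    = (\<Prod>j<m. if 0 \<le> y j \<and> 0 \<le> y (m + j) then 1 else 0)"
    unfolding pr
  proof (intro prod.cong refl)
    fix j assume "j \<in> {..<m}"
    then show "(\<Sum>e\<in>clemens_edges. indicator (edge_cone e) (y (g (h j)), y (m + g (h j)))) = (if 0 \<le> y j \<and> 0 \<le> y (m + j) then 1 else 0 :: ennreal)"
      using edge_cones_subdivide[of "y j" "y (m + j)"] gen[of j] gh[of j] by simp
  qed
  also have "\<dots> = (if \<forall>j<m. 0 \<le> y j \<and> 0 \<le> y (m + j) then 1 else 0)"
    by auto
  also have "(if Q then 1 else 0) * (if \<forall>j<m. 0 \<le> y j \<and> 0 \<le> y (m + j) then 1 else 0) = (indicator (total_region m) y :: ennreal)"
  proof -
    have "(\<forall>j<2 * m + 1. 0 \<le> y j) \<longleftrightarrow> 0 \<le> y (2 * m) \<and> (\<forall>j<m. 0 \<le> y j \<and> 0 \<le> y (m + j))"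
    proof (intro iffI allI impI)
      fix j assume a: "0 \<le> y (2 * m) \<and> (\<forall>j<m. 0 \<le> y j \<and> 0 \<le> y (m + j))" and j: "j < 2 * m + 1"
      consider "j < m" | "j = 2 * m" | "j = m + (j - m)" "j - m < m" using j by linarith
      then show "0 \<le> y j"
      proof cases
        case 3
        have "0 \<le> y (m + (j - m))" using a 3(2) by blast
        then show ?thesis using 3(1) by simp
      qed (use a in auto)
    qed auto
    then have "y \<in> total_region m \<longleftrightarrow> Q \<and> (\<forall>j<m. 0 \<le> y j \<and> 0 \<le> y (m + j))"
      using y unfolding total_region_def space_lborel_pow Q_def by blast
    then show ?thesis by (simp add: indicator_def)
  qed
  finally show ?thesis .
qed

text \<open>
  The polytopes overlap in null sets only, so their volumes add up to the volume of \<open>total_region\<close>;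
  the rank \<open>2m + 1\<close> cancels.
\<close>
lemma sum_alpha_B:
  assumes card: "card (places :: 'k::field_char_0 place set) = m" and m: "m > 0"
  shows "(\<Sum>B\<in>(clemens_max_faces :: ('k place \<Rightarrow> nat set) set). alpha_B B) = 1 / (fact (m - 1) * fact (m + 1))"
proof -
  let ?faces = "clemens_max_faces :: ('k place \<Rightarrow> nat set) set"
  let ?M = "lborel_pow (2 * m + 1)"
  have finp: "finite (places :: 'k place set)" using card m by (metis card.infinite less_irrefl)
  obtain h :: "nat \<Rightarrow> 'k place" where h: "bij_betw h {..<m} places"
    using ex_bij_betw_nat_finite[OF finp] card by (auto simp: atLeast0LessThan)
  define S where "S B = max_face_chart.polytope_coords B m h" for B
  have chart: "max_face_chart B m h" if "B \<in> ?faces" for B using that h m by unfold_locales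
  have S: "S B \<in> sets ?M" if "B \<in> ?faces" for B
    unfolding S_def by (rule max_face_chart.polytope_coords_sets[OF chart[OF that]])
  have fin: "finite ?faces" unfolding clemens_max_faces_def
    using finp by (intro finite_PiE) (auto simp: clemens_edges_def)
  have "(\<Sum>B\<in>?faces. emeasure ?M (S B)) = (\<Sum>B\<in>?faces. \<integral>\<^sup>+ y. indicator (S B) y \<partial>?M)"
    using S by simp
  also have "\<dots> = (\<integral>\<^sup>+ y. (\<Sum>B\<in>?faces. indicator (S B) y) \<partial>?M)"
    using S by (intro nn_integral_sum[symmetric]) auto
  also have "\<dots> = (\<integral>\<^sup>+ y. indicator (total_region m) y \<partial>?M)"
  proof (rule nn_integral_cong_AE)
    have "AE y in ?M. \<forall>j\<in>{..<m}. y j \<noteq> 1 * y (m + j) \<and> y j \<noteq> 2 * y (m + j) \<and> y j \<noteq> 3 * y (m + j)"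
      using m by (intro AE_finite_allI AE_conjI AE_not_multiple) auto
    then show "AE y in ?M. (\<Sum>B\<in>?faces. indicator (S B) y) = (indicator (total_region m) y :: ennreal)"
    proof (rule AE_mp, intro AE_I2 impI)
      fix y assume "y \<in> space ?M" "\<forall>j\<in>{..<m}. y j \<noteq> 1 * y (m + j) \<and> y j \<noteq> 2 * y (m + j) \<and> y j \<noteq> 3 * y (m + j)"
      then show "(\<Sum>B\<in>?faces. indicator (S B) y) = (indicator (total_region m) y :: ennreal)"
        unfolding S_def by (intro sum_indicator_polytopes[OF h m]) auto
    qed
  qed
  also have "\<dots> = ennreal (1 / (real (2 * m + 1) * fact (m - 1) * fact (m + 1)))"
    using total_region_sets[of m] emeasure_total_region[OF m] by simp
  finally have sum: "(\<Sum>B\<in>?faces. emeasure ?M (S B)) = ennreal (1 / (real (2 * m + 1) * fact (m - 1) * fact (m + 1)))" .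
  have top: "emeasure ?M (S B) < \<infinity>" if "B \<in> ?faces" for B
  proof -
    have "emeasure ?M (S B) \<le> (\<Sum>B\<in>?faces. emeasure ?M (S B))" using fin that by (intro member_le_sum) auto
    also have "\<dots> < \<infinity>" unfolding sum by simp
    finally show ?thesis .
  qed
  have "(\<Sum>B\<in>?faces. emeasure ?M (S B)) = (\<Sum>B\<in>?faces. ennreal (measure ?M (S B)))"
  proof (intro sum.cong refl emeasure_eq_ennreal_measure)
    show "emeasure ?M (S B) \<noteq> top_class.top" if "B \<in> ?faces" for B using top[OF that] by simp
  qed
  also have "\<dots> = ennreal (\<Sum>B\<in>?faces. measure ?M (S B))" by (rule sum_ennreal) simp
  finally have "ennreal (\<Sum>B\<in>?faces. measure ?M (S B)) = (\<Sum>B\<in>?faces. emeasure ?M (S B))" by simp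
  then have "(\<Sum>B\<in>?faces. measure ?M (S B)) = 1 / (real (2 * m + 1) * fact (m - 1) * fact (m + 1))"
    unfolding sum by (subst (asm) ennreal_inj) (auto intro: sum_nonneg)
  moreover have "(\<Sum>B\<in>?faces. alpha_B B) = real (2 * m + 1) * (\<Sum>B\<in>?faces. measure ?M (S B))"
    unfolding sum_distrib_left S_def
    by (intro sum.cong refl max_face_chart.alpha_B_eq chart)
  ultimately show ?thesis by (simp del: of_nat_add of_nat_mult of_nat_Suc fact_Suc)
qed

theorem proposition1p2:
  fixes q :: nat
  assumes "is_number_field TYPE('k::field_char_0)"
    and "q = unit_rank TYPE('k)"
    and "card (archimedean_places :: ('k \<Rightarrow> real) set set) = q + 1"
  shows "let \<alpha> = 1 / (fact q)\<^sup>2 *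
               (LINT t:{t :: real \<times> real. 0 \<le> fst t \<and> 0 \<le> snd t \<and> fst t + snd t \<le> 1}|lborel.
                  (1 - fst t - snd t) ^ q)
         in \<alpha> = 1 / (fact q * fact (q + 2)) \<and>
            \<alpha> = (\<Sum>B\<in>(clemens_max_faces :: (('k \<Rightarrow> real) set \<Rightarrow> nat set) set). alpha_B B)"
proof -
  have "(\<Sum>B\<in>(clemens_max_faces :: (('k \<Rightarrow> real) set \<Rightarrow> nat set) set). alpha_B B) = 1 / (fact q * fact (q + 2))"
    using sum_alpha_B[OF assms(3)] by simp
  moreover have "1 / (fact q)\<^sup>2 * (1 / (real (q + 1) * real (q + 2))) = 1 / (fact q * fact (q + 2) :: real)"
  proof -
    have "fact (q + 2) = real (q + 2) * (real (q + 1) * fact q)" by (simp add: numeral_2_eq_2)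
    then show ?thesis by (simp add: power2_eq_square divide_simps del: fact_Suc)
  qed
  ultimately show ?thesis unfolding Let_def triangle_integral by simp
qed

end
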